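(* Fix a tuning parameter $\alpha\ge 0$. Consider the model, estimator and conditions described in the context. Assume that conditions (A0), (A1), (A2), (A3), (A4), (A5), (A6) and $\mathbf A_0(\Theta)$ hold, that the moment condition (M) holds with some $\epsilon>2$, and that there exists $\gamma>1$ such that $\alpha_k^{(0)}=\mathcal O(k^{-\gamma})$ and $\sum_{k\ge 1}k^{-\gamma}\max(\bar\varphi_k,\bar\psi_k)<\infty$ (where $\alpha_k^{(0)}$ are the Lipschitz coefficients in $\mathbf A_0(\Theta)$ and $\bar\varphi_k,\bar\psi_k$ are the constants in (A4), (A5)). Then the minimum density power divergence estimator satisfies $\widehat\theta_{\alpha,n}\to\theta^*$ almost surely as $n\to\infty$.
   Context: Model. Let $\{Y_t,t\in\mathbb Z\}$ be an $\mathbb N_0$-valued time series ($\mathbb N_0=\mathbb N\cup\{0\}$) and $X_t=(X_{1,t},\dots,X_{d_x,t})\in\mathbb R^{d_x}$ a vector of covariates. Let $\mathcal F_{t-1}=\sigma\{Y_{t-1},Y_{t-2},\dots;X_{t-1},X_{t-2},\dots\}$. For $\theta$ in a compact set $\Theta\subset\mathbb R^d$ let $\lambda_t(\theta)=f_\theta(Y_{t-1},Y_{t-2},\dots;X_{t-1},X_{t-2},\dots)$, where $f_\theta$ is a known (up to $\theta$) measurable non-negative function on $\mathbb N_0^{\mathbb N}\times(\mathbb R^{d_x})^{\mathbb N}$. Conditionally on $\mathcal F_{t-1}$, $Y_t$ has probability mass function $g(\cdot\mid\eta_t)$ on $\mathbb N_0$, where $\eta_t=\eta(\lambda_t(\theta^*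 ))$ for a known function $\eta$ (the natural parameter), $\theta^*\in\Theta$ is the unknown true parameter and $\mathbb E(Y_t\mid\mathcal F_{t-1})=\lambda_t(\theta^* )$. Write $\eta_t(\theta)=\eta(\lambda_t(\theta))$. The $Y_t$ have the same distribution, and the support $\{y: g(y\mid\eta_t(\theta))>0\}$ does not depend on $\theta$. Standing assumption: there is a stationary ergodic process $(Y_t,\lambda_t,X_t)$ solving the model. Norms: $\|x\|=\sup_i|x_i|$ for vectors (and any matrix norm for matrices); $\|f\|_\Theta=\sup_{\theta\in\Theta}\|f(\theta)\|$; $\|Z\|_r=(\mathbb E\|Z\|^r)^{1/r}$. Moment condition (M) with parameter $\epsilon$: there is $C>0$ with $\mathbb E\|(Y_t,\lambda_t,X_t)\|^{1+\epsilon}<C$ for all $t$. Estimator. Given observations $(Y_1,X_1),\dots,(Y_n,X_n)$, let $\widehat\lambda_t(\theta)=f_\theta(Y_{t-1},\dots,Y_1,0,0,\dots;X_{t-1},\dots,X_1,0,0,\dots)$ and $\widehat\eta_t(\theta)=\eta(\widehat\lambda_t(\theta))$. For $\alpha>0$ let $\ell_{\alpha,t}(\theta)=\sum_{y=0}^\infty g(y\mid\eta_t(\theta))^{1+\alpha}-(1+\frac1\alpha)g(Y_t\mid\eta_t(\theta))^\alpha$, and for $\alpha=0$ let $\ell_{0,t}(\theta)=-\log g(Y_t\mid\eta_t(\theta))$; $\widehat\ell_{\alpha,t}(\theta)$ is defined identically with $\eta_t(\theta)$ replaced by $\widehat\eta_t(\theta)$. Let $H_{\alpha,n}(\theta)=\frac1n\sum_{t=1}^n\ell_{\alpha,t}(\theta)$,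 $\widehat H_{\alpha,n}(\theta)=\frac1n\sum_{t=1}^n\widehat\ell_{\alpha,t}(\theta)$, and $\widehat\theta_{\alpha,n}=\operatorname{argmin}_{\theta\in\Theta}\widehat H_{\alpha,n}(\theta)$. Condition $\mathbf A_0(\Theta)$: for every $(y,x)$, $\theta\mapsto f_\theta(y,x)$ is continuous on $\Theta$, $\|f_\theta(0)\|_\Theta<\infty$, and there are non-negative $(\alpha_k^{(0)})_{k\ge1}$ with $\sum_k\alpha_k^{(0)}<1$ such that $\|f_\theta(y,x)-f_\theta(y',x')\|_\Theta\le\sum_{k\ge1}\alpha_k^{(0)}(|y_k-y'_k|+\|x_k-x'_k\|)$ for all $(y,x),(y',x')\in\mathbb N_0^{\mathbb N}\times(\mathbb R^{d_x})^{\mathbb N}$. (A0): for all $\theta,\theta'\in\Theta$, if $f_\theta(Y_{t-1},\dots;X_{t-1},\dots)=f_{\theta'}(Y_{t-1},\dots;X_{t-1},\dots)$ a.s. for some $t$ then $\theta=\theta'$; and there is $\underline c>0$ with $\inf_{\theta\in\Theta}f_\theta(y,x)\ge\underline c$ for all $(y,x)$. (A1): $\theta^*$ is an interior point of $\Theta$. (A2): there is $\underline\lambda$ with $\mathbb E\|\lambda_t(\theta)\|_\Theta^4=\underline\lambda<\infty$ for all $t\ge1$. (A3): for all $y\in\mathbb N_0$, $\eta\mapsto g(y\mid\eta)$ is twice continuously differentiable on $\mathbb R$, and if $g(y\mid\eta)=g(y\mid\eta')$ for all $y\in\mathbb N_0$ then $\eta=\eta'$. (A4): $\varphi(\eta)=\sum_{y=0}^\infty|\partial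 g(y\mid\eta)/\partial\eta|$ is well defined on $\mathbb R$ and for every $t\ge1$ there is $\bar\varphi_t>0$ with $\sup_{0\le\delta\le1}\big\|\,\|\varphi(\delta\eta_t(\theta)+(1-\delta)\widehat\eta_t(\theta))\|_\Theta\big\|_2\le\bar\varphi_t<\infty$. (A5): for all $t\ge1$, $\psi(\eta)=\big|\frac{1}{g(Y_t\mid\eta)}\frac{\partial g(Y_t\mid\eta)}{\partial\eta}\big|$ is well defined on $\mathbb R$ and there is $\bar\psi_t>0$ with $\sup_{0\le\delta\le1}\big\|\,\|\psi(\delta\eta_t(\theta)+(1-\delta)\widehat\eta_t(\theta))\|_\Theta\big\|_2\le\bar\psi_t<\infty$. (A6): $\lambda\mapsto\eta(\lambda)$, defined on $[\underline c,\infty)$, satisfies $|\eta(\lambda)-\eta(\lambda')|\le c_\eta|\lambda-\lambda'|$ for some $c_\eta>0$, and $\eta(\lambda)=\eta(\lambda')$ implies $\lambda=\lambda'$. *)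

theory Defs
  imports "HOL-Probability.Probability" "HOL-Library.Landau_Symbols"
begin

definition supn :: "real ^ 'd \<Rightarrow> real" where
  "supn x = Max (range (\<lambda>i. \<bar>x $ i\<bar>))"

(* infinite past (Y_{t-1}, Y_{t-2}, ...), (X_{t-1}, ...): entry k (k \<ge> 1) is the lag-k value;
   entry 0 is unused and set to 0 *)
definition lagY :: "(int \<Rightarrow> 'a \<Rightarrow> nat) \<Rightarrow> int \<Rightarrow> 'a \<Rightarrow> nat \<Rightarrow> nat" where
  "lagY Y t \<omega> = (\<lambda>k. if k = 0 then 0 else Y (t - int k) \<omega>)"
definition lagX :: "(int \<Rightarrow> 'a \<Rightarrow> real ^ 'd) \<Rightarrow> int \<Rightarrow> 'a \<Rightarrow> nat \<Rightarrow> real ^ 'd" where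
  "lagX X t \<omega> = (\<lambda>k. if k = 0 then 0 else X (t - int k) \<omega>)"

definition tlagY :: "(int \<Rightarrow> 'a \<Rightarrow> nat) \<Rightarrow> int \<Rightarrow> 'a \<Rightarrow> nat \<Rightarrow> nat" where
  "tlagY Y t \<omega> = (\<lambda>k. if 1 \<le> k \<and> int k < t then Y (t - int k) \<omega> else 0)"
definition tlagX :: "(int \<Rightarrow> 'a \<Rightarrow> real ^ 'd) \<Rightarrow> int \<Rightarrow> 'a \<Rightarrow> nat \<Rightarrow> real ^ 'd" where
  "tlagX X t \<omega> = (\<lambda>k. if 1 \<le> k \<and> int k < t then X (t - int k) \<omega> else 0)"

definition lam :: "('p \<Rightarrow> (nat \<Rightarrow> nat) \<Rightarrow> (nat \<Rightarrow> real ^ 'd) \<Rightarrow> real) \<Rightarrow>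
    (int \<Rightarrow> 'a \<Rightarrow> nat) \<Rightarrow> (int \<Rightarrow> 'a \<Rightarrow> real ^ 'd) \<Rightarrow> 'p \<Rightarrow> int \<Rightarrow> 'a \<Rightarrow> real" where
  "lam f Y X \<theta> t \<omega> = f \<theta> (lagY Y t \<omega>) (lagX X t \<omega>)"
definition lamhat :: "('p \<Rightarrow> (nat \<Rightarrow> nat) \<Rightarrow> (nat \<Rightarrow> real ^ 'd) \<Rightarrow> real) \<Rightarrow>
    (int \<Rightarrow> 'a \<Rightarrow> nat) \<Rightarrow> (int \<Rightarrow> 'a \<Rightarrow> real ^ 'd) \<Rightarrow> 'p \<Rightarrow> int \<Rightarrow> 'a \<Rightarrow> real" where
  "lamhat f Y X \<theta> t \<omega> = f \<theta> (tlagY Y t \<omega>) (tlagX X t \<omega>)"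

definition dpd_loss :: "real \<Rightarrow> (nat \<Rightarrow> real \<Rightarrow> real) \<Rightarrow> real \<Rightarrow> nat \<Rightarrow> real" where
  "dpd_loss a g e y = (if a = 0 then - ln (g y e)
     else (\<Sum>z. g z e powr (1 + a)) - (1 + 1 / a) * g y e powr a)"

definition Hhat :: "real \<Rightarrow> (nat \<Rightarrow> real \<Rightarrow> real) \<Rightarrow> (real \<Rightarrow> real) \<Rightarrow>
    ('p \<Rightarrow> (nat \<Rightarrow> nat) \<Rightarrow> (nat \<Rightarrow> real ^ 'd) \<Rightarrow> real) \<Rightarrow>
    (int \<Rightarrow> 'a \<Rightarrow> nat) \<Rightarrow> (int \<Rightarrow> 'a \<Rightarrow> real ^ 'd) \<Rightarrow> nat \<Rightarrow> 'p \<Rightarrow> 'a \<Rightarrow> real" where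
  "Hhat a g eta f Y X n \<theta> \<omega> =
     (1 / real n) * (\<Sum>t\<in>{1..n}. dpd_loss a g (eta (lamhat f Y X \<theta> (int t) \<omega>)) (Y (int t) \<omega>))"

definition past :: "'a measure \<Rightarrow> (int \<Rightarrow> 'a \<Rightarrow> nat) \<Rightarrow> (int \<Rightarrow> 'a \<Rightarrow> real ^ 'd) \<Rightarrow> int \<Rightarrow> 'a measure" where
  "past M Y X s = sigma (space M)
     ({Y u -` A \<inter> space M | u A. u \<le> s} \<union>
      {X u -` B \<inter> space M | u B. u \<le> s \<and> B \<in> sets borel})"

definition stationary_proc :: "'a measure \<Rightarrow> 'b measure \<Rightarrow> (int \<Rightarrow> 'a \<Rightarrow> 'b) \<Rightarrow> bool" where
  "stationary_proc M N Z \<longleftrightarrow>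
     distr M (PiM UNIV (\<lambda>_. N)) (\<lambda>\<omega> t. Z (t + 1) \<omega>) = distr M (PiM UNIV (\<lambda>_. N)) (\<lambda>\<omega> t. Z t \<omega>)"

definition ergodic_proc :: "'a measure \<Rightarrow> 'b measure \<Rightarrow> (int \<Rightarrow> 'a \<Rightarrow> 'b) \<Rightarrow> bool" where
  "ergodic_proc M N Z \<longleftrightarrow>
     (\<forall>B \<in> sets (PiM UNIV (\<lambda>_. N)).
        (\<lambda>z t. z (t + 1)) -` B \<inter> space (PiM UNIV (\<lambda>_. N)) = B \<longrightarrow>
        measure M {\<omega> \<in> space M. (\<lambda>t. Z t \<omega>) \<in> B} \<in> {0, 1})"

end

theory Submission
  imports Defs
begin

text \<open>Wald's consistency argument for a stationary ergodic sequence. On path space, the averages of a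
  function with negative mean have bounded partial sums (Garsia), which yields the one-sided ergodic
  theorem needed to compare local infima of the loss with its value at the true parameter. The risk is
  uniquely minimised at the true parameter, since conditionally on the past the excess risk is a density
  power (or Kullback-Leibler) divergence; it is finite there even for \<open>a = 0\<close>, because a law on the naturals
  with finite mean has finite entropy. Replacing the infinite past by the observed one changes the loss at
  time \<open>t\<close> by at most a random variable of mean \<open>O(t powr (1 - \<gamma>) * max (phib t) (psib t))\<close>, uniformly in the
  parameter; dividing by \<open>t\<close> gives an almost surely convergent series, so by Kronecker's lemma the averaged
  error vanishes.\<close>

section \<open>The one-sided ergodic theorem\<close>

text \<open>Three obstacles shape the proof. For \<open>a = 0\<close> the loss has no upper bound,
  and nothing makes it integrable away from \<open>\<theta>s\<close>. It is therefore shifted by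
  \<open>1 + 1 / a\<close> to be nonnegative, risks are nonnegative integrals that may be infinite,
  and the ergodic theorem is applied one-sidedly: from below to capped local infima, from above to
  the loss at \<open>\<theta>s\<close>. Next, (A4) and (A5) bound moments at each fixed position
  \<delta> of the segment between true and truncated natural parameter. A mean value point would
  depend on the outcome and on the parameter, so loss differences are written as integrals over
  \<delta> and Fubini's theorem moves the expectation inside. Finally, infima and suprema over an
  uncountable parameter set need not be measurable; they are taken over countable dense subsets, and
  continuity in the parameter recovers the whole set. The exponent \<open>1 - \<gamma>\<close> is
  that of the tail of \<open>k powr (- \<gamma>)\<close> from \<open>k = t\<close> on: at time
  \<open>t\<close> exactly the lags from \<open>t\<close> on are unobserved.\<close>

locale ergodic_map = prob_space M for M :: "'a measure" +
  fixes T :: "'a \<Rightarrow> 'a"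
  assumes measurable_T [measurable]: "T \<in> M \<rightarrow>\<^sub>M M"
    and distr_T: "distr M M T = M"
    and ergodic: "A \<in> sets M \<Longrightarrow> T -` A \<inter> space M = A \<Longrightarrow> prob A \<in> {0, 1}"
begin

lemma T_space: "x \<in> space M \<Longrightarrow> T x \<in> space M"
  using measurable_T by (rule measurable_space)

lemma integral_T:
  fixes h :: "'a \<Rightarrow> real"
  assumes [measurable]: "h \<in> borel_measurable M"
  shows "(\<integral>x. h (T x) \<partial>M) = (\<integral>x. h x \<partial>M)"
  using integral_distr[of T M M h] by (simp add: distr_T)

lemma integrable_T:
  fixes h :: "'a \<Rightarrow> real"
  assumes "integrable M h"
  shows "integrable M (\<lambda>x. h (T x))"
  using integrable_distr_eq[of T M M h] assms by (simp add: distr_T)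

text \<open>This is the largest of the Birkhoff sums of lengths 0 to \<open>n\<close>. Recursing
  over the first point of the orbit makes the identity behind Garsia's argument hold by
  definition.\<close>

fun running_max :: "('a \<Rightarrow> real) \<Rightarrow> nat \<Rightarrow> 'a \<Rightarrow> real" where
  "running_max h 0 x = 0"
| "running_max h (Suc n) x = max 0 (h x + running_max h n (T x))"

lemma running_max_nonneg: "0 \<le> running_max h n x"
  by (cases n) auto

lemma running_max_Suc_ge: "running_max h n x \<le> running_max h (Suc n) x"
proof (induction n arbitrary: x)
  case (Suc n)
  have "h x + running_max h n (T x) \<le> h x + running_max h (Suc n) (T x)"
    using Suc[of "T x"] by (simp del: running_max.simps(2))
  then show ?case
    unfolding running_max.simps(2)[of h n x] running_max.simps(2)[of h "Suc n" x] by linarith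
qed auto

lemma running_max_mono: "m \<le> n \<Longrightarrow> running_max h m x \<le> running_max h n x"
  by (rule lift_Suc_mono_le[of "\<lambda>n. running_max h n x"]) (rule running_max_Suc_ge)

lemma sum_le_running_max: "(\<Sum>i<n. h ((T ^^ i) x)) \<le> running_max h n x"
proof (induction n arbitrary: x)
  case (Suc n)
  have "(\<Sum>i<Suc n. h ((T ^^ i) x)) = h x + (\<Sum>i<n. h ((T ^^ i) (T x)))"
    by (subst sum.lessThan_Suc_shift) (simp add: funpow_swap1)
  then show ?case using Suc[of "T x"] by auto
qed auto

lemma integrable_running_max:
  assumes "integrable M h"
  shows "integrable M (running_max h n)"
proof (induction n)
  case (Suc n)
  have "running_max h (Suc n) = (\<lambda>x. max 0 (h x + running_max h n (T x)))"
    by auto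
  then show ?case
    using assms integrable_T[OF Suc] by auto
qed (simp add: fun_eq_iff cong: Bochner_Integration.integrable_cong)

text \<open>Garsia's argument: on the invariant set where the running maxima are unbounded,
  the increments \<open>running_max (n + 1) - running_max n \<circ> T\<close> converge to \<open>h\<close>, while their
  integrals are nonnegative by monotonicity and invariance.\<close>

lemma partial_sums_bounded_above:
  fixes h :: "'a \<Rightarrow> real"
  assumes h: "integrable M h" and neg: "(\<integral>x. h x \<partial>M) < 0"
  shows "AE x in M. bdd_above (range (\<lambda>n. \<Sum>i<n. h ((T ^^ i) x)))"
proof -
  let ?m = "running_max h"
  define A where "A = {x \<in> space M. \<forall>K::nat. \<exists>n. real K < ?m n x}"
  note [measurable] = borel_measurable_integrable[OF h]
    borel_measurable_integrable[OF integrable_running_max[OF h]]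
  have A[measurable]: "A \<in> sets M"
    unfolding A_def by measurable
  have shift: "(\<forall>K::nat. \<exists>n. real K < ?m n (T x)) \<longleftrightarrow> (\<forall>K::nat. \<exists>n. real K < ?m n x)" for x
  proof (intro iffI allI)
    fix K :: nat
    assume *: "\<forall>K::nat. \<exists>n. real K < ?m n (T x)"
    obtain L :: nat where L: "real K - h x \<le> real L"
      using real_arch_simple by blast
    obtain n where "real L < ?m n (T x)" using * by blast
    then have "real K < ?m (Suc n) x" using L by auto
    then show "\<exists>n. real K < ?m n x" by blast
  next
    fix K :: nat
    assume *: "\<forall>K::nat. \<exists>n. real K < ?m n x"
    obtain L :: nat where L: "real K + \<bar>h x\<bar> \<le> real L"
      using real_arch_simple by blast
    obtain n where n: "real L < ?m n x" using * by blast
    then have "real L < ?m (Suc n) x" using running_max_Suc_ge[of h n x] by linarith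
    then have "real K < ?m n (T x)" using L by (auto simp: max_def split: if_splits)
    then show "\<exists>n. real K < ?m n (T x)" by blast
  qed
  have inv: "T -` A \<inter> space M = A"
    using T_space by (auto simp: A_def shift)
  have indT: "indicator A (T x) = (indicator A x :: real)" if "x \<in> space M" for x
    using inv that by (auto simp: indicator_def)
  have "prob A \<noteq> 1"
  proof
    assume "prob A = 1"
    then have AE_A: "AE x in M. x \<in> A"
      by (simp add: prob_eq_1)
    let ?d = "\<lambda>n x. indicator A x * (?m (Suc n) x - ?m n (T x)) :: real"
    have "(\<lambda>n. \<integral>x. ?d n x \<partial>M) \<longlonglongrightarrow> (\<integral>x. h x \<partial>M)"
    proof (rule integral_dominated_convergence[where w = "\<lambda>x. \<bar>h x\<bar>"])
      show "AE x in M. (\<lambda>n. ?d n x) \<longlonglongrightarrow> h x"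
      proof (rule AE_mp[OF AE_A], rule AE_I2, rule impI)
        fix x assume x: "x \<in> A"
        obtain L :: nat where L: "\<bar>h x\<bar> \<le> real L"
          using real_arch_simple by blast
        have "\<forall>K::nat. \<exists>n. real K < ?m n (T x)"
          using x by (simp add: shift A_def)
        then obtain N where N: "real L < ?m N (T x)"
          by blast
        have "\<forall>\<^sub>F n in sequentially. ?d n x = h x"
        \<comment> \<open>As soon as \<open>?m n (T x)\<close> exceeds the absolute value of
          \<open>h x\<close>, the maximum with 0 is inactive and the increment equals
          \<open>h x\<close> exactly.\<close>
        proof (rule eventually_sequentiallyI)
          fix n assume "N \<le> n"
          then have "real L < ?m n (T x)"
            using N running_max_mono[of N n h "T x"] by linarith
          then show "?d n x = h x" using L x by (auto simp: max_def)
        qed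
        then show "(\<lambda>n. ?d n x) \<longlonglongrightarrow> h x"
          by (rule tendsto_eventually)
      qed
      \<comment> \<open>If the maximum is active with value 0, then
        \<open>h x + ?m n (T x) \<le> 0\<close>, so the increment \<open>- ?m n (T x)\<close> lies
        between \<open>h x\<close> and 0; otherwise it is \<open>h x\<close>.\<close>
      show "AE x in M. norm (?d n x) \<le> \<bar>h x\<bar>" for n
      proof (rule AE_I2)
        fix x
        show "norm (?d n x) \<le> \<bar>h x\<bar>"
          using running_max_nonneg[of h n "T x"] by (auto simp: indicator_def max_def)
      qed
    qed (use h in auto)
    moreover have "0 \<le> (\<integral>x. ?d n x \<partial>M)" for n
    proof -
      have i: "integrable M (\<lambda>x. indicator A x * ?m k x)" for k
        using integrable_real_mult_indicator[OF A integrable_running_max[OF h, of k]]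
        by (simp add: mult.commute)
      have i': "integrable M (\<lambda>x. indicator A x * ?m k (T x))" for k
        using integrable_real_mult_indicator[OF A integrable_T[OF integrable_running_max[OF h, of k]]]
        by (simp add: mult.commute)
      have "(\<integral>x. indicator A x * ?m n (T x) \<partial>M) = (\<integral>x. indicator A (T x) * ?m n (T x) \<partial>M)"
        by (rule Bochner_Integration.integral_cong) (auto simp: indT)
      also have "\<dots> = (\<integral>x. indicator A x * ?m n x \<partial>M)"
        by (rule integral_T[where h = "\<lambda>x. indicator A x * ?m n x"]) measurable
      also have "\<dots> \<le> (\<integral>x. indicator A x * ?m (Suc n) x \<partial>M)"
        by (rule integral_mono[OF i i]) (intro mult_left_mono running_max_Suc_ge, auto)
      finally show ?thesis
        using i[of "Suc n"] i'[of n] by (simp add: right_diff_distrib del: running_max.simps)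
    qed
    ultimately have "0 \<le> (\<integral>x. h x \<partial>M)"
      by (intro LIMSEQ_le_const) auto
    with neg show False by simp
  qed
  then have "prob A = 0"
    using ergodic[OF A inv] by auto
  then have "AE x in M. x \<notin> A"
    by (simp add: prob_eq_0)
  then show ?thesis
  proof (rule AE_mp, intro AE_I2 impI)
    fix x assume "x \<in> space M" "x \<notin> A"
    then obtain K :: nat where K: "\<And>n. ?m n x \<le> real K"
      by (auto simp: A_def not_less)
    show "bdd_above (range (\<lambda>n. \<Sum>i<n. h ((T ^^ i) x)))"
      by (rule bdd_aboveI2[of _ _ "real K"]) (rule order_trans[OF sum_le_running_max K])
  qed
qed

text \<open>Subtracting a level \<open>b'\<close> strictly between the mean and \<open>b\<close>
  makes the mean negative. The sums of \<open>h\<close> are then at most \<open>K + n * b'\<close>,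
  and the margin \<open>n * (b - b')\<close> eventually absorbs the random constant
  \<open>K\<close>.\<close>

lemma ergodic_average_less:
  fixes h :: "'a \<Rightarrow> real"
  assumes h: "integrable M h" and b: "(\<integral>x. h x \<partial>M) < b"
  shows "AE x in M. \<forall>\<^sub>F n in sequentially. (\<Sum>i<n. h ((T ^^ i) x)) / real n < b"
proof -
  define b' where "b' = ((\<integral>x. h x \<partial>M) + b) / 2"
  have b': "(\<integral>x. h x \<partial>M) < b'" "b' < b"
    using b by (auto simp: b'_def)
  have "AE x in M. bdd_above (range (\<lambda>n. \<Sum>i<n. h ((T ^^ i) x) - b'))"
    by (rule partial_sums_bounded_above[where h = "\<lambda>x. h x - b'"]) (use h b' prob_space in auto)
  then show ?thesis
  proof (rule AE_mp, intro AE_I2 impI)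
    fix x assume "bdd_above (range (\<lambda>n. \<Sum>i<n. h ((T ^^ i) x) - b'))"
    then obtain K where "\<And>n. (\<Sum>i<n. h ((T ^^ i) x) - b') \<le> K"
      by (auto simp: bdd_above_def)
    then have K: "(\<Sum>i<n. h ((T ^^ i) x)) \<le> K + real n * b'" for n
      by (simp add: sum_subtractf algebra_simps)
    obtain N :: nat where N: "K / (b - b') < real N"
      using reals_Archimedean2 by blast
    show "\<forall>\<^sub>F n in sequentially. (\<Sum>i<n. h ((T ^^ i) x)) / real n < b"
    proof (rule eventually_sequentiallyI[of "Suc N"])
      fix n assume n: "Suc N \<le> n"
      then have "K / (b - b') < real n" using N by linarith
      then have "K < real n * (b - b')" using b' by (simp add: field_simps)
      then have "K + real n * b' < real n * b" by (simp add: algebra_simps)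
      with K[of n] have "(\<Sum>i<n. h ((T ^^ i) x)) < real n * b" by linarith
      then show "(\<Sum>i<n. h ((T ^^ i) x)) / real n < b"
        using n by (simp add: field_simps)
    qed
  qed
qed

lemma ergodic_average_greater:
  fixes h :: "'a \<Rightarrow> real"
  assumes h: "integrable M h" and b: "b < (\<integral>x. h x \<partial>M)"
  shows "AE x in M. \<forall>\<^sub>F n in sequentially. b < (\<Sum>i<n. h ((T ^^ i) x)) / real n"
  using ergodic_average_less[of "\<lambda>x. - h x" "- b"] h b by (simp add: sum_negf)

end

section \<open>The density power divergence loss\<close>

text \<open>Strict convexity of \<open>x powr (1 + a)\<close>: the mean value theorem combined with
  strict monotonicity of \<open>x powr a\<close>. Zero endpoints are handled directly because the
  derivative rule is used for positive arguments only.\<close>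

lemma powr_tangent_less:
  fixes p q a :: real
  assumes "0 < a" "0 \<le> p" "0 \<le> q" "p \<noteq> q"
  shows "q powr (1 + a) + (1 + a) * q powr a * (p - q) < p powr (1 + a)"
proof -
  consider "q = 0" | "q > 0" "p = 0" | "q > 0" "p > 0"
    using assms by linarith
  then show ?thesis
  proof cases
    case 1
    then show ?thesis using assms by simp
  next
    case 2
    have "q powr (1 + a) = q powr a * q"
      using 2 by (simp add: powr_add)
    moreover have "0 < a * (q powr a * q)"
      using 2 assms by simp
    ultimately show ?thesis
      using 2 by (simp add: algebra_simps)
  next
    case 3
    have der: "((\<lambda>x. x powr (1 + a)) has_real_derivative (1 + a) * x powr a) (at x)" if "0 < x" for x :: real
      using that by (auto intro!: derivative_eq_intros)
    show ?thesis
    proof (cases "q < p")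
      case True
      obtain z where z: "q < z" "z < p" "p powr (1 + a) - q powr (1 + a) = (p - q) * ((1 + a) * z powr a)"
        using MVT2[of q p "\<lambda>x. x powr (1 + a)" "\<lambda>x. (1 + a) * x powr a"] True 3 der by auto
      have "q powr a < z powr a" using z 3 assms by (intro powr_less_mono2) auto
      then have "(p - q) * ((1 + a) * q powr a) < (p - q) * ((1 + a) * z powr a)"
        using True assms by (intro mult_strict_left_mono) auto
      then show ?thesis using z(3) by (simp add: algebra_simps)
    next
      case False
      then have pq: "p < q" using assms by simp
      obtain z where z: "p < z" "z < q" "q powr (1 + a) - p powr (1 + a) = (q - p) * ((1 + a) * z powr a)"
        using MVT2[of p q "\<lambda>x. x powr (1 + a)" "\<lambda>x. (1 + a) * x powr a"] pq 3 der by auto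
      have "z powr a < q powr a" using z 3 assms by (intro powr_less_mono2) auto
      then have "(q - p) * ((1 + a) * z powr a) < (q - p) * ((1 + a) * q powr a)"
        using pq assms by (intro mult_strict_left_mono) auto
      then show ?thesis using z(3) by (simp add: algebra_simps)
    qed
  qed
qed

lemma abs_powr_diff_le:
  fixes x y a :: real
  assumes "0 \<le> a" "x \<in> {0..1}" "y \<in> {0..1}"
  shows "\<bar>x powr (1 + a) - y powr (1 + a)\<bar> \<le> (1 + a) * \<bar>x - y\<bar>"
proof -
  have main: "\<bar>x powr (1 + a) - y powr (1 + a)\<bar> \<le> (1 + a) * \<bar>x - y\<bar>"
    if xy: "x < y" "0 \<le> x" "y \<le> 1" for x y :: real
  proof (cases "x = 0")
    case True
    have "y powr (1 + a) \<le> y powr 1" using xy assms by (intro powr_mono') auto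
    also have "\<dots> = 1 * y" using xy by auto
    also have "\<dots> \<le> (1 + a) * y" using xy assms by (intro mult_right_mono) auto
    finally show ?thesis using True xy by simp
  next
    case False
    have der: "((\<lambda>x. x powr (1 + a)) has_real_derivative (1 + a) * x powr a) (at x)" if "0 < x" for x :: real
      using that by (auto intro!: derivative_eq_intros)
    obtain z where z: "x < z" "z < y" "y powr (1 + a) - x powr (1 + a) = (y - x) * ((1 + a) * z powr a)"
      using MVT2[of x y "\<lambda>x. x powr (1 + a)" "\<lambda>x. (1 + a) * x powr a"] xy False der by auto
    have "z powr a \<le> 1" using z xy assms by (intro powr_le1) auto
    then have "(1 + a) * z powr a \<le> 1 + a"
      using assms by (simp add: mult_left_le)
    then have "(y - x) * ((1 + a) * z powr a) \<le> (y - x) * (1 + a)"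
      using xy by (intro mult_left_mono) auto
    moreover have "0 \<le> (y - x) * ((1 + a) * z powr a)" using xy assms by auto
    ultimately show ?thesis using z(3) xy by (auto simp: abs_if algebra_simps)
  qed
  show ?thesis
    using main[of x y] main[of y x] assms by (cases x y rule: linorder_cases) (auto simp: abs_minus_commute)
qed

text \<open>In the variable \<open>s = ln x \<le> 0\<close> the function \<open>exp (a * s)\<close>
  has slope at most \<open>a\<close>. Measuring the difference by logarithms lets one log-likelihood
  term control the loss for \<open>a = 0\<close> and \<open>a > 0\<close> alike.\<close>

lemma abs_powr_diff_le_ln:
  fixes x y a :: real
  assumes "0 \<le> a" "x \<in> {0<..1}" "y \<in> {0<..1}"
  shows "\<bar>x powr a - y powr a\<bar> \<le> a * \<bar>ln x - ln y\<bar>"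
proof -
  have main: "y powr a - x powr a \<le> a * (ln y - ln x)"
    if "0 < x" "0 < y" "y \<le> 1" "x \<le> y" for x y :: real
  proof -
    have "x powr a = y powr a * exp (a * (ln x - ln y))"
      using that by (simp add: powr_def exp_add[symmetric] algebra_simps)
    moreover have "1 + a * (ln x - ln y) \<le> exp (a * (ln x - ln y))"
      by (rule exp_ge_add_one_self)
    ultimately have "y powr a * (1 + a * (ln x - ln y)) \<le> x powr a"
      by (simp add: mult_left_mono)
    then have "y powr a - x powr a \<le> y powr a * (a * (ln y - ln x))"
      by (simp add: algebra_simps)
    also have "\<dots> \<le> 1 * (a * (ln y - ln x))"
      using that assms by (intro mult_right_mono powr_le1) auto
    finally show ?thesis by simp
  qed
  show ?thesis
  proof (cases "x \<le> y")
    case True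
    then have "x powr a \<le> y powr a" "ln x \<le> ln y" using assms by (auto intro!: powr_mono2)
    then show ?thesis using main[of x y] True assms by simp
  next
    case False
    then have "y powr a \<le> x powr a" "ln y \<le> ln x" using assms by (auto intro!: powr_mono2)
    then show ?thesis using main[of y x] False assms by simp
  qed
qed

lemma pmf_le_1:
  fixes p :: "nat \<Rightarrow> real"
  assumes "\<And>y. 0 \<le> p y" "p sums 1"
  shows "p y \<le> 1"
  using sum_le_suminf[of p "{y}"] assms by (auto simp: sums_iff)

lemma summable_pmf_powr:
  fixes p :: "nat \<Rightarrow> real"
  assumes "\<And>y. 0 \<le> p y" "p sums 1" "0 \<le> a"
  shows "summable (\<lambda>y. p y powr (1 + a))"
    and "(\<Sum>y. p y powr (1 + a)) \<le> 1" and "0 \<le> (\<Sum>y. p y powr (1 + a))"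
proof -
  have le: "p y powr (1 + a) \<le> p y" for y
    using powr_mono'[of 1 "1 + a" "p y"] pmf_le_1[OF assms(1,2), of y] assms by auto
  have p: "summable p" "suminf p = 1" using assms by (auto simp: sums_iff)
  show *: "summable (\<lambda>y. p y powr (1 + a))"
    by (rule summable_comparison_test'[OF p(1), of 0]) (use le in auto)
  show "(\<Sum>y. p y powr (1 + a)) \<le> 1"
    using suminf_le[OF le * p(1)] p by simp
  show "0 \<le> (\<Sum>y. p y powr (1 + a))"
    by (rule suminf_nonneg[OF *]) simp
qed

text \<open>The shift offsets the largest possible subtracted term, as probabilities are at most 1.
  Because \<open>1 / 0 = 0\<close>, it equals 1 for \<open>a = 0\<close>, where the loss is already
  nonnegative; at probability 0 the default value of \<open>ln\<close> is not positive
  either.\<close>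

lemma dpd_loss_ge:
  assumes "\<And>y. 0 \<le> g y e" "(\<lambda>y. g y e) sums 1" "0 \<le> a"
  shows "0 \<le> dpd_loss a g e y + (1 + 1 / a)"
proof (cases "a = 0")
  case True
  have "ln (g y e) \<le> 0"
    using pmf_le_1[OF assms(1,2), of y] assms(1)[of y] by (cases "g y e = 0") auto
  then show ?thesis using True by (simp add: dpd_loss_def)
next
  case False
  have "g y e powr a \<le> 1"
    using pmf_le_1[OF assms(1,2), of y] assms by (intro powr_le1) auto
  then have "(1 + 1 / a) * g y e powr a \<le> (1 + 1 / a) * 1"
    using assms by (intro mult_left_mono) auto
  then show ?thesis
    using summable_pmf_powr(3)[OF assms] False by (simp add: dpd_loss_def)
qed

text \<open>For \<open>a = 0\<close> this is the termwise comparison of entropy with cross entropy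
  relative to the geometric weights \<open>q = (1 / 2) ^ Suc y\<close>: apply
  \<open>ln u \<le> u - 1\<close> to \<open>u = q / g y e\<close> and use
  \<open>- ln q \<le> y + 1\<close>. Summed over \<open>y\<close>, the right side is a mean plus
  constants. For \<open>a > 0\<close> the loss is at most 1.\<close>

lemma pmf_times_dpd_loss_le:
  assumes "\<And>y. 0 \<le> g y e" "(\<lambda>y. g y e) sums 1" "0 \<le> a"
  shows "g y e * (dpd_loss a g e y + (1 + 1 / a)) \<le> g y e * (2 + 1 / a + real y) + (1 / 2) ^ Suc y"
proof (cases "a = 0")
  case True
  show ?thesis
  proof (cases "g y e = 0")
    case False
    then have p: "0 < g y e" using assms(1)[of y] by simp
    define q :: real where "q = (1 / 2) ^ Suc y"
    have q: "0 < q" by (simp add: q_def)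
    have "ln (q / g y e) \<le> q / g y e - 1"
      by (rule ln_le_minus_one) (use p q in auto)
    then have "g y e * ln (q / g y e) \<le> g y e * (q / g y e - 1)"
      using p by (intro mult_left_mono) auto
    also have "\<dots> = q - g y e" using p by (simp add: field_simps)
    finally have "g y e * (ln q - ln (g y e)) \<le> q - g y e"
      using p q by (simp add: ln_div)
    moreover have "ln q = - (real (Suc y) * ln 2)"
      unfolding q_def by (subst ln_realpow) (auto simp: ln_div)
    moreover have "g y e * (real (Suc y) * ln 2) \<le> g y e * (real (Suc y) * 1)"
      using ln_le_minus_one[of "2::real"] p by (intro mult_left_mono) auto
    ultimately show ?thesis
      using True p unfolding q_def[symmetric] by (simp add: dpd_loss_def algebra_simps)
  qed simp
next
  case False
  have "0 \<le> (1 + 1 / a) * g y e powr a" using assms by simp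
  then have "dpd_loss a g e y \<le> 1"
    using False summable_pmf_powr(2)[OF assms] by (simp add: dpd_loss_def)
  then have "g y e * (dpd_loss a g e y + (1 + 1 / a)) \<le> g y e * (2 + 1 / a + real y)"
    using assms(1) by (intro mult_left_mono) auto
  moreover have "0 \<le> (1 / 2 :: real) ^ Suc y" by simp
  ultimately show ?thesis by linarith
qed

text \<open>The expected loss under \<open>g(\<cdot> | e')\<close> is minimised only at \<open>g(\<cdot> | e')\<close>: termwise, the excess
  loss is the gap in the tangent inequality for the convex function \<open>x powr (1 + a)\<close>
  (for \<open>- ln\<close> when \<open>a = 0\<close>).\<close>

lemma dpd_loss_identifies:
  assumes g: "\<And>y. 0 \<le> g y e" "(\<lambda>y. g y e) sums 1" and g': "\<And>y. 0 \<le> g y e'" "(\<lambda>y. g y e') sums 1"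
    and a: "0 \<le> a" and supp: "{y. g y e > 0} = {y. g y e' > 0}"
    and fin: "(\<Sum>y. ennreal (g y e' * (dpd_loss a g e' y + (1 + 1 / a)))) < \<infinity>"
    and le: "(\<Sum>y. ennreal (g y e' * (dpd_loss a g e y + (1 + 1 / a))))
      \<le> (\<Sum>y. ennreal (g y e' * (dpd_loss a g e' y + (1 + 1 / a))))"
  shows "g y e = g y e'"
proof -
  let ?P = "\<lambda>y. g y e' * (dpd_loss a g e' y + (1 + 1 / a))"
  let ?Q = "\<lambda>y. g y e' * (dpd_loss a g e y + (1 + 1 / a))"
  have nn: "0 \<le> ?P y" "0 \<le> ?Q y" for y
    using g'(1)[of y] dpd_loss_ge[of g e' a y, OF g' a] dpd_loss_ge[of g e a y, OF g a] by auto
  have P: "summable ?P"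
    using fin nn by (intro summable_suminf_not_top) auto
  have Q: "summable ?Q"
    using le_less_trans[OF le fin] nn by (intro summable_suminf_not_top) auto
  have "suminf ?Q \<le> suminf ?P"
    using le nn by (simp add: suminf_ennreal2 P Q ennreal_le_iff suminf_nonneg)
  then have diff: "(\<Sum>y. ?Q y - ?P y) \<le> 0"
    using suminf_diff[OF Q P] by simp
  have sQP: "(\<lambda>y. ?Q y - ?P y) sums (\<Sum>y. ?Q y - ?P y)"
    using summable_diff[OF Q P] by (rule summable_sums)
  have zero: "g y e = g y e'"
    if d: "\<And>y. 0 \<le> d y" "\<And>y. d y = 0 \<Longrightarrow> g y e = g y e'" "d sums (\<Sum>y. ?Q y - ?P y)"
    for d :: "nat \<Rightarrow> real"
  proof -
    have "suminf d \<le> 0" using d(3) diff by (simp add: sums_iff)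
    moreover have "0 \<le> suminf d" using d by (intro suminf_nonneg) (auto simp: sums_iff)
    ultimately have "suminf d = 0" by simp
    then have "\<forall>y. d y = 0"
      using suminf_eq_zero_iff[of d] d by (auto simp: sums_iff)
    then show ?thesis using d(2) by blast
  qed
  show ?thesis
  proof (cases "a = 0")
    case True
    \<comment> \<open>The added difference of two probability mass functions sums to 0. It turns the
      termwise excess into \<open>g y e' * (u - 1 - ln u)\<close> with
      \<open>u = g y e / g y e'\<close>, which is nonnegative and vanishes only at
      \<open>u = 1\<close>.\<close>
    let ?d = "\<lambda>y. (?Q y - ?P y) + (g y e - g y e')"
    have pos: "g y e > 0 \<longleftrightarrow> g y e' > 0" for y using supp by blast
    have d: "?d y = (if g y e' = 0 then 0 else g y e' * (g y e / g y e' - 1 - ln (g y e / g y e')))" for y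
    proof (cases "g y e' = 0")
      case False
      then have "0 < g y e'" "0 < g y e" using pos[of y] g'(1)[of y] by auto
      then have "ln (g y e / g y e') = ln (g y e) - ln (g y e')" "g y e' * (g y e / g y e') = g y e"
        by (auto simp: ln_div)
      then show ?thesis
        using False True by (simp add: dpd_loss_def right_diff_distrib)
    qed (use pos[of y] g(1)[of y] in auto)
    show ?thesis
    proof (rule zero)
      show "?d sums (\<Sum>y. ?Q y - ?P y)"
        using sums_add[OF sQP sums_diff[OF g(2) g'(2)]] by simp
    next
      fix y
      have "ln (g y e / g y e') \<le> g y e / g y e' - 1" if "g y e' \<noteq> 0"
        using that pos[of y] g'(1)[of y] by (intro ln_le_minus_one) auto
      then show "0 \<le> ?d y" unfolding d using g'(1)[of y] by auto
    next
      fix y assume "?d y = 0"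
      then show "g y e = g y e'"
        unfolding d using pos[of y] g(1)[of y] g'(1)[of y]
          ln_eq_minus_one[of "g y e / g y e'"]
        by (auto split: if_splits)
    qed
  next
    case False
    then have a: "0 < a" using a by simp
    let ?A = "\<lambda>e. \<Sum>z. g z e powr (1 + a)"
    \<comment> \<open>The tangent gap at \<open>g y e\<close>, divided by \<open>a\<close>. It
      differs from the termwise excess loss by terms whose series cancel: the power differences sum
      to \<open>?A e - ?A e'\<close>, and the constant \<open>?A e' - ?A e\<close>, weighted by a
      law of total mass 1, gives the opposite.\<close>
    let ?d = "\<lambda>y. (g y e' powr (1 + a) - g y e powr (1 + a)
        - (1 + a) * g y e powr a * (g y e' - g y e)) / a"
    have A: "(\<lambda>y. g y e powr (1 + a)) sums ?A e" "(\<lambda>y. g y e' powr (1 + a)) sums ?A e'"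
      using summable_pmf_powr(1)[OF g] summable_pmf_powr(1)[OF g'] a by (auto intro!: summable_sums)
    have mult: "x * x powr a = x powr (1 + a)" if "0 \<le> x" for x :: real
      using that by (cases "x = 0") (auto simp: powr_add)
    have d: "?d y = (?Q y - ?P y) + (g y e powr (1 + a) - g y e' powr (1 + a)) + g y e' * (?A e' - ?A e)" for y
    proof -
      have *: "(p * U - q * V - (1 + a) * V * (p - q)) / a
        = (p * (B - (1 + 1 / a) * V + K) - p * (B' - (1 + 1 / a) * U + K)) + (q * V - p * U) + p * (B' - B)"
        for p q U V B B' K :: real
        using a by (simp add: field_simps)
      show ?thesis
        using *[of "g y e'" "g y e' powr a" "g y e" "g y e powr a" "?A e" _ "?A e'"] False
        by (simp only: dpd_loss_def if_False mult[OF g(1)[of y]] mult[OF g'(1)[of y]])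
    qed
    show ?thesis
    proof (rule zero)
      have "(\<lambda>y. (?Q y - ?P y) + (g y e powr (1 + a) - g y e' powr (1 + a)) + g y e' * (?A e' - ?A e))
        sums ((\<Sum>y. ?Q y - ?P y) + (?A e - ?A e') + 1 * (?A e' - ?A e))"
        by (intro sums_add sQP sums_diff A sums_mult2 g')
      then show "?d sums (\<Sum>y. ?Q y - ?P y)"
        unfolding d by simp
    next
      fix y
      show "0 \<le> ?d y"
        using powr_tangent_less[of a "g y e'" "g y e"] a g(1)[of y] g'(1)[of y]
        by (cases "g y e' = g y e") auto
    next
      fix y assume "?d y = 0"
      then show "g y e = g y e'"
        using powr_tangent_less[of a "g y e'" "g y e"] a g(1)[of y] g'(1)[of y]
        by (cases "g y e' = g y e") auto
    qed
  qed
qed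

lemma dpd_loss_cong: "(\<And>y. g y e = g y e') \<Longrightarrow> dpd_loss a g e y = dpd_loss a g e' y"
  by (simp add: dpd_loss_def)

text \<open>A Scheffe-type argument. The tail of the powers is at most the tail of the mass, which
  is 1 minus a finite sum and hence continuous; a cutoff with a small tail at \<open>e0\<close>
  therefore has a small tail at all nearby parameters.\<close>

lemma continuous_on_suminf_powr:
  fixes g :: "nat \<Rightarrow> real \<Rightarrow> real"
  assumes nn: "\<And>e y. e \<in> S \<Longrightarrow> 0 \<le> g y e" and s: "\<And>e. e \<in> S \<Longrightarrow> (\<lambda>y. g y e) sums 1"
    and cont: "\<And>y. continuous_on S (g y)" and a: "0 \<le> a"
  shows "continuous_on S (\<lambda>e. \<Sum>y. g y e powr (1 + a))"
  unfolding continuous_on_def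
proof (intro ballI tendstoI)
  fix e0 \<epsilon> :: real assume e0: "e0 \<in> S" and "0 < \<epsilon>"
  let ?F = "\<lambda>e. \<Sum>y. g y e powr (1 + a)"
  let ?FN = "\<lambda>N e. \<Sum>y<N. g y e powr (1 + a)"
  let ?B = "\<lambda>N e. \<Sum>y<N. g y e"
  have tail: "0 \<le> ?F e - ?FN N e \<and> ?F e - ?FN N e \<le> 1 - ?B N e" if e: "e \<in> S" for e N
  proof -
    have le: "g y e powr (1 + a) \<le> g y e" for y
      using powr_mono'[of 1 "1 + a" "g y e"] pmf_le_1[OF nn s, OF e e, of y] nn[OF e, of y] a by auto
    have 1: "?F e - ?FN N e = (\<Sum>y. g (y + N) e powr (1 + a))"
      by (subst suminf_split_initial_segment[OF summable_pmf_powr(1)[OF nn s a, OF e e], of N]) simp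
    have 2: "1 - ?B N e = (\<Sum>y. g (y + N) e)"
      using suminf_split_initial_segment[of "\<lambda>y. g y e" N] s[OF e] by (simp add: sums_iff)
    have s1: "summable (\<lambda>y. g (y + N) e powr (1 + a))"
      using summable_pmf_powr(1)[OF nn s a, OF e e] by (rule summable_ignore_initial_segment)
    have s2: "summable (\<lambda>y. g (y + N) e)"
      using s[OF e] by (intro summable_ignore_initial_segment) (auto simp: sums_iff)
    show ?thesis
      unfolding 1 2 using suminf_le[OF le s1 s2] suminf_nonneg[OF s1] by auto
  qed
  have "(\<lambda>N. ?B N e0) \<longlonglongrightarrow> 1" using s[OF e0] by (simp add: sums_def)
  then have "\<forall>\<^sub>F N in sequentially. 1 - \<epsilon> / 4 < ?B N e0"
    using \<open>0 < \<epsilon>\<close> by (intro order_tendstoD) auto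
  then obtain N where N: "1 - \<epsilon> / 4 < ?B N e0"
    by (auto simp: eventually_sequentially)
  have "continuous_on S (?B N)" "continuous_on S (?FN N)"
    using a by (auto intro!: continuous_on_sum cont continuous_on_powr' nn)
  then have lim: "(?B N \<longlongrightarrow> ?B N e0) (at e0 within S)" "(?FN N \<longlongrightarrow> ?FN N e0) (at e0 within S)"
    using e0 by (auto simp: continuous_on_def)
  have "\<forall>\<^sub>F e in at e0 within S. e \<in> S"
    by (auto simp: eventually_at_filter)
  then show "\<forall>\<^sub>F e in at e0 within S. dist (?F e) (?F e0) < \<epsilon>"
    using order_tendstoD(1)[OF lim(1) N] tendstoD[OF lim(2) half_gt_zero[OF \<open>0 < \<epsilon>\<close>]]
  proof eventually_elim
    case (elim e)
    then show ?case
      using tail[OF elim(1), of N] tail[OF e0, of N] N unfolding dist_real_def by linarith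
  qed
qed

lemma continuous_on_dpd_loss:
  fixes g :: "nat \<Rightarrow> real \<Rightarrow> real"
  assumes nn: "\<And>e y. e \<in> S \<Longrightarrow> 0 \<le> g y e" and s: "\<And>e. e \<in> S \<Longrightarrow> (\<lambda>y. g y e) sums 1"
    and cont: "\<And>y. continuous_on S (g y)" and a: "0 \<le> a" and pos: "\<And>e. e \<in> S \<Longrightarrow> g y e \<noteq> 0"
  shows "continuous_on S (\<lambda>e. dpd_loss a g e y)"
proof (cases "a = 0")
  case True
  then show ?thesis
    using cont pos by (auto simp: dpd_loss_def intro!: continuous_intros)
next
  case False
  then show ?thesis
    using continuous_on_suminf_powr[OF nn s cont a] cont pos nn
    by (auto simp: dpd_loss_def intro!: continuous_intros)
qed

text \<open>On the unit interval \<open>x powr (1 + a)\<close> is Lipschitz with constant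
  \<open>1 + a\<close>, and the power term contributes \<open>(1 + 1 / a) * a = 1 + a\<close> as
  well. The right side splits into the L1 distance of the two laws, governed by the function in
  (A4), and the log-likelihood ratio, governed by the one in (A5).\<close>

lemma abs_dpd_loss_diff_le:
  assumes g: "\<And>y. 0 \<le> g y e" "(\<lambda>y. g y e) sums 1" and g': "\<And>y. 0 \<le> g y e'" "(\<lambda>y. g y e') sums 1"
    and a: "0 \<le> a" and pos: "0 < g y e" "0 < g y e'"
  shows "ennreal \<bar>dpd_loss a g e y - dpd_loss a g e' y\<bar>
    \<le> ennreal (1 + a) * ((\<Sum>z. ennreal \<bar>g z e - g z e'\<bar>) + ennreal \<bar>ln (g y e) - ln (g y e')\<bar>)"
proof -
  have sd: "summable (\<lambda>z. \<bar>g z e - g z e'\<bar>)"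
  proof (rule summable_comparison_test'[of "\<lambda>z. g z e + g z e'" 0])
    show "summable (\<lambda>z. g z e + g z e')" using g g' by (auto intro!: summable_add simp: sums_iff)
    show "norm \<bar>g z e - g z e'\<bar> \<le> g z e + g z e'" for z using g(1)[of z] g'(1)[of z] by simp
  qed
  have le: "g y e \<le> 1" "g y e' \<le> 1" for y using pmf_le_1[OF g] pmf_le_1[OF g'] by auto
  have "\<bar>dpd_loss a g e y - dpd_loss a g e' y\<bar>
    \<le> (1 + a) * ((\<Sum>z. \<bar>g z e - g z e'\<bar>) + \<bar>ln (g y e) - ln (g y e')\<bar>)"
  proof (cases "a = 0")
    case True
    then show ?thesis using suminf_nonneg[OF sd] by (simp add: dpd_loss_def)
  next
    case False
    let ?A = "\<lambda>e. \<Sum>z. g z e powr (1 + a)"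
    have s: "summable (\<lambda>z. g z e powr (1 + a))" "summable (\<lambda>z. g z e' powr (1 + a))"
      using summable_pmf_powr(1)[OF g] summable_pmf_powr(1)[OF g'] a by auto
    have b: "\<bar>g z e powr (1 + a) - g z e' powr (1 + a)\<bar> \<le> (1 + a) * \<bar>g z e - g z e'\<bar>" for z
      using g(1)[of z] g'(1)[of z] le[of z] a by (intro abs_powr_diff_le) auto
    have sd': "summable (\<lambda>z. (1 + a) * \<bar>g z e - g z e'\<bar>)" using sd by (rule summable_mult)
    have sb: "summable (\<lambda>z. \<bar>g z e powr (1 + a) - g z e' powr (1 + a)\<bar>)"
      by (rule summable_comparison_test'[OF sd', of 0]) (use b in auto)
    have "\<bar>?A e - ?A e'\<bar> = \<bar>\<Sum>z. g z e powr (1 + a) - g z e' powr (1 + a)\<bar>"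
      by (simp add: suminf_diff[OF s])
    also have "\<dots> \<le> (\<Sum>z. \<bar>g z e powr (1 + a) - g z e' powr (1 + a)\<bar>)"
      by (rule summable_rabs[OF sb])
    also have "\<dots> \<le> (\<Sum>z. (1 + a) * \<bar>g z e - g z e'\<bar>)"
      by (rule suminf_le[OF b sb sd'])
    also have "\<dots> = (1 + a) * (\<Sum>z. \<bar>g z e - g z e'\<bar>)"
      by (rule suminf_mult[OF sd])
    finally have 1: "\<bar>?A e - ?A e'\<bar> \<le> (1 + a) * (\<Sum>z. \<bar>g z e - g z e'\<bar>)" .
    have "(1 + 1 / a) * \<bar>g y e powr a - g y e' powr a\<bar> \<le> (1 + 1 / a) * (a * \<bar>ln (g y e) - ln (g y e')\<bar>)"
      using pos le a by (intro mult_left_mono abs_powr_diff_le_ln) auto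
    also have "\<dots> = (1 + a) * \<bar>ln (g y e) - ln (g y e')\<bar>"
      using False by (simp add: field_simps)
    finally have 2: "\<bar>(1 + 1 / a) * (g y e powr a - g y e' powr a)\<bar> \<le> (1 + a) * \<bar>ln (g y e) - ln (g y e')\<bar>"
      using a by (simp add: abs_mult)
    have "dpd_loss a g e y - dpd_loss a g e' y = (?A e - ?A e') - (1 + 1 / a) * (g y e powr a - g y e' powr a)"
      using False by (simp add: dpd_loss_def algebra_simps)
    then show ?thesis using 1 2 by (simp add: distrib_left)
  qed
  then have "ennreal \<bar>dpd_loss a g e y - dpd_loss a g e' y\<bar>
    \<le> ennreal ((1 + a) * ((\<Sum>z. \<bar>g z e - g z e'\<bar>) + \<bar>ln (g y e) - ln (g y e')\<bar>))"
    by (rule ennreal_leI)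
  also have "\<dots> = ennreal (1 + a) * ((\<Sum>z. ennreal \<bar>g z e - g z e'\<bar>) + ennreal \<bar>ln (g y e) - ln (g y e')\<bar>)"
    using a suminf_nonneg[OF sd] by (simp add: ennreal_mult suminf_ennreal2[OF _ sd])
  finally show ?thesis .
qed

text \<open>The fundamental theorem of calculus along the segment, with \<delta> kept as an
  integration variable so that expectations can later be taken at each fixed \<delta>. A convex
  \<open>S\<close> instead of the whole line is required for \<open>ln\<close> of a mass function,
  which needs positivity.\<close>

lemma abs_diff_le_nn_integral_deriv:
  fixes G G' :: "real \<Rightarrow> real"
  assumes der: "\<And>x. x \<in> S \<Longrightarrow> (G has_real_derivative G' x) (at x)"
    and cont: "continuous_on S G'" and S: "convex S" "x \<in> S" "y \<in> S"
  shows "ennreal \<bar>G x - G y\<bar>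
    \<le> ennreal \<bar>x - y\<bar> * (\<integral>\<^sup>+\<delta>. ennreal \<bar>G' (\<delta> * x + (1 - \<delta>) * y)\<bar> * indicator {0..1} \<delta> \<partial>lborel)"
proof -
  have seg: "\<delta> * x + (1 - \<delta>) * y \<in> S" if "\<delta> \<in> {0..1}" for \<delta>
    using convexD[OF S(1), of x y \<delta> "1 - \<delta>"] that S by auto
  let ?h = "\<lambda>\<delta>. G' (\<delta> * x + (1 - \<delta>) * y) * (x - y)"
  have c: "continuous_on {0..1} (\<lambda>\<delta>. G' (\<delta> * x + (1 - \<delta>) * y))"
    by (rule continuous_on_compose2[OF cont]) (auto intro!: continuous_intros seg)
  have d: "((\<lambda>\<delta>. G (\<delta> * x + (1 - \<delta>) * y)) has_real_derivative ?h \<delta>) (at \<delta>)" if "\<delta> \<in> {0..1}" for \<delta>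
  proof -
    have "((\<lambda>\<delta>. \<delta> * x + (1 - \<delta>) * y) has_real_derivative (x - y)) (at \<delta>)"
      by (auto intro!: derivative_eq_intros)
    from DERIV_chain2[OF der[OF seg[OF that]] this] show ?thesis .
  qed
  have int: "set_integrable lborel {0..1} ?h"
    by (rule borel_integrable_atLeastAtMost') (intro continuous_intros c)
  have "G x - G y = (\<integral>\<delta>. indicator {0..1} \<delta> *\<^sub>R ?h \<delta> \<partial>lborel)"
  proof (subst integral_FTC_atLeastAtMost)
    show "((\<lambda>\<delta>. G (\<delta> * x + (1 - \<delta>) * y)) has_vector_derivative ?h \<delta>) (at \<delta> within {0..1})"
      if "0 \<le> \<delta>" "\<delta> \<le> 1" for \<delta>
      using d[of \<delta>] that has_field_derivative_at_within
      by (simp add: has_real_derivative_iff_has_vector_derivative[symmetric])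
    show "continuous_on {0..1} ?h" by (intro continuous_intros c)
  qed simp_all
  then have "ennreal \<bar>G x - G y\<bar> \<le> (\<integral>\<^sup>+\<delta>. norm (indicator {0..1} \<delta> *\<^sub>R ?h \<delta>) \<partial>lborel)"
    using integral_norm_bound_ennreal[OF int[unfolded set_integrable_def]] by simp
  also have "\<dots> = (\<integral>\<^sup>+\<delta>. ennreal \<bar>x - y\<bar> *
      (ennreal \<bar>G' (\<delta> * x + (1 - \<delta>) * y)\<bar> * indicator {0..1} \<delta>) \<partial>lborel)"
    by (intro nn_integral_cong) (auto simp: indicator_def abs_mult ennreal_mult mult.commute)
  also have "\<dots> = ennreal \<bar>x - y\<bar> * (\<integral>\<^sup>+\<delta>. ennreal \<bar>G' (\<delta> * x + (1 - \<delta>) * y)\<bar> * indicator {0..1} \<delta> \<partial>lborel)"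
  proof (rule nn_integral_cmult)
    have "(\<lambda>\<delta>. indicator {0..1} \<delta> *\<^sub>R G' (\<delta> * x + (1 - \<delta>) * y)) \<in> borel_measurable lborel"
      using borel_integrable_atLeastAtMost'[OF c] unfolding set_integrable_def by (rule borel_measurable_integrable)
    then have "(\<lambda>\<delta>. ennreal \<bar>indicator {0..1} \<delta> *\<^sub>R G' (\<delta> * x + (1 - \<delta>) * y)\<bar>) \<in> borel_measurable lborel"
      by measurable
    also have "(\<lambda>\<delta>. ennreal \<bar>indicator {0..1} \<delta> *\<^sub>R G' (\<delta> * x + (1 - \<delta>) * y)\<bar>)
      = (\<lambda>\<delta>. ennreal \<bar>G' (\<delta> * x + (1 - \<delta>) * y)\<bar> * indicator {0..1} \<delta>)"
      by (auto simp: indicator_def)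
    finally show "\<dots> \<in> borel_measurable lborel" .
  qed
  finally show ?thesis .
qed

section \<open>Averages, tails and separation of risks\<close>

text \<open>Kronecker's lemma for nonnegative terms: for \<open>t \<le> n\<close> one has
  \<open>r t / n \<le> r t / t\<close>, so beyond a fixed \<open>N\<close> the average is below a
  Cauchy tail, while the initial block is divided by a growing \<open>n\<close>.\<close>

lemma averages_tendsto_0:
  fixes r :: "nat \<Rightarrow> real"
  assumes nn: "\<And>t. 0 \<le> r t" and s: "summable (\<lambda>t. r t / real t)"
  shows "(\<lambda>n. (\<Sum>t\<in>{1..n}. r t) / real n) \<longlonglongrightarrow> 0"
proof (rule LIMSEQ_I)
  fix \<epsilon> :: real assume "0 < \<epsilon>"
  obtain N where N: "\<And>m n. N \<le> m \<Longrightarrow> norm (\<Sum>t\<in>{m..<n}. r t / real t) < \<epsilon> / 2"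
    using s[unfolded summable_Cauchy] \<open>0 < \<epsilon>\<close> half_gt_zero by metis
  let ?A = "\<Sum>t\<in>{1..<Suc N}. r t"
  obtain K :: nat where K: "?A / (\<epsilon> / 2) < real K"
    using reals_Archimedean2 by blast
  show "\<exists>n0. \<forall>n\<ge>n0. norm ((\<Sum>t\<in>{1..n}. r t) / real n - 0) < \<epsilon>"
  proof (intro exI allI impI)
    fix n assume n: "max (Suc N) (Suc K) \<le> n"
    have "(\<Sum>t\<in>{1..n}. r t) = ?A + (\<Sum>t\<in>{Suc N..<Suc n}. r t)"
      using n by (subst sum.atLeastLessThan_concat) (auto simp: atLeastLessThanSuc_atLeastAtMost)
    then have "(\<Sum>t\<in>{1..n}. r t) / real n = ?A / real n + (\<Sum>t\<in>{Suc N..<Suc n}. r t / real n)"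
      by (simp add: add_divide_distrib sum_divide_distrib)
    moreover have "(\<Sum>t\<in>{Suc N..<Suc n}. r t / real n) \<le> (\<Sum>t\<in>{Suc N..<Suc n}. r t / real t)"
      using nn by (intro sum_mono divide_left_mono) auto
    moreover have "(\<Sum>t\<in>{Suc N..<Suc n}. r t / real t) < \<epsilon> / 2"
      using N[of "Suc N" "Suc n"] by simp
    moreover have "?A / real n < \<epsilon> / 2"
    proof -
      have "?A / (\<epsilon> / 2) < real n" using K n by linarith
      then show ?thesis using \<open>0 < \<epsilon>\<close> n by (simp add: field_simps)
    qed
    moreover have "0 \<le> (\<Sum>t\<in>{1..n}. r t) / real n" using nn by (simp add: sum_nonneg)
    ultimately show "norm ((\<Sum>t\<in>{1..n}. r t) / real n - 0) < \<epsilon>"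
      unfolding real_norm_def by linarith
  qed
qed

text \<open>Telescoping against \<open>x powr (1 - \<gamma>)\<close>. The mean value point lies
  between \<open>k\<close> and \<open>k + 1 \<le> 2 * k\<close>, which costs the factor
  \<open>2 powr \<gamma>\<close>; the derivative supplies \<open>1 / (\<gamma> - 1)\<close>.\<close>

lemma sum_powr_tail_le:
  fixes \<gamma> :: real
  assumes \<gamma>: "1 < \<gamma>" and t: "1 \<le> (t::nat)"
  shows "(\<Sum>k<n. real (k + t) powr (- \<gamma>)) \<le> 2 powr \<gamma> / (\<gamma> - 1) * real t powr (1 - \<gamma>)"
proof -
  define C where "C = 2 powr \<gamma> / (\<gamma> - 1)"
  have step: "real k powr (- \<gamma>) \<le> C * (real k powr (1 - \<gamma>) - real (Suc k) powr (1 - \<gamma>))" if k: "1 \<le> k" for k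
  proof -
    have der: "((\<lambda>x. x powr (1 - \<gamma>)) has_real_derivative (1 - \<gamma>) * x powr (- \<gamma>)) (at x)" if "0 < x" for x :: real
      using that by (auto intro!: derivative_eq_intros)
    obtain z where z: "real k < z" "z < real (Suc k)"
      "real (Suc k) powr (1 - \<gamma>) - real k powr (1 - \<gamma>) = (real (Suc k) - real k) * ((1 - \<gamma>) * z powr (- \<gamma>))"
      using MVT2[of "real k" "real (Suc k)" "\<lambda>x. x powr (1 - \<gamma>)" "\<lambda>x. (1 - \<gamma>) * x powr (- \<gamma>)"] k der by auto
    have "(2 * real k) powr (- \<gamma>) \<le> z powr (- \<gamma>)"
      using z k \<gamma> by (intro powr_mono2') auto
    then have "2 powr \<gamma> * (2 * real k) powr (- \<gamma>) \<le> 2 powr \<gamma> * z powr (- \<gamma>)"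
      by (intro mult_left_mono) auto
    moreover have "2 powr \<gamma> * (2 * real k) powr (- \<gamma>) = real k powr (- \<gamma>)"
      by (simp add: powr_mult powr_minus)
    ultimately have "real k powr (- \<gamma>) \<le> 2 powr \<gamma> * z powr (- \<gamma>)" by simp
    also have "\<dots> = C * (real k powr (1 - \<gamma>) - real (Suc k) powr (1 - \<gamma>))"
    proof -
      have "real k powr (1 - \<gamma>) - real (Suc k) powr (1 - \<gamma>) = (\<gamma> - 1) * z powr (- \<gamma>)"
        using z(3) by (simp add: algebra_simps)
      then show ?thesis using \<gamma> by (simp add: C_def)
    qed
    finally show ?thesis .
  qed
  have "(\<Sum>k<n. real (k + t) powr (- \<gamma>)) \<le> C * (real t powr (1 - \<gamma>) - real (n + t) powr (1 - \<gamma>))"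
  proof (induction n)
    case (Suc n)
    then show ?case using step[of "n + t"] t by (simp add: algebra_simps)
  qed simp
  also have "\<dots> \<le> C * real t powr (1 - \<gamma>)"
    using \<gamma> by (intro mult_left_mono) (auto simp: C_def)
  finally show ?thesis by (simp add: C_def)
qed

lemma (in finite_measure_subalgebra) nn_integral_cond_prob:
  assumes [measurable]: "A \<in> sets M" "k \<in> borel_measurable F"
    and p: "AE x in M. real_cond_exp M F (indicator A) x = p x"
  shows "(\<integral>\<^sup>+x. k x * indicator A x \<partial>M) = (\<integral>\<^sup>+x. k x * ennreal (p x) \<partial>M)"
proof -
  let ?i = "\<lambda>x. ennreal (indicator A x)"
  have "AE x in M. nn_cond_exp M F ?i x \<le> nn_cond_exp M F (\<lambda>_. 1) x"
    by (rule nn_cond_exp_mono) (auto simp: indicator_def)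
  moreover have "AE x in M. 1 = nn_cond_exp M F (\<lambda>_. 1) x"
    using nn_cond_exp_F_meas[of "\<lambda>_. 1"] by auto
  moreover have "AE x in M. 0 = nn_cond_exp M F (\<lambda>x. ennreal (- indicator A x)) x"
  proof -
    have "(\<lambda>x. ennreal (- indicator A x)) = (\<lambda>_. 0)" by (auto simp: indicator_def ennreal_neg)
    then show ?thesis using nn_cond_exp_F_meas[of "\<lambda>_. 0"] by auto
  qed
  ultimately have "AE x in M. nn_cond_exp M F ?i x = ennreal (p x)"
    using p
  proof eventually_elim
    case (elim x)
    then have "nn_cond_exp M F ?i x \<le> 1" by simp
    then have "nn_cond_exp M F ?i x < top" by (simp add: le_less_trans)
    then have "ennreal (enn2real (nn_cond_exp M F ?i x)) = nn_cond_exp M F ?i x"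
      by (rule ennreal_enn2real)
    moreover have "enn2real (nn_cond_exp M F ?i x) = p x"
      using elim by (simp add: real_cond_exp_def)
    ultimately show ?case by simp
  qed
  then have "(\<integral>\<^sup>+x. k x * ennreal (p x) \<partial>M) = (\<integral>\<^sup>+x. k x * nn_cond_exp M F ?i x \<partial>M)"
    by (intro nn_integral_cong_AE) auto
  also have "\<dots> = (\<integral>\<^sup>+x. k x * ?i x \<partial>M)"
    by (rule nn_cond_exp_intg) auto
  finally show ?thesis by (simp add: ennreal_indicator)
qed

section \<open>Ergodic comparison of averaged losses over a compact parameter set\<close>

context ergodic_map
begin

lemma AE_funpow_T:
  assumes "AE x in M. P x"
  shows "AE x in M. \<forall>i. P ((T ^^ i) x)"
proof -
  have "AE x in M. P ((T ^^ i) x)" for i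
  proof (induction i)
    case (Suc i)
    then have "AE x in distr M M T. P ((T ^^ i) x)" unfolding distr_T .
    then have "AE x in M. P ((T ^^ i) (T x))" by (rule AE_distrD[OF measurable_T])
    then show ?case by (simp add: funpow_swap1)
  qed (use assms in simp)
  then show ?thesis by (simp add: AE_all_countable)
qed

text \<open>Wald's argument: the infima of the loss over shrinking neighbourhoods of a parameter increase
  to the loss at that parameter, so some neighbourhood still has an expected infimum above
  the minimal risk.\<close>

lemma local_infimum_separates:
  fixes h :: "'p::{metric_space, second_countable_topology} \<Rightarrow> 'a \<Rightarrow> real"
  assumes meas: "\<And>\<theta>. \<theta> \<in> \<Theta> \<Longrightarrow> h \<theta> \<in> borel_measurable M"
    and low: "\<And>\<theta> x. \<theta> \<in> \<Theta> \<Longrightarrow> x \<in> space M \<Longrightarrow> 0 \<le> h \<theta> x"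
    and cont: "AE x in M. continuous_on \<Theta> (\<lambda>\<theta>. h \<theta> x)"
    and \<theta>0: "\<theta>0 \<in> \<Theta>" and sep: "ennreal I < (\<integral>\<^sup>+x. ennreal (h \<theta>0 x) \<partial>M)"
  obtains r W where "0 < r" "integrable M W" "I < (\<integral>x. W x \<partial>M)"
    "AE x in M. \<forall>\<theta>\<in>\<Theta>. dist \<theta>0 \<theta> < r \<longrightarrow> W x \<le> h \<theta> x"
proof -
  obtain D where D: "countable D" "D \<subseteq> \<Theta>" "\<Theta> \<subseteq> closure D"
    using separable[of \<Theta>] by blast
  define r where "r m = 1 / real (Suc m)" for m
  have r: "0 < r m" for m by (simp add: r_def)
  define B where "B m = D \<inter> ball \<theta>0 (r m)" for m
  have dense: "\<exists>d\<in>D \<inter> U. True" if "open U" "\<theta> \<in> U" "\<theta> \<in> \<Theta>" for U \<theta>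
    using D that by (metis IntI closure_iff_nhds_not_empty disjoint_iff subsetD open_subset subset_refl)
  have B: "countable (B m)" "B m \<noteq> {}" "\<And>\<theta>. \<theta> \<in> B m \<Longrightarrow> \<theta> \<in> \<Theta>" for m
    using D dense[of "ball \<theta>0 (r m)" \<theta>0] \<theta>0 r by (auto simp: B_def)
  \<comment> \<open>As \<open>m\<close> grows the ball shrinks and the cap rises, so
    \<open>W m\<close> increases. The cap makes \<open>W m\<close> integrable even where
    \<open>h \<theta>0\<close> is not, and countability of \<open>B m\<close> makes the infimum
    measurable.\<close>
  define W where "W m x = min (real m) (INF \<theta>\<in>B m. h \<theta> x)" for m x
  have bdd: "bdd_below ((\<lambda>\<theta>. h \<theta> x) ` B m)" if "x \<in> space M" for x m
    using low that B by (intro bdd_belowI2[of _ 0]) auto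
  have W_meas[measurable]: "W m \<in> borel_measurable M" for m
    unfolding W_def using B meas
    by (intro borel_measurable_min borel_measurable_const borel_measurable_cINF_real) auto
  have W_bd: "0 \<le> W m x" "W m x \<le> real m" if "x \<in> space M" for m x
    using low B that by (auto simp: W_def intro!: cINF_greatest)
  \<comment> \<open>The bound passes from the dense set to every parameter in the ball: the ball is
    open, so points of \<open>D\<close> near \<open>\<theta>\<close> still lie in it, and continuity
    compares their losses.\<close>
  have W_le: "W m x \<le> h \<theta> x"
    if x: "x \<in> space M" and c: "continuous_on \<Theta> (\<lambda>\<theta>. h \<theta> x)" and \<theta>: "\<theta> \<in> \<Theta>" "dist \<theta>0 \<theta> < r m" for m x \<theta>
  proof (rule field_le_epsilon)
    fix e :: real assume "0 < e"
    then obtain d where d: "0 < d" "\<And>\<theta>'. \<theta>' \<in> \<Theta> \<Longrightarrow> dist \<theta>' \<theta> < d \<Longrightarrow> dist (h \<theta>' x) (h \<theta> x) < e"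
      using c \<theta> unfolding continuous_on_iff by metis
    obtain \<theta>' where \<theta>': "\<theta>' \<in> D" "\<theta>' \<in> ball \<theta>0 (r m) \<inter> ball \<theta> d"
      using dense[of "ball \<theta>0 (r m) \<inter> ball \<theta> d" \<theta>] \<theta> d by auto
    then have "\<theta>' \<in> B m" by (auto simp: B_def)
    then have "W m x \<le> h \<theta>' x"
      using cINF_lower[OF bdd[OF x]] by (auto simp: W_def min_le_iff_disj)
    moreover have "\<bar>h \<theta>' x - h \<theta> x\<bar> < e"
      using d(2)[of \<theta>'] \<theta>' D by (auto simp: dist_real_def dist_commute)
    ultimately show "W m x \<le> h \<theta> x + e" by linarith
  qed
  have inc: "W m x \<le> W n x" if "m \<le> n" "x \<in> space M" for m n x
  proof -
    have "r n \<le> r m" using that by (simp add: r_def field_simps)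
    then have "B n \<subseteq> B m" by (auto simp: B_def)
    then have "(INF \<theta>\<in>B m. h \<theta> x) \<le> (INF \<theta>\<in>B n. h \<theta> x)"
      using B bdd[OF that(2)] by (intro cINF_superset_mono) auto
    then show ?thesis using that by (auto simp: W_def)
  qed
  have lim: "(\<lambda>m. W m x) \<longlonglongrightarrow> h \<theta>0 x"
    if x: "x \<in> space M" and c: "continuous_on \<Theta> (\<lambda>\<theta>. h \<theta> x)" for x
  proof (rule LIMSEQ_I)
    fix e :: real assume "0 < e"
    then obtain d where d: "0 < d" "\<And>\<theta>'. \<theta>' \<in> \<Theta> \<Longrightarrow> dist \<theta>' \<theta>0 < d \<Longrightarrow> dist (h \<theta>' x) (h \<theta>0 x) < e / 2"
      using c \<theta>0 half_gt_zero unfolding continuous_on_iff by metis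
    obtain N1 :: nat where N1: "h \<theta>0 x \<le> real N1" using real_arch_simple by blast
    obtain N2 :: nat where N2: "1 / d < real N2" using reals_Archimedean2 by blast
    show "\<exists>n0. \<forall>n\<ge>n0. norm (W n x - h \<theta>0 x) < e"
    proof (intro exI allI impI)
      fix n assume n: "max N1 N2 \<le> n"
      have "1 / d < real (Suc n)" using N2 n by linarith
      then have rn: "r n < d" using d by (simp add: r_def field_simps)
      have "h \<theta>0 x - e / 2 \<le> (INF \<theta>\<in>B n. h \<theta> x)"
      proof (rule cINF_greatest[OF B(2)])
        fix \<theta> assume "\<theta> \<in> B n"
        then have "dist (h \<theta> x) (h \<theta>0 x) < e / 2"
          using d(2)[of \<theta>] rn B(3)[of \<theta> n] by (auto simp: B_def dist_commute)
        then show "h \<theta>0 x - e / 2 \<le> h \<theta> x" unfolding dist_real_def by linarith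
      qed
      then have "h \<theta>0 x - e / 2 \<le> W n x"
        using N1 n \<open>0 < e\<close> by (auto simp: W_def)
      moreover have "W n x \<le> h \<theta>0 x" using W_le[OF x c \<theta>0] r by simp
      ultimately show "norm (W n x - h \<theta>0 x) < e" using \<open>0 < e\<close> by auto
    qed
  qed
  have "(\<integral>\<^sup>+x. ennreal (h \<theta>0 x) \<partial>M) = (\<integral>\<^sup>+x. (SUP m. ennreal (W m x)) \<partial>M)"
  proof (rule nn_integral_cong_AE)
    show "AE x in M. ennreal (h \<theta>0 x) = (SUP m. ennreal (W m x))"
      using cont AE_space
    proof eventually_elim
      case (elim x)
      have "(\<lambda>m. ennreal (W m x)) \<longlonglongrightarrow> (SUP m. ennreal (W m x))"
        by (rule LIMSEQ_SUP) (use inc elim in \<open>auto simp: incseq_def intro!: ennreal_leI\<close>)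
      moreover have "(\<lambda>m. ennreal (W m x)) \<longlonglongrightarrow> ennreal (h \<theta>0 x)"
        by (rule tendsto_ennrealI[OF lim]) (use elim in auto)
      ultimately show ?case by (metis LIMSEQ_unique)
    qed
  qed
  also have "\<dots> = (SUP m. \<integral>\<^sup>+x. ennreal (W m x) \<partial>M)"
    by (rule nn_integral_monotone_convergence_SUP_AE) (use inc in \<open>auto intro!: AE_I2 ennreal_leI\<close>)
  finally obtain m where m: "ennreal I < (\<integral>\<^sup>+x. ennreal (W m x) \<partial>M)"
    using sep by (auto simp: less_SUP_iff)
  have iW: "integrable M (W m)"
    by (rule integrable_const_bound[of _ "real m"]) (use W_bd in auto)
  have "ennreal I < ennreal (\<integral>x. W m x \<partial>M)"
    using m nn_integral_eq_integral[OF iW] W_bd by simp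
  then have "I < (\<integral>x. W m x \<partial>M)"
    by (metis ennreal_leI not_le)
  moreover have "AE x in M. \<forall>\<theta>\<in>\<Theta>. dist \<theta>0 \<theta> < r m \<longrightarrow> W m x \<le> h \<theta> x"
    using cont AE_space by eventually_elim (use W_le in auto)
  ultimately show ?thesis using that[OF r iW] by blast
qed

text \<open>Compactness covers the parameters at distance at least \<epsilon> by finitely many
  neighbourhoods with an infimum of mean above the minimal risk. Only finitely many ergodic
  averages, hence null sets, are involved, although the conclusion is uniform in the
  parameter.\<close>

lemma ergodic_risk_separation:
  fixes h :: "'p::{metric_space, second_countable_topology} \<Rightarrow> 'a \<Rightarrow> real"
  assumes \<Theta>: "compact \<Theta>" "\<theta>s \<in> \<Theta>"
    and meas: "\<And>\<theta>. \<theta> \<in> \<Theta> \<Longrightarrow> h \<theta> \<in> borel_measurable M"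
    and low: "\<And>\<theta> x. \<theta> \<in> \<Theta> \<Longrightarrow> x \<in> space M \<Longrightarrow> 0 \<le> h \<theta> x"
    and cont: "AE x in M. continuous_on \<Theta> (\<lambda>\<theta>. h \<theta> x)"
    and fin: "(\<integral>\<^sup>+x. ennreal (h \<theta>s x) \<partial>M) < \<infinity>"
    and sep: "\<And>\<theta>. \<theta> \<in> \<Theta> \<Longrightarrow> \<theta> \<noteq> \<theta>s \<Longrightarrow> (\<integral>\<^sup>+x. ennreal (h \<theta>s x) \<partial>M) < (\<integral>\<^sup>+x. ennreal (h \<theta> x) \<partial>M)"
    and \<epsilon>: "0 < \<epsilon>"
  shows "AE x in M. \<exists>\<kappa>>0. \<forall>\<^sub>F n in sequentially. \<forall>\<theta>\<in>\<Theta>. \<epsilon> \<le> dist \<theta>s \<theta> \<longrightarrow>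
    (\<Sum>i<n. h \<theta>s ((T ^^ i) x)) / real n + \<kappa> \<le> (\<Sum>i<n. h \<theta> ((T ^^ i) x)) / real n"
proof -
  have ints: "integrable M (h \<theta>s)"
    using meas[OF \<Theta>(2)] fin low[OF \<Theta>(2)] by (intro integrableI_nonneg) auto
  let ?I = "\<integral>x. h \<theta>s x \<partial>M"
  have I: "(\<integral>\<^sup>+x. ennreal (h \<theta>s x) \<partial>M) = ennreal ?I"
    using nn_integral_eq_integral[OF ints] low[OF \<Theta>(2)] by simp
  define Q where "Q \<theta>0 r W \<longleftrightarrow> 0 < r \<and> integrable M W \<and> ?I < (\<integral>x. W x \<partial>M) \<and>
    (AE x in M. \<forall>\<theta>\<in>\<Theta>. dist \<theta>0 \<theta> < r \<longrightarrow> W x \<le> h \<theta> x)" for \<theta>0 r W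
  have "\<exists>r W. Q \<theta>0 r W" if "\<theta>0 \<in> \<Theta> - {\<theta>s}" for \<theta>0
  proof -
    have *: "\<theta>0 \<in> \<Theta>" "ennreal ?I < (\<integral>\<^sup>+x. ennreal (h \<theta>0 x) \<partial>M)" using that sep I by auto
    show ?thesis
      by (rule local_infimum_separates[OF meas low cont *]) (auto simp: Q_def)
  qed
  then obtain r W where "\<And>\<theta>0. \<theta>0 \<in> \<Theta> - {\<theta>s} \<Longrightarrow> Q \<theta>0 (r \<theta>0) (W \<theta>0)"
    by metis
  then have rW: "0 < r \<theta>0" "integrable M (W \<theta>0)" "?I < (\<integral>x. W \<theta>0 x \<partial>M)"
    "AE x in M. \<forall>\<theta>\<in>\<Theta>. dist \<theta>0 \<theta> < r \<theta>0 \<longrightarrow> W \<theta>0 x \<le> h \<theta> x" if "\<theta>0 \<in> \<Theta> - {\<theta>s}" for \<theta>0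
    using that by (auto simp: Q_def)
  define K where "K = \<Theta> - ball \<theta>s \<epsilon>"
  have "compact K" unfolding K_def using \<Theta> by (intro compact_diff) auto
  moreover have KS: "K \<subseteq> \<Theta> - {\<theta>s}" using \<epsilon> by (auto simp: K_def)
  then have "K \<subseteq> (\<Union>\<theta>0\<in>K. ball \<theta>0 (r \<theta>0))" using rW by fastforce
  ultimately obtain F where F: "F \<subseteq> K" "finite F" "K \<subseteq> (\<Union>\<theta>0\<in>F. ball \<theta>0 (r \<theta>0))"
    using compactE_image[of K K "\<lambda>\<theta>0. ball \<theta>0 (r \<theta>0)"] by (metis open_ball)
  have FS: "\<theta>0 \<in> \<Theta> - {\<theta>s}" if "\<theta>0 \<in> F" for \<theta>0 using that F(1) KS by blast
  \<comment> \<open>The extra element \<open>?I + 1\<close> keeps the minimum defined when the cover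
    is empty.\<close>
  define \<beta> where "\<beta> = Min (insert (?I + 1) ((\<lambda>\<theta>0. \<integral>x. W \<theta>0 x \<partial>M) ` F))"
  have \<beta>: "?I < \<beta>" unfolding \<beta>_def using F(2) rW(3)[OF FS] by (subst Min_gr_iff) auto
  have \<beta>_le: "\<beta> \<le> (\<integral>x. W \<theta>0 x \<partial>M)" if "\<theta>0 \<in> F" for \<theta>0
    unfolding \<beta>_def using that F by (intro Min_le) auto
  \<comment> \<open>A third of the gap: one \<kappa> is lost in each of the two ergodic estimates,
    and one remains.\<close>
  define \<kappa> where "\<kappa> = (\<beta> - ?I) / 3"
  have \<kappa>: "0 < \<kappa>" using \<beta> by (simp add: \<kappa>_def)
  have "AE x in M. \<forall>\<theta>0\<in>F. \<forall>\<^sub>F n in sequentially. \<beta> - \<kappa> < (\<Sum>i<n. W \<theta>0 ((T ^^ i) x)) / real n"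
  proof (rule AE_finite_allI[OF F(2)])
    fix \<theta>0 assume "\<theta>0 \<in> F"
    then show "AE x in M. \<forall>\<^sub>F n in sequentially. \<beta> - \<kappa> < (\<Sum>i<n. W \<theta>0 ((T ^^ i) x)) / real n"
      using rW(2)[OF FS] \<beta>_le[of \<theta>0] \<kappa> by (intro ergodic_average_greater) auto
  qed
  moreover have "AE x in M. \<forall>\<^sub>F n in sequentially. (\<Sum>i<n. h \<theta>s ((T ^^ i) x)) / real n < ?I + \<kappa>"
    using ergodic_average_less[OF ints] \<kappa> by simp
  moreover have "AE x in M. \<forall>\<theta>0\<in>F. \<forall>i. \<forall>\<theta>\<in>\<Theta>. dist \<theta>0 \<theta> < r \<theta>0 \<longrightarrow> W \<theta>0 ((T ^^ i) x) \<le> h \<theta> ((T ^^ i) x)"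
    by (intro AE_finite_allI[OF F(2)] AE_funpow_T rW(4) FS)
  ultimately show ?thesis
  proof eventually_elim
    case (elim x)
    have "\<forall>\<^sub>F n in sequentially. \<forall>\<theta>0\<in>F. \<beta> - \<kappa> < (\<Sum>i<n. W \<theta>0 ((T ^^ i) x)) / real n"
      using elim(1) F(2) by (simp add: eventually_ball_finite_distrib)
    then have "\<forall>\<^sub>F n in sequentially. \<forall>\<theta>\<in>\<Theta>. \<epsilon> \<le> dist \<theta>s \<theta> \<longrightarrow>
      (\<Sum>i<n. h \<theta>s ((T ^^ i) x)) / real n + \<kappa> \<le> (\<Sum>i<n. h \<theta> ((T ^^ i) x)) / real n"
      using elim(2)
    proof (eventually_elim, intro ballI impI)
      fix n \<theta>
      assume n: "\<forall>\<theta>0\<in>F. \<beta> - \<kappa> < (\<Sum>i<n. W \<theta>0 ((T ^^ i) x)) / real n"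
        "(\<Sum>i<n. h \<theta>s ((T ^^ i) x)) / real n < ?I + \<kappa>" and \<theta>: "\<theta> \<in> \<Theta>" "\<epsilon> \<le> dist \<theta>s \<theta>"
      then obtain \<theta>0 where \<theta>0: "\<theta>0 \<in> F" "dist \<theta>0 \<theta> < r \<theta>0" using F(3) by (force simp: K_def)
      then have "(\<Sum>i<n. W \<theta>0 ((T ^^ i) x)) / real n \<le> (\<Sum>i<n. h \<theta> ((T ^^ i) x)) / real n"
        using elim(3) \<theta> by (intro divide_right_mono sum_mono) auto
      then show "(\<Sum>i<n. h \<theta>s ((T ^^ i) x)) / real n + \<kappa> \<le> (\<Sum>i<n. h \<theta> ((T ^^ i) x)) / real n"
        using bspec[OF n(1) \<theta>0(1)] n(2) unfolding \<kappa>_def by argo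
    qed
    then show ?case using \<kappa> by blast
  qed
qed

end

section \<open>The model and its risk\<close>

lemma supn_nonneg: "0 \<le> supn x"
proof -
  have "supn x \<in> range (\<lambda>i. \<bar>x $ i\<bar>)"
    unfolding supn_def by (rule Max_in) auto
  then obtain i where "supn x = \<bar>x $ i\<bar>" by (rule rangeE)
  then show ?thesis by simp
qed

lemma measurable_supn [measurable]: "supn \<in> borel_measurable borel"
  unfolding supn_def by measurable

text \<open>The source \<open>N\<close> is arbitrary because the lemma serves for the underlying
  space, for the past sigma-algebra and for path space; only times before \<open>t\<close>
  enter.\<close>

lemma measurable_lam:
  assumes f: "(\<lambda>(y, x). f \<theta> y x) \<in> borel_measurable (PiM UNIV (\<lambda>_. count_space UNIV) \<Otimes>\<^sub>M PiM UNIV (\<lambda>_. borel))"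
    and Y: "\<And>u. u < t \<Longrightarrow> Y u \<in> N \<rightarrow>\<^sub>M count_space UNIV"
    and X: "\<And>u. u < t \<Longrightarrow> X u \<in> borel_measurable N"
  shows "lam f Y X \<theta> t \<in> borel_measurable N" and "lamhat f Y X \<theta> t \<in> borel_measurable N"
proof -
  have [measurable]: "lagY Y t \<in> N \<rightarrow>\<^sub>M PiM UNIV (\<lambda>_. count_space UNIV)"
    unfolding lagY_def
  proof (rule measurable_abs_UNIV, goal_cases)
    case (1 k)
    show ?case by (cases "k = 0") (auto intro: Y)
  qed
  have [measurable]: "tlagY Y t \<in> N \<rightarrow>\<^sub>M PiM UNIV (\<lambda>_. count_space UNIV)"
    unfolding tlagY_def
  proof (rule measurable_abs_UNIV, goal_cases)
    case (1 k)
    show ?case by (cases "1 \<le> k \<and> int k < t") (auto intro: Y)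
  qed
  have [measurable]: "lagX X t \<in> N \<rightarrow>\<^sub>M PiM UNIV (\<lambda>_. borel)"
    unfolding lagX_def
  proof (rule measurable_abs_UNIV, goal_cases)
    case (1 k)
    show ?case by (cases "k = 0") (auto intro: X)
  qed
  have [measurable]: "tlagX X t \<in> N \<rightarrow>\<^sub>M PiM UNIV (\<lambda>_. borel)"
    unfolding tlagX_def
  proof (rule measurable_abs_UNIV, goal_cases)
    case (1 k)
    show ?case by (cases "1 \<le> k \<and> int k < t") (auto intro: X)
  qed
  have "(\<lambda>\<omega>. (lagY Y t \<omega>, lagX X t \<omega>)) \<in> N \<rightarrow>\<^sub>M (PiM UNIV (\<lambda>_. count_space UNIV) \<Otimes>\<^sub>M PiM UNIV (\<lambda>_. borel))"
    "(\<lambda>\<omega>. (tlagY Y t \<omega>, tlagX X t \<omega>)) \<in> N \<rightarrow>\<^sub>M (PiM UNIV (\<lambda>_. count_space UNIV) \<Otimes>\<^sub>M PiM UNIV (\<lambda>_. borel))"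
    by measurable
  from measurable_compose[OF this(1) f] measurable_compose[OF this(2) f]
  show "lam f Y X \<theta> t \<in> borel_measurable N" and "lamhat f Y X \<theta> t \<in> borel_measurable N"
    unfolding lam_def[abs_def] lamhat_def[abs_def] by simp_all
qed

lemma measurable_dpd_loss:
  assumes g: "\<And>y. g y \<in> borel_measurable borel"
    and e: "e \<in> borel_measurable N" and y: "y \<in> N \<rightarrow>\<^sub>M count_space UNIV"
  shows "(\<lambda>x. dpd_loss a g (e x) (y x)) \<in> borel_measurable N"
proof (rule measurable_compose_countable[OF _ y])
  fix n
  have [measurable]: "(\<lambda>x. g n (e x)) \<in> borel_measurable N" for n
    using measurable_compose[OF e g] .
  show "(\<lambda>x. dpd_loss a g (e x) n) \<in> borel_measurable N"
    by (cases "a = 0") (simp_all add: dpd_loss_def)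
qed

lemma measurable_past:
  assumes Y: "\<And>u. Y u \<in> M \<rightarrow>\<^sub>M count_space UNIV" and X: "\<And>u. X u \<in> borel_measurable M"
  shows "subalgebra M (past M Y X s)"
    and "u \<le> s \<Longrightarrow> Y u \<in> past M Y X s \<rightarrow>\<^sub>M count_space UNIV"
    and "u \<le> s \<Longrightarrow> X u \<in> borel_measurable (past M Y X s)"
proof -
  let ?G = "{Y u -` A \<inter> space M | u A. u \<le> s} \<union> {X u -` B \<inter> space M | u B. u \<le> s \<and> B \<in> sets borel}"
  have G: "?G \<subseteq> sets M"
    using Y X by (auto intro: measurable_sets)
  then have G': "?G \<subseteq> Pow (space M)"
    using sets.space_closed by blast
  have sp: "space (past M Y X s) = space M" and se: "sets (past M Y X s) = sigma_sets (space M) ?G"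
    using G' by (auto simp: past_def)
  show "subalgebra M (past M Y X s)"
    unfolding subalgebra_def sp se using sets.sigma_sets_subset[OF G] by simp
  show "Y u \<in> past M Y X s \<rightarrow>\<^sub>M count_space UNIV" if "u \<le> s"
    using that by (intro measurableI) (auto simp: sp se intro!: sigma_sets.Basic)
  show "X u \<in> borel_measurable (past M Y X s)" if "u \<le> s"
    using that by (intro measurableI) (auto simp: sp se intro!: sigma_sets.Basic)
qed

locale dpd_count_model = prob_space M for M :: "'a measure" +
  fixes Y :: "int \<Rightarrow> 'a \<Rightarrow> nat"
    and X :: "int \<Rightarrow> 'a \<Rightarrow> real ^ 'd"
    and f :: "real ^ 'p \<Rightarrow> (nat \<Rightarrow> nat) \<Rightarrow> (nat \<Rightarrow> real ^ 'd) \<Rightarrow> real"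
    and g :: "nat \<Rightarrow> real \<Rightarrow> real"
    and eta :: "real \<Rightarrow> real"
    and \<Theta> :: "(real ^ 'p) set"
    and \<theta>s :: "real ^ 'p"
    and a c c_eta B :: real
  assumes compact_\<Theta>: "compact \<Theta>" and \<theta>s: "\<theta>s \<in> \<Theta>" and a: "0 \<le> a"
    and measY [measurable]: "\<And>t. Y t \<in> M \<rightarrow>\<^sub>M count_space UNIV"
    and measX [measurable]: "\<And>t. X t \<in> borel_measurable M"
    and measf: "\<And>\<theta>. \<theta> \<in> \<Theta> \<Longrightarrow> (\<lambda>(y, x). f \<theta> y x)
                  \<in> borel_measurable (PiM UNIV (\<lambda>_. count_space UNIV) \<Otimes>\<^sub>M PiM UNIV (\<lambda>_. borel))"
    and pmf: "\<And>e. e \<in> eta ` {c..} \<Longrightarrow> (\<forall>y. 0 \<le> g y e) \<and> (\<lambda>y. g y e) sums 1"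
    and model_pmf: "\<And>t y. AE \<omega> in M.
        real_cond_exp M (past M Y X (t - 1)) (indicator {\<omega>' \<in> space M. Y t \<omega>' = y}) \<omega>
          = g y (eta (lam f Y X \<theta>s t \<omega>))"
    and support: "\<And>t \<omega> \<theta> \<theta>'. \<omega> \<in> space M \<Longrightarrow> \<theta> \<in> \<Theta> \<Longrightarrow> \<theta>' \<in> \<Theta> \<Longrightarrow>
        {y. g y (eta (lam f Y X \<theta> t \<omega>)) > 0} = {y. g y (eta (lam f Y X \<theta>' t \<omega>)) > 0}"
    and stat: "stationary_proc M (count_space UNIV \<Otimes>\<^sub>M (borel \<Otimes>\<^sub>M borel))
                 (\<lambda>t \<omega>. (Y t \<omega>, lam f Y X \<theta>s t \<omega>, X t \<omega>))"
    and erg: "ergodic_proc M (count_space UNIV \<Otimes>\<^sub>M (borel \<Otimes>\<^sub>M borel))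
                 (\<lambda>t \<omega>. (Y t \<omega>, lam f Y X \<theta>s t \<omega>, X t \<omega>))"
    and B: "0 \<le> B"
    and second_moment: "\<And>t. (\<integral>\<^sup>+\<omega>. ennreal (real (Y t \<omega>) + supn (X t \<omega>)) ^ 2 \<partial>M) \<le> ennreal (B\<^sup>2)"
    and f_cont: "\<And>y x. continuous_on \<Theta> (\<lambda>\<theta>. f \<theta> y x)"
    and f_ident: "\<And>\<theta> \<theta>'. \<theta> \<in> \<Theta> \<Longrightarrow> \<theta>' \<in> \<Theta> \<Longrightarrow>
        (\<exists>t. AE \<omega> in M. lam f Y X \<theta> t \<omega> = lam f Y X \<theta>' t \<omega>) \<Longrightarrow> \<theta> = \<theta>'"
    and f_low: "\<And>\<theta> y x. \<theta> \<in> \<Theta> \<Longrightarrow> c \<le> f \<theta> y x"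
    and g_C1: "\<And>y e. (g y has_real_derivative deriv (g y) e) (at e)"
      "\<And>y. continuous_on UNIV (deriv (g y))"
    and g_ident: "\<And>e e'. (\<forall>y. g y e = g y e') \<Longrightarrow> e = e'"
    and g_nonzero: "\<And>t::nat. t \<ge> 1 \<Longrightarrow> AE \<omega> in M. \<forall>e. g (Y (int t) \<omega>) e \<noteq> 0"
    and c_eta: "0 < c_eta"
    and eta_lip: "\<And>l l'. c \<le> l \<Longrightarrow> c \<le> l' \<Longrightarrow> \<bar>eta l - eta l'\<bar> \<le> c_eta * \<bar>l - l'\<bar>"
    and eta_inj: "inj_on eta {c..}"
begin

lemma pmf_g: assumes "c \<le> l" shows "0 \<le> g y (eta l)" "(\<lambda>y. g y (eta l)) sums 1"
  using pmf[of "eta l"] assms by auto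

lemma g_cont: "continuous_on S (g y)"
  by (rule DERIV_continuous_on[OF has_field_derivative_at_within[OF g_C1(1)]])

lemma g_borel [measurable]: "g y \<in> borel_measurable borel"
  using g_cont by (rule borel_measurable_continuous_onI)

lemma lam_low: "\<theta> \<in> \<Theta> \<Longrightarrow> c \<le> lam f Y' X' \<theta> t \<omega>" "\<theta> \<in> \<Theta> \<Longrightarrow> c \<le> lamhat f Y' X' \<theta> t \<omega>"
  by (simp_all add: lam_def lamhat_def f_low)

lemma eta_cont: "continuous_on {c..} eta"
proof (rule continuous_onI)
  fix x e assume "x \<in> {c..}" "0 < (e::real)"
  then show "\<exists>d>0. \<forall>x'\<in>{c..}. dist x' x < d \<longrightarrow> dist (eta x') (eta x) \<le> e"
  proof (intro exI[of _ "e / c_eta"] conjI ballI impI)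
    fix x' assume *: "x' \<in> {c..}" "dist x' x < e / c_eta"
    then have "c_eta * \<bar>x' - x\<bar> < e" using c_eta by (simp add: dist_real_def field_simps)
    then show "dist (eta x') (eta x) \<le> e"
      using eta_lip[of x' x] * \<open>x \<in> {c..}\<close> by (simp add: dist_real_def)
  qed (use c_eta in auto)
qed

text \<open>A continuous image of an interval is an interval. Segments between two attained natural
  parameters thus stay where \<open>g\<close> is a probability mass function, as needed to
  differentiate its logarithm along them.\<close>

lemma convex_range: "convex (eta ` {c..})"
proof -
  have "connected (eta ` {c..})"
    by (intro connected_continuous_image eta_cont) auto
  then show ?thesis by (simp add: is_interval_connected_1[symmetric] is_interval_convex_1)
qed

text \<open>\<open>eta\<close> is arbitrary below \<open>c\<close>, so measurability goes through \<open>eta (max c l)\<close>.\<close>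

lemma measurable_eta:
  assumes [measurable]: "l \<in> borel_measurable N" and "\<And>x. c \<le> l x"
  shows "(\<lambda>x. eta (l x)) \<in> borel_measurable N"
proof -
  have "continuous_on UNIV (\<lambda>l. eta (max c l))"
    by (rule continuous_on_compose2[OF eta_cont]) (auto intro!: continuous_intros)
  then have [measurable]: "(\<lambda>l. eta (max c l)) \<in> borel_measurable borel"
    by (rule borel_measurable_continuous_onI)
  have "(\<lambda>x. eta (max c (l x))) \<in> borel_measurable N" by measurable
  then show ?thesis using assms(2) by (simp add: max_absorb2)
qed

lemma measurable_eta_lam [measurable]:
  assumes "\<theta> \<in> \<Theta>"
  shows "(\<lambda>\<omega>. eta (lam f Y X \<theta> t \<omega>)) \<in> borel_measurable M"
    and "(\<lambda>\<omega>. eta (lamhat f Y X \<theta> t \<omega>)) \<in> borel_measurable M"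
    and "(\<lambda>\<omega>. eta (lam f Y X \<theta> t \<omega>)) \<in> borel_measurable (past M Y X (t - 1))"
  using assms measurable_past[of Y M X, OF measY measX]
  by (auto intro!: measurable_eta measurable_lam measf lam_low)

lemma loss_nonneg:
  assumes "\<theta> \<in> \<Theta>"
  shows "0 \<le> dpd_loss a g (eta (lam f Y' X' \<theta> t \<omega>)) y + (1 + 1 / a)"
  using assms by (intro dpd_loss_ge pmf_g a lam_low)

lemma loss_cont:
  assumes "\<And>e. g y e \<noteq> 0"
  shows "continuous_on \<Theta> (\<lambda>\<theta>. dpd_loss a g (eta (f \<theta> y' x')) y)"
proof -
  have "continuous_on (eta ` {c..}) (\<lambda>e. dpd_loss a g e y)"
    using pmf assms by (intro continuous_on_dpd_loss g_cont a) auto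
  then show ?thesis
    by (rule continuous_on_compose2[OF _ continuous_on_compose2[OF eta_cont f_cont]])
      (use f_low in auto)
qed

text \<open>Splitting over the countably many values of \<open>Y t\<close> reduces the claim to one
  conditional probability at a time, and the series passes through the nonnegative integral.\<close>

lemma nn_integral_model:
  assumes k: "\<And>y. k y \<in> borel_measurable (past M Y X (t - 1))"
  shows "(\<integral>\<^sup>+\<omega>. k (Y t \<omega>) \<omega> \<partial>M) = (\<integral>\<^sup>+\<omega>. (\<Sum>y. ennreal (g y (eta (lam f Y X \<theta>s t \<omega>))) * k y \<omega>) \<partial>M)"
proof -
  interpret fs: finite_measure_subalgebra M "past M Y X (t - 1)"
    by unfold_locales (rule measurable_past; measurable)
  have kM[measurable]: "k y \<in> borel_measurable M" for y
    using measurable_from_subalg[OF fs.subalg k] .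
  let ?A = "\<lambda>y. {\<omega> \<in> space M. Y t \<omega> = y}"
  note [measurable] = measurable_eta_lam[OF \<theta>s]
  have "(\<integral>\<^sup>+\<omega>. k (Y t \<omega>) \<omega> \<partial>M) = (\<integral>\<^sup>+\<omega>. (\<Sum>y. k y \<omega> * indicator (?A y) \<omega>) \<partial>M)"
  proof (rule nn_integral_cong)
    fix \<omega> assume \<omega>: "\<omega> \<in> space M"
    have "(\<Sum>y. k y \<omega> * indicator (?A y) \<omega>) = (\<Sum>y\<in>{Y t \<omega>}. k y \<omega> * indicator (?A y) \<omega>)"
      by (rule suminf_finite) (auto simp: indicator_def)
    then show "k (Y t \<omega>) \<omega> = (\<Sum>y. k y \<omega> * indicator (?A y) \<omega>)" using \<omega> by simp
  qed
  also have "\<dots> = (\<Sum>y. \<integral>\<^sup>+\<omega>. k y \<omega> * indicator (?A y) \<omega> \<partial>M)"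
    by (rule nn_integral_suminf) measurable
  also have "\<dots> = (\<Sum>y. \<integral>\<^sup>+\<omega>. k y \<omega> * ennreal (g y (eta (lam f Y X \<theta>s t \<omega>))) \<partial>M)"
    by (intro suminf_cong fs.nn_integral_cond_prob k model_pmf) measurable
  also have "\<dots> = (\<integral>\<^sup>+\<omega>. (\<Sum>y. k y \<omega> * ennreal (g y (eta (lam f Y X \<theta>s t \<omega>)))) \<partial>M)"
    by (rule nn_integral_suminf[symmetric]) measurable
  finally show ?thesis by (simp add: mult.commute)
qed

text \<open>Extended nonnegative values are used because the expectation need not be finite away
  from \<open>\<theta>s\<close>. Time 1 represents all times by stationarity.\<close>

definition risk :: "real ^ 'p \<Rightarrow> ennreal" where
  "risk \<theta> = (\<integral>\<^sup>+\<omega>. ennreal (dpd_loss a g (eta (lam f Y X \<theta> 1 \<omega>)) (Y 1 \<omega>) + (1 + 1 / a)) \<partial>M)"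

definition cond_risk :: "real ^ 'p \<Rightarrow> 'a \<Rightarrow> ennreal" where
  "cond_risk \<theta> \<omega> = (\<Sum>y. ennreal (g y (eta (lam f Y X \<theta>s 1 \<omega>)) *
     (dpd_loss a g (eta (lam f Y X \<theta> 1 \<omega>)) y + (1 + 1 / a))))"

lemma measurable_cond_risk [measurable]: "\<theta> \<in> \<Theta> \<Longrightarrow> cond_risk \<theta> \<in> borel_measurable M"
  unfolding cond_risk_def
  using measurable_eta_lam[of \<theta>] measurable_eta_lam[OF \<theta>s] by (auto intro!: borel_measurable_suminf_order
    measurable_compose[OF _ measurable_ennreal] borel_measurable_times borel_measurable_add measurable_dpd_loss
    measurable_compose[OF _ g_borel])

lemma risk_eq: assumes "\<theta> \<in> \<Theta>" shows "risk \<theta> = (\<integral>\<^sup>+\<omega>. cond_risk \<theta> \<omega> \<partial>M)"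
proof -
  have "(\<lambda>\<omega>. ennreal (dpd_loss a g (eta (lam f Y X \<theta> 1 \<omega>)) y + (1 + 1 / a)))
    \<in> borel_measurable (past M Y X (1 - 1))" for y
    using measurable_eta_lam(3)[OF assms, of 1]
    by (intro measurable_compose[OF _ measurable_ennreal] borel_measurable_add measurable_dpd_loss) auto
  from nn_integral_model[OF this] show ?thesis
    unfolding risk_def cond_risk_def
    by (simp add: ennreal_mult pmf_g lam_low \<theta>s loss_nonneg[OF assms])
qed

lemma first_moment: "(\<integral>\<^sup>+\<omega>. ennreal (real (Y t \<omega>)) \<partial>M) < \<infinity>"
proof -
  have le: "ennreal (real (Y t \<omega>)) \<le> 1 + ennreal (real (Y t \<omega>) + supn (X t \<omega>)) ^ 2" for \<omega>
  proof -
    have "Y t \<omega> \<le> 1 + (Y t \<omega>)\<^sup>2" by (cases "Y t \<omega>") (auto simp: power2_eq_square)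
    then have "real (Y t \<omega>) \<le> 1 + (real (Y t \<omega>))\<^sup>2"
      using of_nat_mono[where 'a = real, of "Y t \<omega>" "1 + (Y t \<omega>)\<^sup>2"] by simp
    also have "(real (Y t \<omega>))\<^sup>2 \<le> (real (Y t \<omega>) + supn (X t \<omega>))\<^sup>2"
      by (intro power_mono) (auto simp: supn_nonneg)
    finally have "ennreal (real (Y t \<omega>)) \<le> ennreal (1 + (real (Y t \<omega>) + supn (X t \<omega>))\<^sup>2)"
      by (intro ennreal_leI) auto
    then show ?thesis
      using ennreal_power[of "real (Y t \<omega>) + supn (X t \<omega>)" 2] by (simp add: supn_nonneg)
  qed
  have "(\<integral>\<^sup>+\<omega>. ennreal (real (Y t \<omega>)) \<partial>M) \<le> (\<integral>\<^sup>+\<omega>. 1 + ennreal (real (Y t \<omega>) + supn (X t \<omega>)) ^ 2 \<partial>M)"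
    by (rule nn_integral_mono) (rule le)
  also have "\<dots> = 1 + (\<integral>\<^sup>+\<omega>. ennreal (real (Y t \<omega>) + supn (X t \<omega>)) ^ 2 \<partial>M)"
    by (subst nn_integral_add) (auto simp: emeasure_space_1)
  also have "\<dots> \<le> 1 + ennreal (B\<^sup>2)" by (intro add_left_mono second_moment)
  also have "\<dots> < \<infinity>" by simp
  finally show ?thesis .
qed

text \<open>The entropy of a distribution on the naturals with finite mean is finite (compare with
  a geometric law), which bounds the case \<open>a = 0\<close>.\<close>

lemma risk_finite: "risk \<theta>s < \<infinity>"
proof -
  let ?e = "\<lambda>\<omega>. eta (lam f Y X \<theta>s 1 \<omega>)"
  have "cond_risk \<theta>s \<omega> \<le> (\<Sum>y. ennreal (g y (?e \<omega>)) * ennreal (2 + 1 / a + real y)) + (\<Sum>y. ennreal ((1 / 2) ^ Suc y))" for \<omega>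
  proof -
    have "ennreal (g y (?e \<omega>) * (dpd_loss a g (?e \<omega>) y + (1 + 1 / a)))
      \<le> ennreal (g y (?e \<omega>)) * ennreal (2 + 1 / a + real y) + ennreal ((1 / 2) ^ Suc y)" for y
    proof -
      have "ennreal (g y (?e \<omega>) * (dpd_loss a g (?e \<omega>) y + (1 + 1 / a)))
        \<le> ennreal (g y (?e \<omega>) * (2 + 1 / a + real y) + (1 / 2) ^ Suc y)"
        by (intro ennreal_leI pmf_times_dpd_loss_le pmf_g lam_low \<theta>s a)
      also have "\<dots> = ennreal (g y (?e \<omega>) * (2 + 1 / a + real y)) + ennreal ((1 / 2) ^ Suc y)"
        using a pmf_g(1)[OF lam_low(1)[OF \<theta>s]] by (intro ennreal_plus mult_nonneg_nonneg) auto
      also have "ennreal (g y (?e \<omega>) * (2 + 1 / a + real y)) = ennreal (g y (?e \<omega>)) * ennreal (2 + 1 / a + real y)"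
        using a pmf_g(1)[OF lam_low(1)[OF \<theta>s]] by (intro ennreal_mult) auto
      finally show ?thesis .
    qed
    then show ?thesis
      unfolding cond_risk_def by (subst suminf_add) (auto intro!: suminf_le)
  qed
  then have "risk \<theta>s \<le> (\<integral>\<^sup>+\<omega>. (\<Sum>y. ennreal (g y (?e \<omega>)) * ennreal (2 + 1 / a + real y)) + (\<Sum>y. ennreal ((1 / 2) ^ Suc y)) \<partial>M)"
    unfolding risk_eq[OF \<theta>s] by (intro nn_integral_mono)
  also have "\<dots> = (\<integral>\<^sup>+\<omega>. (\<Sum>y. ennreal (g y (?e \<omega>)) * ennreal (2 + 1 / a + real y)) \<partial>M) + (\<Sum>y. ennreal ((1 / 2) ^ Suc y))"
    using measurable_eta_lam[OF \<theta>s] by (subst nn_integral_add) (auto simp: emeasure_space_1)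
  \<comment> \<open>The disintegration is read backwards: averaging \<open>real y\<close> against
    the conditional law gives the mean of \<open>Y 1\<close>, which is finite.\<close>
  also have "(\<integral>\<^sup>+\<omega>. (\<Sum>y. ennreal (g y (?e \<omega>)) * ennreal (2 + 1 / a + real y)) \<partial>M)
    = (\<integral>\<^sup>+\<omega>. ennreal (2 + 1 / a + real (Y 1 \<omega>)) \<partial>M)"
    by (rule nn_integral_model[symmetric, where k = "\<lambda>y \<omega>. ennreal (2 + 1 / a + real y)"]) simp
  also have "\<dots> = ennreal (2 + 1 / a) + (\<integral>\<^sup>+\<omega>. ennreal (real (Y 1 \<omega>)) \<partial>M)"
  proof -
    have "(\<integral>\<^sup>+\<omega>. ennreal (2 + 1 / a + real (Y 1 \<omega>)) \<partial>M)
      = (\<integral>\<^sup>+\<omega>. ennreal (2 + 1 / a) + ennreal (real (Y 1 \<omega>)) \<partial>M)"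
      by (intro nn_integral_cong ennreal_plus) (use a in auto)
    then show ?thesis
      using nn_integral_add[of "\<lambda>_. ennreal (2 + 1 / a)" M "\<lambda>\<omega>. ennreal (real (Y 1 \<omega>))"]
      by (simp only: nn_integral_const emeasure_space_1 mult_1_right) simp
  qed
  also have "(\<Sum>y. ennreal ((1 / 2) ^ Suc y)) = ennreal 1"
    using power_half_series by (intro suminf_ennreal_eq) auto
  finally show ?thesis using first_moment[of 1] by (simp add: le_less_trans)
qed

lemma cond_risk_identifies:
  assumes "\<theta> \<in> \<Theta>" "\<omega> \<in> space M" "cond_risk \<theta>s \<omega> < \<infinity>" "cond_risk \<theta> \<omega> \<le> cond_risk \<theta>s \<omega>"
  shows "g y (eta (lam f Y X \<theta> 1 \<omega>)) = g y (eta (lam f Y X \<theta>s 1 \<omega>))"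
  using assms(3,4) unfolding cond_risk_def
  by (intro dpd_loss_identifies[where a = a] pmf_g lam_low assms(1) \<theta>s a support[OF assms(2,1) \<theta>s])

text \<open>Given the past, a strictly smaller risk at \<open>\<theta>\<close> would force both
  laws, hence both conditional risks, to agree; so
  \<open>cond_risk \<theta>s \<le> cond_risk \<theta>\<close> almost everywhere. If the integrals
  are ordered the other way, equality holds almost everywhere, the laws agree, and injectivity in
  the natural parameter and of \<open>eta\<close> gives equal intensities, contradicting
  identifiability.\<close>

lemma risk_separation:
  assumes "\<theta> \<in> \<Theta>" "\<theta> \<noteq> \<theta>s"
  shows "risk \<theta>s < risk \<theta>"
proof (rule ccontr)
  assume "\<not> ?thesis"
  then have le: "risk \<theta> \<le> risk \<theta>s" by simp
  note [measurable] = measurable_cond_risk[OF assms(1)] measurable_cond_risk[OF \<theta>s]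
  have "AE \<omega> in M. cond_risk \<theta>s \<omega> \<noteq> \<infinity>"
    by (rule nn_integral_PInf_AE) (use risk_finite risk_eq[OF \<theta>s] in auto)
  then have fin: "AE \<omega> in M. cond_risk \<theta>s \<omega> < \<infinity>"
    by eventually_elim (simp add: less_top)
  have mono: "AE \<omega> in M. cond_risk \<theta>s \<omega> \<le> cond_risk \<theta> \<omega>"
    using fin AE_space
  proof eventually_elim
    case (elim \<omega>)
    show ?case
    proof (rule ccontr)
      assume "\<not> ?thesis"
      then have lt: "cond_risk \<theta> \<omega> < cond_risk \<theta>s \<omega>" by simp
      have "dpd_loss a g (eta (lam f Y X \<theta> 1 \<omega>)) y = dpd_loss a g (eta (lam f Y X \<theta>s 1 \<omega>)) y" for y
        using cond_risk_identifies[OF assms(1) elim(2,1)] lt by (intro dpd_loss_cong) auto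
      then show False using lt by (simp add: cond_risk_def)
    qed
  qed
  \<comment> \<open>Subtracting the integrals is legitimate because the risk at
    \<open>\<theta>s\<close> is finite.\<close>
  have "(\<integral>\<^sup>+\<omega>. cond_risk \<theta> \<omega> - cond_risk \<theta>s \<omega> \<partial>M) = risk \<theta> - risk \<theta>s"
    unfolding risk_eq[OF assms(1)] risk_eq[OF \<theta>s] using risk_finite risk_eq[OF \<theta>s] mono
    by (intro nn_integral_diff) auto
  also have "\<dots> = 0"
    using le le_less_trans[OF le risk_finite] by (simp add: diff_eq_0_iff_ennreal)
  finally have "AE \<omega> in M. cond_risk \<theta> \<omega> - cond_risk \<theta>s \<omega> = 0"
    by (subst (asm) nn_integral_0_iff_AE) auto
  then have "AE \<omega> in M. lam f Y X \<theta> 1 \<omega> = lam f Y X \<theta>s 1 \<omega>"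
    using fin AE_space
  proof eventually_elim
    case (elim \<omega>)
    have "cond_risk \<theta> \<omega> \<le> cond_risk \<theta>s \<omega>"
      using elim(1,2) by (auto simp: diff_eq_0_iff_ennreal)
    then have "eta (lam f Y X \<theta> 1 \<omega>) = eta (lam f Y X \<theta>s 1 \<omega>)"
      using cond_risk_identifies[OF assms(1) elim(3,2)] by (intro g_ident) auto
    then show ?case
      by (rule inj_onD[OF eta_inj]) (use lam_low assms(1) \<theta>s in auto)
  qed
  then show False using f_ident[OF assms(1) \<theta>s] assms(2) by blast
qed

end

section \<open>Empirical risks\<close>

lemma nn_integral_mult_le:
  assumes [measurable]: "u \<in> borel_measurable M" "v \<in> borel_measurable M"
    and u: "(\<integral>\<^sup>+x. u x ^ 2 \<partial>M) \<le> ennreal (p\<^sup>2)" and v: "(\<integral>\<^sup>+x. v x ^ 2 \<partial>M) \<le> ennreal (q\<^sup>2)"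
    and pq: "0 \<le> p" "0 \<le> q"
  shows "(\<integral>\<^sup>+x. u x * v x \<partial>M) \<le> ennreal (p * q)"
proof -
  have "(\<integral>\<^sup>+x. u x * v x \<partial>M)\<^sup>2 \<le> (\<integral>\<^sup>+x. u x ^ 2 \<partial>M) * (\<integral>\<^sup>+x. v x ^ 2 \<partial>M)"
    by (rule Cauchy_Schwarz_nn_integral) measurable
  also have "\<dots> \<le> ennreal (p\<^sup>2) * ennreal (q\<^sup>2)"
    by (intro mult_mono u v) auto
  also have "\<dots> = ennreal (p * q) ^ 2"
    using pq by (simp add: ennreal_mult[symmetric] ennreal_power power_mult_distrib)
  finally have *: "(\<integral>\<^sup>+x. u x * v x \<partial>M)\<^sup>2 \<le> ennreal (p * q) ^ 2" .
  show ?thesis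
  proof (cases "\<integral>\<^sup>+x. u x * v x \<partial>M")
    case (real r)
    then have "r\<^sup>2 \<le> (p * q)\<^sup>2" using * pq by (simp add: ennreal_power ennreal_le_iff)
    then have "r \<le> p * q" by (rule power2_le_imp_le) (use pq in auto)
    then show ?thesis using real by (simp add: ennreal_leI)
  next
    case top
    then show ?thesis using * by (simp add: ennreal_power power2_eq_square ennreal_mult_eq_top_iff top_unique)
  qed
qed

context dpd_count_model
begin

abbreviation obs_space :: "(nat \<times> real \<times> (real ^ 'd)) measure" where
  "obs_space \<equiv> count_space UNIV \<Otimes>\<^sub>M (borel \<Otimes>\<^sub>M borel)"

definition path :: "'a \<Rightarrow> int \<Rightarrow> nat \<times> real \<times> (real ^ 'd)" where
  "path \<omega> t = (Y t \<omega>, lam f Y X \<theta>s t \<omega>, X t \<omega>)"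

text \<open>The loss at time 1 as a function of a whole path, with the lagged values read off its
  coordinates. After \<open>i\<close> shifts it becomes the loss at time \<open>Suc i\<close>, so
  empirical risks turn into Birkhoff averages.\<close>

definition path_loss :: "real ^ 'p \<Rightarrow> (int \<Rightarrow> nat \<times> real \<times> (real ^ 'd)) \<Rightarrow> real" where
  "path_loss \<theta> z = dpd_loss a g (eta (lam f (\<lambda>u z. fst (z u)) (\<lambda>u z. snd (snd (z u))) \<theta> 1 z)) (fst (z 1)) + (1 + 1 / a)"

abbreviation loss :: "real ^ 'p \<Rightarrow> nat \<Rightarrow> 'a \<Rightarrow> real" where
  "loss \<theta> t \<omega> \<equiv> dpd_loss a g (eta (lam f Y X \<theta> (int t) \<omega>)) (Y (int t) \<omega>)"

abbreviation loss_hat :: "real ^ 'p \<Rightarrow> nat \<Rightarrow> 'a \<Rightarrow> real" where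
  "loss_hat \<theta> t \<omega> \<equiv> dpd_loss a g (eta (lamhat f Y X \<theta> (int t) \<omega>)) (Y (int t) \<omega>)"

lemma measurable_path [measurable]: "path \<in> M \<rightarrow>\<^sub>M PiM UNIV (\<lambda>_. obs_space)"
proof -
  have [measurable]: "lam f Y X \<theta>s t \<in> borel_measurable M" for t
    by (rule measurable_lam(1)) (use measf \<theta>s in auto)
  show ?thesis
    unfolding path_def[abs_def] by (rule measurable_abs_UNIV) measurable
qed

lemma path_loss_shift:
  "path_loss \<theta> (((\<lambda>z t. z (t + 1)) ^^ i) (path \<omega>)) = loss \<theta> (Suc i) \<omega> + (1 + 1 / a)"
proof -
  have "((\<lambda>z t. z (t + 1)) ^^ i) z = (\<lambda>t. z (t + int i))" for z :: "int \<Rightarrow> nat \<times> real \<times> (real ^ 'd)"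
    by (induction i arbitrary: z) (auto simp: algebra_simps)
  then show ?thesis
    unfolding path_loss_def lam_def lagY_def lagX_def path_def
    by (simp add: algebra_simps cong: if_cong)
qed

text \<open>The underlying probability space carries no transformation; stationarity and ergodicity
  are properties of the law of the path. The ergodic theorem is therefore used for the shift on the
  image measure, and its conclusions are pulled back.\<close>

lemma ergodic_map_path:
  "ergodic_map (distr M (PiM UNIV (\<lambda>_. obs_space)) path) (\<lambda>z t. z (t + 1))"
proof -
  let ?S = "PiM UNIV (\<lambda>_::int. obs_space)" and ?T = "\<lambda>z t. z (t + 1 :: int)"
  interpret \<mu>: prob_space "distr M ?S path" by (rule prob_space_distr) measurable
  have T[measurable]: "?T \<in> ?S \<rightarrow>\<^sub>M ?S"
    by (rule measurable_abs_UNIV) measurable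
  show ?thesis
  proof
    show "?T \<in> distr M ?S path \<rightarrow>\<^sub>M distr M ?S path" by simp
    have "distr (distr M ?S path) (distr M ?S path) ?T = distr (distr M ?S path) ?S ?T"
      by (rule distr_cong) auto
    also have "\<dots> = distr M ?S (?T \<circ> path)" by (rule distr_distr) measurable
    also have "\<dots> = distr M ?S path"
      using stat unfolding stationary_proc_def path_def[abs_def] comp_def .
    finally show "distr (distr M ?S path) (distr M ?S path) ?T = distr M ?S path" .
  next
    fix A assume A: "A \<in> sets (distr M ?S path)" "?T -` A \<inter> space (distr M ?S path) = A"
    then have "measure M {\<omega> \<in> space M. path \<omega> \<in> A} \<in> {0, 1}"
      using erg unfolding ergodic_proc_def path_def[abs_def] by simp
    moreover have "path -` A \<inter> space M = {\<omega> \<in> space M. path \<omega> \<in> A}" by auto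
    ultimately show "\<mu>.prob A \<in> {0, 1}" using A by (simp add: measure_distr)
  qed
qed

lemma loss_gap:
  assumes \<epsilon>: "0 < \<epsilon>"
  shows "AE \<omega> in M. \<exists>\<kappa>>0. \<forall>\<^sub>F n in sequentially. \<forall>\<theta>\<in>\<Theta>. \<epsilon> \<le> dist \<theta>s \<theta> \<longrightarrow>
    (\<Sum>i<n. loss \<theta>s (Suc i) \<omega>) / real n + \<kappa> \<le> (\<Sum>i<n. loss \<theta> (Suc i) \<omega>) / real n"
proof -
  let ?S = "PiM UNIV (\<lambda>_::int. obs_space)" and ?T = "\<lambda>z t. z (t + 1 :: int)"
  interpret \<mu>: ergodic_map "distr M ?S path" ?T by (rule ergodic_map_path)
  have meas: "path_loss \<theta> \<in> borel_measurable ?S" if \<theta>: "\<theta> \<in> \<Theta>" for \<theta>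
    unfolding path_loss_def
    by (intro borel_measurable_add borel_measurable_const measurable_dpd_loss g_borel measurable_eta
        measurable_lam(1) measf lam_low \<theta>) measurable
  have risk: "(\<integral>\<^sup>+z. ennreal (path_loss \<theta> z) \<partial>distr M ?S path) = risk \<theta>" if \<theta>: "\<theta> \<in> \<Theta>" for \<theta>
  proof -
    have "(\<integral>\<^sup>+z. ennreal (path_loss \<theta> z) \<partial>distr M ?S path) = (\<integral>\<^sup>+\<omega>. ennreal (path_loss \<theta> (path \<omega>)) \<partial>M)"
      using meas[OF \<theta>] by (intro nn_integral_distr) auto
    also have "\<dots> = risk \<theta>" using path_loss_shift[of \<theta> 0] by (simp add: risk_def)
    finally show ?thesis .
  qed
  have nonneg: "0 \<le> path_loss \<theta> z" if "\<theta> \<in> \<Theta>" for \<theta> z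
    unfolding path_loss_def using that by (rule loss_nonneg)
  have cont: "AE z in distr M ?S path. continuous_on \<Theta> (\<lambda>\<theta>. path_loss \<theta> z)"
  proof -
    have "Measurable.pred ?S (\<lambda>z. fst (z 1) \<in> {y. \<forall>e. g y e \<noteq> 0})" by measurable
    then have "AE z in distr M ?S path. \<forall>e. g (fst (z 1)) e \<noteq> 0"
      using g_nonzero[of 1] by (subst AE_distr_iff) (auto simp: path_def pred_def)
    then show ?thesis
      by eventually_elim (auto simp: path_loss_def lam_def intro!: continuous_on_add loss_cont)
  qed
  have "AE z in distr M ?S path. \<exists>\<kappa>>0. \<forall>\<^sub>F n in sequentially. \<forall>\<theta>\<in>\<Theta>. \<epsilon> \<le> dist \<theta>s \<theta> \<longrightarrow>
    (\<Sum>i<n. path_loss \<theta>s ((?T ^^ i) z)) / real n + \<kappa> \<le> (\<Sum>i<n. path_loss \<theta> ((?T ^^ i) z)) / real n"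
    by (rule \<mu>.ergodic_risk_separation[OF compact_\<Theta> \<theta>s _ _ cont _ _ \<epsilon>])
      (use meas nonneg risk risk_finite risk_separation \<theta>s in auto)
  then have "AE \<omega> in M. \<exists>\<kappa>>0. \<forall>\<^sub>F n in sequentially. \<forall>\<theta>\<in>\<Theta>. \<epsilon> \<le> dist \<theta>s \<theta> \<longrightarrow>
    (\<Sum>i<n. path_loss \<theta>s ((?T ^^ i) (path \<omega>))) / real n + \<kappa> \<le> (\<Sum>i<n. path_loss \<theta> ((?T ^^ i) (path \<omega>))) / real n"
    by (rule AE_distrD[OF measurable_path])
  \<comment> \<open>The constant \<open>1 + 1 / a\<close> occurs on both sides of the comparison and
    cancels.\<close>
  then show ?thesis
    unfolding path_loss_shift by (simp add: sum.distrib add_divide_distrib algebra_simps)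
qed

text \<open>A deterministic argument for one outcome. If the minimiser were at distance at least
  \<epsilon>, its infinite-past average would exceed that at \<open>\<theta>s\<close> by \<kappa>;
  two approximation errors below \<open>\<kappa> / 2\<close> cannot reverse this order.\<close>

lemma argmin_tendsto:
  assumes gap: "\<And>\<epsilon>. 0 < \<epsilon> \<Longrightarrow> \<exists>\<kappa>>0. \<forall>\<^sub>F n in sequentially. \<forall>\<theta>\<in>\<Theta>. \<epsilon> \<le> dist \<theta>s \<theta> \<longrightarrow>
    (\<Sum>i<n. loss \<theta>s (Suc i) \<omega>) / real n + \<kappa> \<le> (\<Sum>i<n. loss \<theta> (Suc i) \<omega>) / real n"
    and approx: "\<And>t \<theta>. 1 \<le> t \<Longrightarrow> \<theta> \<in> \<Theta> \<Longrightarrow> \<bar>loss \<theta> t \<omega> - loss_hat \<theta> t \<omega>\<bar> \<le> r t"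
    and r: "(\<lambda>n. (\<Sum>t\<in>{1..n}. r t) / real n) \<longlonglongrightarrow> 0"
    and est: "\<And>n. n \<ge> 1 \<Longrightarrow> \<theta>hat n \<in> \<Theta> \<and>
        (\<forall>\<theta>\<in>\<Theta>. Hhat a g eta f Y X n (\<theta>hat n) \<omega> \<le> Hhat a g eta f Y X n \<theta> \<omega>)"
  shows "\<theta>hat \<longlonglongrightarrow> \<theta>s"
proof (rule tendstoI)
  fix \<epsilon> :: real assume \<epsilon>: "0 < \<epsilon>"
  obtain \<kappa> where \<kappa>: "0 < \<kappa>" and ev: "\<forall>\<^sub>F n in sequentially. \<forall>\<theta>\<in>\<Theta>. \<epsilon> \<le> dist \<theta>s \<theta> \<longrightarrow>
    (\<Sum>i<n. loss \<theta>s (Suc i) \<omega>) / real n + \<kappa> \<le> (\<Sum>i<n. loss \<theta> (Suc i) \<omega>) / real n"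
    using gap[OF \<epsilon>] by blast
  have H: "\<bar>(\<Sum>i<n. loss \<theta> (Suc i) \<omega>) / real n - Hhat a g eta f Y X n \<theta> \<omega>\<bar> \<le> (\<Sum>t\<in>{1..n}. r t) / real n"
    if "\<theta> \<in> \<Theta>" for \<theta> n
  proof -
    have "(\<Sum>i<n. loss \<theta> (Suc i) \<omega>) = (\<Sum>t\<in>{1..n}. loss \<theta> t \<omega>)"
      by (rule sum.reindex_bij_witness[of _ "\<lambda>t. t - 1" Suc]) auto
    moreover have "Hhat a g eta f Y X n \<theta> \<omega> = (\<Sum>t\<in>{1..n}. loss_hat \<theta> t \<omega>) / real n"
      by (simp add: Hhat_def)
    ultimately have eq: "(\<Sum>i<n. loss \<theta> (Suc i) \<omega>) / real n - Hhat a g eta f Y X n \<theta> \<omega>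
      = (\<Sum>t\<in>{1..n}. loss \<theta> t \<omega> - loss_hat \<theta> t \<omega>) / real n"
      by (simp only: sum_subtractf diff_divide_distrib)
    have "\<bar>\<Sum>t\<in>{1..n}. loss \<theta> t \<omega> - loss_hat \<theta> t \<omega>\<bar> / real n \<le> (\<Sum>t\<in>{1..n}. r t) / real n"
      by (intro divide_right_mono order_trans[OF sum_abs] sum_mono approx that) auto
    then show ?thesis unfolding eq abs_divide by simp
  qed
  have "\<forall>\<^sub>F n in sequentially. (\<Sum>t\<in>{1..n}. r t) / real n < \<kappa> / 2"
    using r \<kappa> by (intro order_tendstoD) auto
  with ev eventually_ge_at_top[of 1] show "\<forall>\<^sub>F n in sequentially. dist (\<theta>hat n) \<theta>s < \<epsilon>"
  proof eventually_elim
    case (elim n)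
    note e = est[OF elim(2)]
    show ?case
    proof (rule ccontr)
      assume "\<not> ?thesis"
      then have "(\<Sum>i<n. loss \<theta>s (Suc i) \<omega>) / real n + \<kappa> \<le> (\<Sum>i<n. loss (\<theta>hat n) (Suc i) \<omega>) / real n"
        using elim(1) e by (auto simp: dist_commute)
      moreover have "Hhat a g eta f Y X n (\<theta>hat n) \<omega> \<le> Hhat a g eta f Y X n \<theta>s \<omega>"
        using e \<theta>s by blast
      ultimately show False
        using H[of "\<theta>hat n" n] H[OF \<theta>s, of n] e elim(3) by linarith
    qed
  qed
qed

end

section \<open>The truncated past\<close>

locale dpd_truncated_model = dpd_count_model M Y X f g eta \<Theta> \<theta>s a c c_eta B
  for M :: "'a measure" and Y and X :: "int \<Rightarrow> 'a \<Rightarrow> real ^ 'd"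
    and f :: "real ^ 'p \<Rightarrow> (nat \<Rightarrow> nat) \<Rightarrow> (nat \<Rightarrow> real ^ 'd) \<Rightarrow> real"
    and g eta \<Theta> \<theta>s a c c_eta B +
  fixes alpha0 phib psib :: "nat \<Rightarrow> real" and \<gamma> C\<alpha> :: real
  assumes alpha_nonneg: "\<And>k. 0 \<le> alpha0 k"
    and \<gamma>: "1 < \<gamma>" and alpha_rate: "\<And>k. 1 \<le> k \<Longrightarrow> alpha0 k \<le> C\<alpha> * real k powr (- \<gamma>)"
    and f_lip: "\<And>y x y' x'.
        summable (\<lambda>k. alpha0 (Suc k) * (\<bar>real (y (Suc k)) - real (y' (Suc k))\<bar> + supn (x (Suc k) - x' (Suc k))))
        \<Longrightarrow> \<forall>\<theta>\<in>\<Theta>. \<bar>f \<theta> y x - f \<theta> y' x'\<bar>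
              \<le> (\<Sum>k. alpha0 (Suc k) * (\<bar>real (y (Suc k)) - real (y' (Suc k))\<bar> + supn (x (Suc k) - x' (Suc k))))"
    and deriv_summable: "\<And>e. summable (\<lambda>y. \<bar>deriv (g y) e\<bar>)"
    and rate_summable: "summable (\<lambda>k. real k powr (- \<gamma>) * max (phib k) (psib k))"
    and phib_pos: "\<And>t. 1 \<le> t \<Longrightarrow> 0 < phib t" and psib_pos: "\<And>t. 1 \<le> t \<Longrightarrow> 0 < psib t"
    and phi_bound: "\<And>t \<delta>. 1 \<le> t \<Longrightarrow> \<delta> \<in> {0..1} \<Longrightarrow>
        (\<integral>\<^sup>+\<omega>. (SUP \<theta>\<in>\<Theta>. ennreal (\<Sum>y. \<bar>deriv (g y)
            (\<delta> * eta (lam f Y X \<theta> (int t) \<omega>) + (1 - \<delta>) * eta (lamhat f Y X \<theta> (int t) \<omega>))\<bar>)) ^ 2 \<partial>M)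
          \<le> ennreal ((phib t)\<^sup>2)"
    and psi_bound: "\<And>t \<delta>. 1 \<le> t \<Longrightarrow> \<delta> \<in> {0..1} \<Longrightarrow>
        (\<integral>\<^sup>+\<omega>. (SUP \<theta>\<in>\<Theta>. ennreal (\<bar>deriv (g (Y (int t) \<omega>))
            (\<delta> * eta (lam f Y X \<theta> (int t) \<omega>) + (1 - \<delta>) * eta (lamhat f Y X \<theta> (int t) \<omega>))
          / g (Y (int t) \<omega>)
            (\<delta> * eta (lam f Y X \<theta> (int t) \<omega>) + (1 - \<delta>) * eta (lamhat f Y X \<theta> (int t) \<omega>))\<bar>)) ^ 2 \<partial>M)
          \<le> ennreal ((psib t)\<^sup>2)"
begin

definition seg :: "real ^ 'p \<Rightarrow> nat \<Rightarrow> real \<Rightarrow> 'a \<Rightarrow> real" where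
  "seg \<theta> t \<delta> \<omega> = \<delta> * eta (lam f Y X \<theta> (int t) \<omega>) + (1 - \<delta>) * eta (lamhat f Y X \<theta> (int t) \<omega>)"

text \<open>The index set is a parameter: for countable \<open>D\<close> the supremum is jointly
  measurable in \<delta> and the outcome, as Fubini's theorem requires, and the moment bounds over
  \<open>\<Theta>\<close> carry over to subsets.\<close>

definition phi_sup :: "(real ^ 'p) set \<Rightarrow> nat \<Rightarrow> real \<Rightarrow> 'a \<Rightarrow> ennreal" where
  "phi_sup D t \<delta> \<omega> = (SUP \<theta>\<in>D. ennreal (\<Sum>y. \<bar>deriv (g y) (seg \<theta> t \<delta> \<omega>)\<bar>))"

definition psi_sup :: "(real ^ 'p) set \<Rightarrow> nat \<Rightarrow> real \<Rightarrow> 'a \<Rightarrow> ennreal" where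
  "psi_sup D t \<delta> \<omega> = (SUP \<theta>\<in>D. ennreal \<bar>deriv (g (Y (int t) \<omega>)) (seg \<theta> t \<delta> \<omega>) / g (Y (int t) \<omega>) (seg \<theta> t \<delta> \<omega>)\<bar>)"

definition obs_norm :: "int \<Rightarrow> 'a \<Rightarrow> real" where
  "obs_norm u \<omega> = real (Y u \<omega>) + supn (X u \<omega>)"

text \<open>Truncation at time \<open>t\<close> replaces the values at times 0, -1, -2, ... by zero,
  that is, the lags \<open>t\<close>, \<open>t + 1\<close>, .... The sum is the resulting Lipschitz
  bound on the intensity error, extended-valued since it is finite only almost surely.\<close>

definition tail :: "nat \<Rightarrow> 'a \<Rightarrow> ennreal" where
  "tail t \<omega> = (\<Sum>k. ennreal (alpha0 (k + t)) * ennreal (obs_norm (- int k) \<omega>))"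

text \<open>A majorant of the loss error common to all parameters in \<open>D\<close>:
  \<open>1 + a\<close> comes from the loss, \<open>c_eta\<close> from the Lipschitz bound on
  \<open>eta\<close>, \<open>tail\<close> from the intensities, and the integral from the slopes
  along the segment.\<close>

definition loss_err :: "(real ^ 'p) set \<Rightarrow> nat \<Rightarrow> 'a \<Rightarrow> ennreal" where
  "loss_err D t \<omega> = ennreal ((1 + a) * c_eta) * (tail t \<omega> *
     (\<integral>\<^sup>+\<delta>. (phi_sup D t \<delta> \<omega> + psi_sup D t \<delta> \<omega>) * indicator {0..1} \<delta> \<partial>lborel))"

lemma obs_norm_nonneg: "0 \<le> obs_norm u \<omega>"
  by (simp add: obs_norm_def supn_nonneg)

lemma measurable_obs_norm [measurable]: "obs_norm u \<in> borel_measurable M"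
  unfolding obs_norm_def by measurable

lemma measurable_tail [measurable]: "tail t \<in> borel_measurable M"
  unfolding tail_def by measurable

lemma deriv_g_borel [measurable]: "deriv (g y) \<in> borel_measurable borel"
  using g_C1(2) by (rule borel_measurable_continuous_onI)

lemma measurable_sups:
  assumes "countable D" "D \<subseteq> \<Theta>"
  shows "(\<lambda>(\<delta>, \<omega>). phi_sup D t \<delta> \<omega>) \<in> borel_measurable (lborel \<Otimes>\<^sub>M M)"
    and "(\<lambda>(\<delta>, \<omega>). psi_sup D t \<delta> \<omega>) \<in> borel_measurable (lborel \<Otimes>\<^sub>M M)"
proof -
  have seg: "(\<lambda>p. seg \<theta> t (fst p) (snd p)) \<in> borel_measurable (lborel \<Otimes>\<^sub>M M)" if "\<theta> \<in> D" for \<theta>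
  proof -
    note [measurable] = measurable_eta_lam[of \<theta>]
    have [simp, measurable]: "\<theta> \<in> \<Theta>" using that assms by auto
    show ?thesis unfolding seg_def by measurable
  qed
  show "(\<lambda>(\<delta>, \<omega>). phi_sup D t \<delta> \<omega>) \<in> borel_measurable (lborel \<Otimes>\<^sub>M M)"
    unfolding phi_sup_def split_beta'
    by (intro borel_measurable_SUP assms measurable_compose[OF _ measurable_ennreal] borel_measurable_suminf
        borel_measurable_abs measurable_compose[OF seg deriv_g_borel])
  have "(\<lambda>p. deriv (g (Y (int t) (snd p))) (seg \<theta> t (fst p) (snd p)) / g (Y (int t) (snd p)) (seg \<theta> t (fst p) (snd p)))
    \<in> borel_measurable (lborel \<Otimes>\<^sub>M M)" if "\<theta> \<in> D" for \<theta>
    by (rule measurable_compose_countable[where g = "\<lambda>p. Y (int t) (snd p)" and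
          f = "\<lambda>y p. deriv (g y) (seg \<theta> t (fst p) (snd p)) / g y (seg \<theta> t (fst p) (snd p))"])
      (intro borel_measurable_divide measurable_compose[OF seg[OF that] deriv_g_borel]
        measurable_compose[OF seg[OF that] g_borel], measurable)
  then show "(\<lambda>(\<delta>, \<omega>). psi_sup D t \<delta> \<omega>) \<in> borel_measurable (lborel \<Otimes>\<^sub>M M)"
    unfolding psi_sup_def split_beta'
    by (intro borel_measurable_SUP assms measurable_compose[OF _ measurable_ennreal] borel_measurable_abs)
qed

lemma sup_bounds:
  assumes "D \<subseteq> \<Theta>" "1 \<le> t" "\<delta> \<in> {0..1}"
  shows "(\<integral>\<^sup>+\<omega>. phi_sup D t \<delta> \<omega> ^ 2 \<partial>M) \<le> ennreal ((phib t)\<^sup>2)"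
    and "(\<integral>\<^sup>+\<omega>. psi_sup D t \<delta> \<omega> ^ 2 \<partial>M) \<le> ennreal ((psib t)\<^sup>2)"
  unfolding phi_sup_def psi_sup_def seg_def
  by (rule order_trans[OF _ phi_bound[OF assms(2,3)]] order_trans[OF _ psi_bound[OF assms(2,3)]],
      intro nn_integral_mono power_mono SUP_subset_mono assms(1) order_refl zero_le)+

lemma alpha_tail: assumes "1 \<le> t"
  shows "(\<Sum>k. ennreal (alpha0 (k + t))) \<le> ennreal (C\<alpha> * (2 powr \<gamma> / (\<gamma> - 1) * real t powr (1 - \<gamma>)))"
proof -
  have C: "0 \<le> C\<alpha>" using alpha_rate[of 1] alpha_nonneg[of 1] by simp
  have "(\<Sum>k<n. ennreal (alpha0 (k + t))) \<le> ennreal (C\<alpha> * (2 powr \<gamma> / (\<gamma> - 1) * real t powr (1 - \<gamma>)))" for n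
  proof -
    have "(\<Sum>k<n. alpha0 (k + t)) \<le> (\<Sum>k<n. C\<alpha> * real (k + t) powr (- \<gamma>))"
      using assms by (intro sum_mono alpha_rate) auto
    also have "\<dots> \<le> C\<alpha> * (2 powr \<gamma> / (\<gamma> - 1) * real t powr (1 - \<gamma>))"
      unfolding sum_distrib_left[symmetric] by (intro mult_left_mono sum_powr_tail_le \<gamma> assms C)
    finally show ?thesis using alpha_nonneg by (simp add: ennreal_leI)
  qed
  then show ?thesis unfolding suminf_eq_SUP by (intro SUP_least)
qed

text \<open>Cauchy-Schwarz is applied lag by lag with the common second-moment bound
  \<open>B\<close>, after the series has been moved outside the expectation.\<close>

lemma tail_mult_le:
  assumes [measurable]: "u \<in> borel_measurable M" and u: "(\<integral>\<^sup>+\<omega>. u \<omega> ^ 2 \<partial>M) \<le> ennreal (p\<^sup>2)" and p: "0 \<le> p"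
  shows "(\<integral>\<^sup>+\<omega>. tail t \<omega> * u \<omega> \<partial>M) \<le> (\<Sum>k. ennreal (alpha0 (k + t))) * ennreal (B * p)"
proof -
  have "(\<integral>\<^sup>+\<omega>. tail t \<omega> * u \<omega> \<partial>M)
    = (\<integral>\<^sup>+\<omega>. (\<Sum>k. ennreal (alpha0 (k + t)) * (ennreal (obs_norm (- int k) \<omega>) * u \<omega>)) \<partial>M)"
    by (simp add: tail_def ennreal_suminf_multc[symmetric] mult.assoc)
  also have "\<dots> = (\<Sum>k. ennreal (alpha0 (k + t)) * (\<integral>\<^sup>+\<omega>. ennreal (obs_norm (- int k) \<omega>) * u \<omega> \<partial>M))"
    by (subst nn_integral_suminf) (auto simp: nn_integral_cmult)
  also have "\<dots> \<le> (\<Sum>k. ennreal (alpha0 (k + t)) * ennreal (B * p))"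
    using second_moment unfolding obs_norm_def[symmetric]
    by (intro suminf_le mult_left_mono nn_integral_mult_le u B p) auto
  finally show ?thesis by (simp add: ennreal_suminf_multc)
qed

lemma AE_tail_finite: assumes "1 \<le> t" shows "AE \<omega> in M. tail t \<omega> < \<infinity>"
proof -
  have "(\<integral>\<^sup>+\<omega>. tail t \<omega> \<partial>M) \<le> (\<Sum>k. ennreal (alpha0 (k + t))) * ennreal (B * 1)"
    using tail_mult_le[of "\<lambda>_. 1" 1 t] by (simp add: emeasure_space_1)
  also have "\<dots> < \<infinity>"
    using le_less_trans[OF alpha_tail[OF assms], of \<infinity>] by (simp add: ennreal_mult_less_top)
  finally have "AE \<omega> in M. tail t \<omega> \<noteq> \<infinity>" by (intro nn_integral_PInf_AE) auto
  then show ?thesis by eventually_elim (simp add: less_top)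
qed

lemma measurable_slope_integral:
  assumes "countable D" "D \<subseteq> \<Theta>"
  shows "(\<lambda>\<omega>. \<integral>\<^sup>+\<delta>. (phi_sup D t \<delta> \<omega> + psi_sup D t \<delta> \<omega>) * indicator {0..1} \<delta> \<partial>lborel) \<in> borel_measurable M"
proof -
  note [measurable] = measurable_sups[OF assms]
  have "(\<lambda>(\<omega>, \<delta>). phi_sup D t \<delta> \<omega>) \<in> borel_measurable (M \<Otimes>\<^sub>M lborel)"
    "(\<lambda>(\<omega>, \<delta>). psi_sup D t \<delta> \<omega>) \<in> borel_measurable (M \<Otimes>\<^sub>M lborel)"
    by measurable
  note [measurable] = this
  show ?thesis by measurable
qed

lemma measurable_loss_err:
  assumes "countable D" "D \<subseteq> \<Theta>"
  shows "loss_err D t \<in> borel_measurable M"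
  unfolding loss_err_def using measurable_slope_integral[OF assms] by measurable

text \<open>Fubini's theorem puts the \<delta> integral outermost, where the second-moment bounds at
  fixed \<delta> apply. The factor 2 comes from bounding the two slope terms by the same
  maximum.\<close>

lemma loss_err_integral:
  assumes D: "countable D" "D \<subseteq> \<Theta>" and t: "1 \<le> t"
  shows "(\<integral>\<^sup>+\<omega>. loss_err D t \<omega> \<partial>M) \<le> ennreal ((1 + a) * c_eta * (C\<alpha> * (2 powr \<gamma> / (\<gamma> - 1) * real t powr (1 - \<gamma>))
    * (B * (2 * max (phib t) (psib t)))))"
proof -
  interpret P: pair_sigma_finite lborel M by unfold_locales
  note [measurable] = measurable_sups[OF D]
  let ?S = "\<lambda>\<delta> \<omega>. phi_sup D t \<delta> \<omega> + psi_sup D t \<delta> \<omega>"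
  let ?A = "\<Sum>k. ennreal (alpha0 (k + t))" and ?m = "max (phib t) (psib t)"
  have [measurable]: "phi_sup D t \<delta> \<in> borel_measurable M" "psi_sup D t \<delta> \<in> borel_measurable M" for \<delta>
    using measurable_compose_Pair1[OF _ measurable_sups(1)[OF D], of \<delta>]
      measurable_compose_Pair1[OF _ measurable_sups(2)[OF D], of \<delta>] by auto
  have [measurable]: "(\<lambda>\<delta>. phi_sup D t \<delta> \<omega>) \<in> borel_measurable lborel" "(\<lambda>\<delta>. psi_sup D t \<delta> \<omega>) \<in> borel_measurable lborel"
    if "\<omega> \<in> space M" for \<omega>
    using measurable_compose[OF measurable_Pair2'[OF that] measurable_sups(1)[OF D]]
      measurable_compose[OF measurable_Pair2'[OF that] measurable_sups(2)[OF D]] by auto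
  have bound: "(\<integral>\<^sup>+\<omega>. tail t \<omega> * ?S \<delta> \<omega> \<partial>M) \<le> ?A * ennreal (B * (2 * ?m))" if "\<delta> \<in> {0..1}" for \<delta>
  proof -
    have "(\<integral>\<^sup>+\<omega>. tail t \<omega> * ?S \<delta> \<omega> \<partial>M)
      = (\<integral>\<^sup>+\<omega>. tail t \<omega> * phi_sup D t \<delta> \<omega> \<partial>M) + (\<integral>\<^sup>+\<omega>. tail t \<omega> * psi_sup D t \<delta> \<omega> \<partial>M)"
      by (subst nn_integral_add[symmetric]) (auto simp: distrib_left)
    also have "\<dots> \<le> ?A * ennreal (B * phib t) + ?A * ennreal (B * psib t)"
      using phib_pos[OF t] psib_pos[OF t]
      by (intro add_mono tail_mult_le sup_bounds D t that) auto
    also have "\<dots> \<le> ?A * ennreal (B * ?m) + ?A * ennreal (B * ?m)"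
      using B by (intro add_mono mult_left_mono ennreal_leI) auto
    also have "\<dots> = ?A * ennreal (B * (2 * ?m))"
      using B phib_pos[OF t] by (simp add: distrib_left[symmetric] ennreal_plus[symmetric] del: ennreal_plus)
    finally show ?thesis .
  qed
  have "(\<integral>\<^sup>+\<omega>. tail t \<omega> * (\<integral>\<^sup>+\<delta>. ?S \<delta> \<omega> * indicator {0..1} \<delta> \<partial>lborel) \<partial>M)
    = (\<integral>\<^sup>+\<omega>. (\<integral>\<^sup>+\<delta>. tail t \<omega> * ?S \<delta> \<omega> * indicator {0..1} \<delta> \<partial>lborel) \<partial>M)"
    by (intro nn_integral_cong, subst nn_integral_cmult[symmetric]) (auto simp: mult.assoc)
  also have "\<dots> = (\<integral>\<^sup>+\<delta>. (\<integral>\<^sup>+\<omega>. tail t \<omega> * ?S \<delta> \<omega> * indicator {0..1} \<delta> \<partial>M) \<partial>lborel)"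
    by (rule P.Fubini') measurable
  also have "\<dots> = (\<integral>\<^sup>+\<delta>. (\<integral>\<^sup>+\<omega>. tail t \<omega> * ?S \<delta> \<omega> \<partial>M) * indicator {0..1} \<delta> \<partial>lborel)"
    by (intro nn_integral_cong nn_integral_multc) measurable
  also have "\<dots> \<le> (\<integral>\<^sup>+\<delta>. ?A * ennreal (B * (2 * ?m)) * indicator {0..1::real} \<delta> \<partial>lborel)"
  proof (rule nn_integral_mono)
    show "(\<integral>\<^sup>+\<omega>. tail t \<omega> * ?S \<delta> \<omega> \<partial>M) * indicator {0..1} \<delta> \<le> ?A * ennreal (B * (2 * ?m)) * indicator {0..1} \<delta>" for \<delta>
      using bound[of \<delta>] by (cases "\<delta> \<in> {0..1}") auto
  qed
  also have "\<dots> = ?A * ennreal (B * (2 * ?m))"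
    by (subst nn_integral_cmult_indicator) auto
  also have "\<dots> \<le> ennreal (C\<alpha> * (2 powr \<gamma> / (\<gamma> - 1) * real t powr (1 - \<gamma>))) * ennreal (B * (2 * ?m))"
    by (intro mult_right_mono alpha_tail t) auto
  finally have le: "(\<integral>\<^sup>+\<omega>. tail t \<omega> * (\<integral>\<^sup>+\<delta>. ?S \<delta> \<omega> * indicator {0..1} \<delta> \<partial>lborel) \<partial>M)
    \<le> ennreal (C\<alpha> * (2 powr \<gamma> / (\<gamma> - 1) * real t powr (1 - \<gamma>))) * ennreal (B * (2 * ?m))" .
  have "(\<integral>\<^sup>+\<omega>. loss_err D t \<omega> \<partial>M) = ennreal ((1 + a) * c_eta) *
      (\<integral>\<^sup>+\<omega>. tail t \<omega> * (\<integral>\<^sup>+\<delta>. ?S \<delta> \<omega> * indicator {0..1} \<delta> \<partial>lborel) \<partial>M)"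
    unfolding loss_err_def using measurable_slope_integral[OF D] by (intro nn_integral_cmult) measurable
  also have "\<dots> \<le> ennreal ((1 + a) * c_eta) *
      (ennreal (C\<alpha> * (2 powr \<gamma> / (\<gamma> - 1) * real t powr (1 - \<gamma>))) * ennreal (B * (2 * ?m)))"
    by (intro mult_left_mono le) auto
  also have "\<dots> = ennreal ((1 + a) * c_eta * (C\<alpha> * (2 powr \<gamma> / (\<gamma> - 1) * real t powr (1 - \<gamma>)) * (B * (2 * ?m))))"
  proof -
    have 1: "0 \<le> C\<alpha> * (2 powr \<gamma> / (\<gamma> - 1) * real t powr (1 - \<gamma>))"
      using alpha_rate[of 1] alpha_nonneg[of 1] \<gamma> by (intro mult_nonneg_nonneg) auto
    have 2: "0 \<le> B * (2 * ?m)" using B phib_pos[OF t] by (intro mult_nonneg_nonneg) auto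
    have 3: "0 \<le> (1 + a) * c_eta" using a c_eta by simp
    show ?thesis using ennreal_mult[OF 3 mult_nonneg_nonneg[OF 1 2]] ennreal_mult[OF 1 2] by simp
  qed
  finally show ?thesis .
qed

lemma abs_lam_diff_le:
  assumes t: "1 \<le> t" and fin: "tail t \<omega> < \<infinity>" and \<theta>: "\<theta> \<in> \<Theta>"
  shows "ennreal \<bar>lam f Y X \<theta> (int t) \<omega> - lamhat f Y X \<theta> (int t) \<omega>\<bar> \<le> tail t \<omega>"
proof -
  \<comment> \<open>Index \<open>k\<close> stands for lag \<open>Suc k\<close>. The lags 1 to
    \<open>t - 1\<close> agree in both pasts, so the first nonzero index can be
    \<open>t - 1\<close>, which is lag \<open>t\<close> and time 0. Finiteness of
    \<open>tail\<close> supplies the summability that \<open>f_lip\<close> demands.\<close>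
  define b where "b k = alpha0 (Suc k) *
    (\<bar>real (lagY Y (int t) \<omega> (Suc k)) - real (tlagY Y (int t) \<omega> (Suc k))\<bar>
      + supn (lagX X (int t) \<omega> (Suc k) - tlagX X (int t) \<omega> (Suc k)))" for k
  let ?b = "\<lambda>k. alpha0 (k + t) * obs_norm (- int k) \<omega>"
  have b0: "b k = 0" if "k < t - 1" for k
  proof -
    have "int (Suc k) < int t" using that by simp
    then show ?thesis by (simp add: b_def lagY_def tlagY_def lagX_def tlagX_def supn_def)
  qed
  have b1: "b (k + (t - 1)) = ?b k" for k
  proof -
    have "Suc (k + (t - 1)) = k + t" "int t - int (k + t) = - int k" "\<not> int (k + t) < int t" "k + t \<noteq> 0"
      using t by auto
    then show ?thesis
      unfolding b_def lagY_def tlagY_def lagX_def tlagX_def obs_norm_def by simp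
  qed
  have nn: "0 \<le> ?b k" for k by (simp add: alpha_nonneg obs_norm_nonneg)
  have tail: "tail t \<omega> = (\<Sum>k. ennreal (?b k))"
    unfolding tail_def by (simp add: ennreal_mult alpha_nonneg obs_norm_nonneg)
  have s: "summable ?b"
    by (rule summable_suminf_not_top) (use nn fin tail in auto)
  then have sb: "summable b"
    unfolding b1[symmetric] by (simp only: summable_iff_shift)
  have "suminf b = suminf ?b"
    using suminf_split_initial_segment[OF sb, of "t - 1"] b0 unfolding b1 by simp
  moreover have "\<bar>lam f Y X \<theta> (int t) \<omega> - lamhat f Y X \<theta> (int t) \<omega>\<bar> \<le> suminf b"
    using f_lip[OF sb[unfolded b_def]] \<theta> unfolding lam_def lamhat_def b_def by blast
  moreover have "ennreal (suminf ?b) = tail t \<omega>"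
    unfolding tail by (rule suminf_ennreal2[OF nn s, symmetric])
  ultimately show ?thesis using ennreal_leI by fastforce
qed

lemma abs_loss_diff_le:
  assumes D: "countable D" "D \<subseteq> \<Theta>" and \<theta>: "\<theta> \<in> D" and t: "1 \<le> t" and \<omega>: "\<omega> \<in> space M"
    and nz: "\<And>e. g (Y (int t) \<omega>) e \<noteq> 0" and fin: "tail t \<omega> < \<infinity>"
  shows "ennreal \<bar>loss \<theta> t \<omega> - loss_hat \<theta> t \<omega>\<bar> \<le> loss_err D t \<omega>"
proof -
  let ?S = "eta ` {c..}" and ?y = "Y (int t) \<omega>"
  let ?l = "lam f Y X \<theta> (int t) \<omega>" and ?l' = "lamhat f Y X \<theta> (int t) \<omega>"
  have \<theta>': "\<theta> \<in> \<Theta>" using \<theta> D by auto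
  have low: "c \<le> ?l" "c \<le> ?l'" by (rule lam_low[OF \<theta>'])+
  have pos: "0 < g ?y e" if "e \<in> ?S" for e
    using pmf[OF that] nz[of e] by (metis order_le_less)
  have mphi: "(\<lambda>\<delta>. phi_sup D t \<delta> \<omega>) \<in> borel_measurable lborel"
    and mpsi: "(\<lambda>\<delta>. psi_sup D t \<delta> \<omega>) \<in> borel_measurable lborel"
    using measurable_compose[OF measurable_Pair2'[OF \<omega>] measurable_sups(1)[OF D]]
      measurable_compose[OF measurable_Pair2'[OF \<omega>] measurable_sups(2)[OF D]] by auto
  note [measurable] = mphi mpsi
  let ?d = "ennreal \<bar>eta ?l - eta ?l'\<bar>"
  let ?I = "\<lambda>u. \<integral>\<^sup>+\<delta>. u \<delta> * indicator {0..1} \<delta> \<partial>lborel"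
  have A: "(\<Sum>z. ennreal \<bar>g z (eta ?l) - g z (eta ?l')\<bar>) \<le> ?d * ?I (\<lambda>\<delta>. phi_sup D t \<delta> \<omega>)"
  proof -
    have [measurable]: "(\<lambda>\<delta>. seg \<theta> t \<delta> \<omega>) \<in> borel_measurable lborel"
      unfolding seg_def by measurable
    have "ennreal \<bar>g z (eta ?l) - g z (eta ?l')\<bar> \<le> ?d * ?I (\<lambda>\<delta>. ennreal \<bar>deriv (g z) (seg \<theta> t \<delta> \<omega>)\<bar>)" for z
      unfolding seg_def using g_C1 by (intro abs_diff_le_nn_integral_deriv[where S = UNIV]) auto
    then have "(\<Sum>z. ennreal \<bar>g z (eta ?l) - g z (eta ?l')\<bar>)
      \<le> (\<Sum>z. ?d * ?I (\<lambda>\<delta>. ennreal \<bar>deriv (g z) (seg \<theta> t \<delta> \<omega>)\<bar>))"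
      by (intro suminf_le) auto
    also have "\<dots> = ?d * (\<Sum>z. ?I (\<lambda>\<delta>. ennreal \<bar>deriv (g z) (seg \<theta> t \<delta> \<omega>)\<bar>))"
      by (rule ennreal_suminf_cmult)
    finally have 1: "(\<Sum>z. ennreal \<bar>g z (eta ?l) - g z (eta ?l')\<bar>)
      \<le> ?d * (\<Sum>z. ?I (\<lambda>\<delta>. ennreal \<bar>deriv (g z) (seg \<theta> t \<delta> \<omega>)\<bar>))" .
    have "(\<Sum>z. ?I (\<lambda>\<delta>. ennreal \<bar>deriv (g z) (seg \<theta> t \<delta> \<omega>)\<bar>))
      = (\<integral>\<^sup>+\<delta>. (\<Sum>z. ennreal \<bar>deriv (g z) (seg \<theta> t \<delta> \<omega>)\<bar> * indicator {0..1} \<delta>) \<partial>lborel)"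
      by (rule nn_integral_suminf[symmetric]) measurable
    also have "\<dots> \<le> ?I (\<lambda>\<delta>. phi_sup D t \<delta> \<omega>)"
    proof (rule nn_integral_mono)
      fix \<delta>
      have "(\<Sum>z. ennreal \<bar>deriv (g z) (seg \<theta> t \<delta> \<omega>)\<bar>) = ennreal (\<Sum>z. \<bar>deriv (g z) (seg \<theta> t \<delta> \<omega>)\<bar>)"
        by (rule suminf_ennreal2[OF _ deriv_summable]) simp
      also have "\<dots> \<le> phi_sup D t \<delta> \<omega>"
        unfolding phi_sup_def by (rule SUP_upper[OF \<theta>])
      finally show "(\<Sum>z. ennreal \<bar>deriv (g z) (seg \<theta> t \<delta> \<omega>)\<bar> * indicator {0..1} \<delta>)
        \<le> phi_sup D t \<delta> \<omega> * indicator {0..1} \<delta>"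
        by (simp add: ennreal_suminf_multc mult_right_mono)
    qed
    finally show ?thesis by (intro order_trans[OF 1] mult_left_mono zero_le)
  qed
  have B: "ennreal \<bar>ln (g ?y (eta ?l)) - ln (g ?y (eta ?l'))\<bar> \<le> ?d * ?I (\<lambda>\<delta>. psi_sup D t \<delta> \<omega>)"
  proof -
    have "ennreal \<bar>ln (g ?y (eta ?l)) - ln (g ?y (eta ?l'))\<bar>
      \<le> ?d * ?I (\<lambda>\<delta>. ennreal \<bar>deriv (g ?y) (seg \<theta> t \<delta> \<omega>) / g ?y (seg \<theta> t \<delta> \<omega>)\<bar>)"
      unfolding seg_def
    \<comment> \<open>For the logarithm the segment must stay in the convex set \<open>?S\<close>,
      where \<open>g ?y\<close> is positive; the preceding estimate for \<open>g z\<close> could use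
      the whole line.\<close>
    proof (rule abs_diff_le_nn_integral_deriv[where S = ?S and G = "\<lambda>e. ln (g ?y e)"
          and G' = "\<lambda>e. deriv (g ?y) e / g ?y e"])
      show "((\<lambda>e. ln (g ?y e)) has_real_derivative deriv (g ?y) e / g ?y e) (at e)" if "e \<in> ?S" for e
        using pos[OF that] by (auto intro!: derivative_eq_intros g_C1(1))
      show "continuous_on ?S (\<lambda>e. deriv (g ?y) e / g ?y e)"
        using nz by (intro continuous_on_divide g_cont continuous_on_subset[OF g_C1(2)]) auto
    qed (use convex_range low in auto)
    also have "\<dots> \<le> ?d * ?I (\<lambda>\<delta>. psi_sup D t \<delta> \<omega>)"
      unfolding psi_sup_def by (intro mult_left_mono nn_integral_mono mult_right_mono SUP_upper \<theta>) auto
    finally show ?thesis .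
  qed
  have "?I (\<lambda>\<delta>. phi_sup D t \<delta> \<omega> + psi_sup D t \<delta> \<omega>)
    = ?I (\<lambda>\<delta>. phi_sup D t \<delta> \<omega>) + ?I (\<lambda>\<delta>. psi_sup D t \<delta> \<omega>)"
    unfolding distrib_right by (rule nn_integral_add) measurable
  then have "(\<Sum>z. ennreal \<bar>g z (eta ?l) - g z (eta ?l')\<bar>) + ennreal \<bar>ln (g ?y (eta ?l)) - ln (g ?y (eta ?l'))\<bar>
    \<le> ?d * ?I (\<lambda>\<delta>. phi_sup D t \<delta> \<omega> + psi_sup D t \<delta> \<omega>)"
    using add_mono[OF A B] by (simp only: distrib_left)
  also have "\<dots> \<le> ennreal c_eta * tail t \<omega> * ?I (\<lambda>\<delta>. phi_sup D t \<delta> \<omega> + psi_sup D t \<delta> \<omega>)"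
  proof (rule mult_right_mono)
    have "?d \<le> ennreal (c_eta * \<bar>?l - ?l'\<bar>)" using eta_lip low by (intro ennreal_leI) auto
    also have "\<dots> = ennreal c_eta * ennreal \<bar>?l - ?l'\<bar>" using c_eta by (intro ennreal_mult) auto
    also have "\<dots> \<le> ennreal c_eta * tail t \<omega>" by (intro mult_left_mono abs_lam_diff_le t fin \<theta>') auto
    finally show "?d \<le> ennreal c_eta * tail t \<omega>" .
  qed simp
  finally have "ennreal (1 + a) * ((\<Sum>z. ennreal \<bar>g z (eta ?l) - g z (eta ?l')\<bar>)
      + ennreal \<bar>ln (g ?y (eta ?l)) - ln (g ?y (eta ?l'))\<bar>)
    \<le> ennreal (1 + a) * (ennreal c_eta * tail t \<omega> * ?I (\<lambda>\<delta>. phi_sup D t \<delta> \<omega> + psi_sup D t \<delta> \<omega>))"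
    by (intro mult_left_mono) auto
  moreover have "ennreal (1 + a) * (ennreal c_eta * tail t \<omega> * ?I (\<lambda>\<delta>. phi_sup D t \<delta> \<omega> + psi_sup D t \<delta> \<omega>))
    = loss_err D t \<omega>"
    unfolding loss_err_def using a c_eta by (simp add: ennreal_mult mult.assoc)
  ultimately have F: "ennreal (1 + a) * ((\<Sum>z. ennreal \<bar>g z (eta ?l) - g z (eta ?l')\<bar>)
      + ennreal \<bar>ln (g ?y (eta ?l)) - ln (g ?y (eta ?l'))\<bar>) \<le> loss_err D t \<omega>"
    by (simp only:)
  show ?thesis
    by (rule order_trans[OF abs_dpd_loss_diff_le[where g = g and e = "eta ?l" and e' = "eta ?l'" and a = a and y = ?y] F])
      (use low a pos in \<open>auto intro: pmf_g\<close>)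
qed

text \<open>The factor \<open>1 / t\<close> lowers the exponent \<open>1 - \<gamma>\<close> to
  \<open>- \<gamma>\<close>, so the means of \<open>loss_err D t / t\<close> are dominated by a
  multiple of the series in the rate condition. One random sequence \<open>r\<close> then serves all
  parameters at once.\<close>

lemma AE_loss_approx:
  "AE \<omega> in M. \<exists>r. (\<forall>t\<ge>1. \<forall>\<theta>\<in>\<Theta>. \<bar>loss \<theta> t \<omega> - loss_hat \<theta> t \<omega>\<bar> \<le> r t) \<and>
    (\<lambda>n. (\<Sum>t\<in>{1..n}. r t) / real n) \<longlonglongrightarrow> 0"
proof -
  obtain D where D: "countable D" "D \<subseteq> \<Theta>" "\<Theta> \<subseteq> closure D"
    using separable[of \<Theta>] by blast
  note [measurable] = measurable_loss_err[OF D(1,2)]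
  define K where "K = (1 + a) * c_eta * (C\<alpha> * (2 powr \<gamma> / (\<gamma> - 1)) * (B * 2))"
  let ?w = "\<lambda>t. real t powr (- \<gamma>) * max (phib t) (psib t)"
  let ?v = "\<lambda>t \<omega>. loss_err D (Suc t) \<omega> * ennreal (1 / real (Suc t))"
  have K: "0 \<le> K"
    unfolding K_def using alpha_rate[of 1] alpha_nonneg[of 1] \<gamma> a c_eta B by (intro mult_nonneg_nonneg) auto
  have w: "0 \<le> ?w (Suc t)" for t using phib_pos[of "Suc t"] by (intro mult_nonneg_nonneg) auto
  have le: "(\<integral>\<^sup>+\<omega>. ?v t \<omega> \<partial>M) \<le> ennreal (K * ?w (Suc t))" for t
  proof -
    have "(\<integral>\<^sup>+\<omega>. ?v t \<omega> \<partial>M) = (\<integral>\<^sup>+\<omega>. loss_err D (Suc t) \<omega> \<partial>M) * ennreal (1 / real (Suc t))"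
      by (rule nn_integral_multc) measurable
    also have "\<dots> \<le> ennreal ((1 + a) * c_eta * (C\<alpha> * (2 powr \<gamma> / (\<gamma> - 1) * real (Suc t) powr (1 - \<gamma>))
      * (B * (2 * max (phib (Suc t)) (psib (Suc t)))))) * ennreal (1 / real (Suc t))"
      by (intro mult_right_mono loss_err_integral D) auto
    also have "\<dots> = ennreal ((1 + a) * c_eta * (C\<alpha> * (2 powr \<gamma> / (\<gamma> - 1) * real (Suc t) powr (1 - \<gamma>))
      * (B * (2 * max (phib (Suc t)) (psib (Suc t))))) * (1 / real (Suc t)))"
      by (rule ennreal_mult''[symmetric]) simp
    also have "real (Suc t) powr (1 - \<gamma>) = real (Suc t) * real (Suc t) powr (- \<gamma>)"
      by (simp add: powr_diff powr_minus divide_inverse)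
    also have "(1 + a) * c_eta * (C\<alpha> * (2 powr \<gamma> / (\<gamma> - 1) * (real (Suc t) * real (Suc t) powr (- \<gamma>)))
      * (B * (2 * max (phib (Suc t)) (psib (Suc t))))) * (1 / real (Suc t)) = K * ?w (Suc t)"
      by (simp add: K_def del: of_nat_Suc)
    finally show ?thesis .
  qed
  have "(\<integral>\<^sup>+\<omega>. (\<Sum>t. ?v t \<omega>) \<partial>M) = (\<Sum>t. \<integral>\<^sup>+\<omega>. ?v t \<omega> \<partial>M)"
    by (rule nn_integral_suminf) measurable
  also have "\<dots> \<le> (\<Sum>t. ennreal (K * ?w (Suc t)))"
    by (intro suminf_le le) auto
  also have "\<dots> = ennreal (\<Sum>t. K * ?w (Suc t))"
  proof (rule suminf_ennreal2)
    have "summable (\<lambda>t. ?w (Suc t))" using rate_summable by (subst summable_Suc_iff)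
    then show "summable (\<lambda>t. K * ?w (Suc t))" by (rule summable_mult)
  qed (use K w in \<open>rule mult_nonneg_nonneg\<close>)
  also have "\<dots> < \<infinity>" by simp
  finally have "AE \<omega> in M. (\<Sum>t. ?v t \<omega>) \<noteq> \<infinity>"
    by (intro nn_integral_PInf_AE) auto
  moreover have "AE \<omega> in M. \<forall>t. 1 \<le> t \<longrightarrow> tail t \<omega> < \<infinity>"
    using AE_tail_finite by (subst AE_all_countable) auto
  moreover have "AE \<omega> in M. \<forall>t::nat. 1 \<le> t \<longrightarrow> (\<forall>e. g (Y (int t) \<omega>) e \<noteq> 0)"
    using g_nonzero by (subst AE_all_countable) auto
  ultimately show ?thesis using AE_space
  proof eventually_elim
    case (elim \<omega>)
    define r where "r t = (if t = 0 then 0 else enn2real (loss_err D t \<omega>))" for t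
    have "(\<Sum>t. ?v t \<omega>) < top" using elim(1) by (simp add: less_top)
    then have v: "?v t \<omega> < top" for t by (rule ennreal_suminf_lessD)
    have fin: "loss_err D (Suc t) \<omega> < \<infinity>" for t
    proof (rule ccontr)
      assume "\<not> ?thesis"
      then have "loss_err D (Suc t) \<omega> = top" by (simp add: not_less top_unique)
      then show False using v[of t] by (simp add: ennreal_top_mult)
    qed
    have r: "?v t \<omega> = ennreal (r (Suc t) / real (Suc t))" for t
      using fin[of t] by (simp add: r_def divide_inverse ennreal_mult'' del: of_nat_Suc)
    have "summable (\<lambda>t. r (Suc t) / real (Suc t))"
    proof (rule summable_suminf_not_top)
      show "(\<Sum>t. ennreal (r (Suc t) / real (Suc t))) \<noteq> top" using elim(1) unfolding r by simp
    qed (simp add: r_def)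
    then have "summable (\<lambda>t. r t / real t)"
      by (rule iffD1[OF summable_Suc_iff[of "\<lambda>t. r t / real t"]])
    then have lim: "(\<lambda>n. (\<Sum>t\<in>{1..n}. r t) / real n) \<longlonglongrightarrow> 0"
      by (intro averages_tendsto_0) (auto simp: r_def)
    have "\<bar>loss \<theta> t \<omega> - loss_hat \<theta> t \<omega>\<bar> \<le> r t" if t: "1 \<le> t" and \<theta>: "\<theta> \<in> \<Theta>" for t \<theta>
    proof -
      have nz: "\<And>e. g (Y (int t) \<omega>) e \<noteq> 0" using elim(3) t by blast
      have onD: "\<bar>loss \<theta> t \<omega> - loss_hat \<theta> t \<omega>\<bar> \<le> r t" if "\<theta> \<in> D" for \<theta>
      proof -
        have "ennreal \<bar>loss \<theta> t \<omega> - loss_hat \<theta> t \<omega>\<bar> \<le> loss_err D t \<omega>"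
          using elim t by (intro abs_loss_diff_le D that nz) auto
        moreover have "loss_err D t \<omega> = ennreal (r t)"
          using fin[of "t - 1"] t by (simp add: r_def)
        moreover have "0 \<le> r t" by (simp add: r_def)
        ultimately show ?thesis by simp
      qed
      \<comment> \<open>The majorant is so far established on the countable set \<open>D\<close>;
        continuity of both losses extends it to its closure within \<open>\<Theta>\<close>.\<close>
      have cont: "continuous_on \<Theta> (\<lambda>\<theta>. \<bar>loss \<theta> t \<omega> - loss_hat \<theta> t \<omega>\<bar>)"
        unfolding lam_def lamhat_def by (intro continuous_intros loss_cont nz)
      have "\<theta> \<in> closure D" using D(3) \<theta> by blast
      then obtain x where x: "\<And>n. x n \<in> D" "x \<longlonglongrightarrow> \<theta>"
        unfolding closure_sequential by blast
      have "(\<lambda>n. \<bar>loss (x n) t \<omega> - loss_hat (x n) t \<omega>\<bar>) \<longlonglongrightarrow> \<bar>loss \<theta> t \<omega> - loss_hat \<theta> t \<omega>\<bar>"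
        by (rule continuous_on_tendsto_compose[OF cont x(2) \<theta>]) (intro always_eventually allI subsetD[OF D(2)] x(1))
      then show ?thesis
        by (rule LIMSEQ_le_const2) (use onD x(1) in auto)
    qed
    then show ?case using lim by blast
  qed
qed

lemma argmin_AE_tendsto:
  assumes est: "\<And>n \<omega>. n \<ge> 1 \<Longrightarrow> \<omega> \<in> space M \<Longrightarrow> \<theta>hat n \<omega> \<in> \<Theta> \<and>
        (\<forall>\<theta>\<in>\<Theta>. Hhat a g eta f Y X n (\<theta>hat n \<omega>) \<omega> \<le> Hhat a g eta f Y X n \<theta> \<omega>)"
  shows "AE \<omega> in M. (\<lambda>n. \<theta>hat n \<omega>) \<longlonglongrightarrow> \<theta>s"
proof -
  let ?gap = "\<lambda>\<epsilon> \<omega>. \<exists>\<kappa>>0. \<forall>\<^sub>F n in sequentially. \<forall>\<theta>\<in>\<Theta>. \<epsilon> \<le> dist \<theta>s \<theta> \<longrightarrow>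
    (\<Sum>i<n. loss \<theta>s (Suc i) \<omega>) / real n + \<kappa> \<le> (\<Sum>i<n. loss \<theta> (Suc i) \<omega>) / real n"
  \<comment> \<open>The null set depends on the radius, so countably many radii are treated
    simultaneously. A gap for a smaller radius yields one for every larger radius.\<close>
  have "AE \<omega> in M. \<forall>j::nat. ?gap (1 / real (Suc j)) \<omega>"
    unfolding AE_all_countable by (intro allI loss_gap) simp
  then show ?thesis
    using AE_loss_approx AE_space
  proof eventually_elim
    case (elim \<omega>)
    then obtain r where r: "\<And>t \<theta>. 1 \<le> t \<Longrightarrow> \<theta> \<in> \<Theta> \<Longrightarrow> \<bar>loss \<theta> t \<omega> - loss_hat \<theta> t \<omega>\<bar> \<le> r t"
      "(\<lambda>n. (\<Sum>t\<in>{1..n}. r t) / real n) \<longlonglongrightarrow> 0" by blast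
    have gap: "?gap \<epsilon> \<omega>" if \<epsilon>: "0 < \<epsilon>" for \<epsilon>
    proof -
      obtain j :: nat where j: "1 / real (Suc j) < \<epsilon>" using nat_approx_posE[OF \<epsilon>] by blast
      obtain \<kappa> where \<kappa>: "0 < \<kappa>" "\<forall>\<^sub>F n in sequentially. \<forall>\<theta>\<in>\<Theta>. 1 / real (Suc j) \<le> dist \<theta>s \<theta> \<longrightarrow>
        (\<Sum>i<n. loss \<theta>s (Suc i) \<omega>) / real n + \<kappa> \<le> (\<Sum>i<n. loss \<theta> (Suc i) \<omega>) / real n"
        using elim(1) by blast
      from \<kappa>(2) have "\<forall>\<^sub>F n in sequentially. \<forall>\<theta>\<in>\<Theta>. \<epsilon> \<le> dist \<theta>s \<theta> \<longrightarrow>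
        (\<Sum>i<n. loss \<theta>s (Suc i) \<omega>) / real n + \<kappa> \<le> (\<Sum>i<n. loss \<theta> (Suc i) \<omega>) / real n"
        by (rule eventually_mono) (use j in auto)
      then show ?thesis using \<kappa>(1) by blast
    qed
    show ?case
      by (rule argmin_tendsto[OF gap r]) (use est elim(3) in auto)
  qed
qed

end

section \<open>From the stated hypotheses to the working assumptions\<close>

lemma bigo_powr_bound:
  fixes u :: "nat \<Rightarrow> real"
  assumes "u \<in> O(\<lambda>k. real k powr p)"
  obtains C where "\<And>k. 1 \<le> k \<Longrightarrow> u k \<le> C * real k powr p"
proof -
  obtain C where C: "\<forall>\<^sub>F k in at_top. norm (u k) \<le> C * norm (real k powr p)"
    using landau_o.bigE[OF assms] by blast
  then obtain N where N: "\<And>k. N \<le> k \<Longrightarrow> \<bar>u k\<bar> \<le> C * real k powr p"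
    by (auto simp: eventually_at_top_linorder)
  \<comment> \<open>The Landau bound holds only eventually; the added sum covers the finitely many
    remaining indices.\<close>
  define C' where "C' = \<bar>C\<bar> + (\<Sum>k<N. \<bar>u k\<bar> / real k powr p)"
  have "u k \<le> C' * real k powr p" if k: "1 \<le> k" for k
  proof (cases "N \<le> k")
    case True
    have "0 \<le> (\<Sum>k<N. \<bar>u k\<bar> / real k powr p)" by (intro sum_nonneg) auto
    then have "C \<le> C'" by (simp add: C'_def)
    then have "C * real k powr p \<le> C' * real k powr p" by (intro mult_right_mono) auto
    then show ?thesis using N[OF True] by linarith
  next
    case False
    have "\<bar>u k\<bar> / real k powr p \<le> (\<Sum>k<N. \<bar>u k\<bar> / real k powr p)"
      using False by (intro member_le_sum[of k "{..<N}" "\<lambda>k. \<bar>u k\<bar> / real k powr p"]) auto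
    then have "\<bar>u k\<bar> / real k powr p \<le> C'" by (simp add: C'_def)
    then show ?thesis using k by (simp add: field_simps abs_le_iff)
  qed
  then show ?thesis by (rule that)
qed

theorem theorem2p1:
  fixes M :: "'a measure"
    and Y :: "int \<Rightarrow> 'a \<Rightarrow> nat"
    and X :: "int \<Rightarrow> 'a \<Rightarrow> real ^ 'd"
    and f :: "real ^ 'p \<Rightarrow> (nat \<Rightarrow> nat) \<Rightarrow> (nat \<Rightarrow> real ^ 'd) \<Rightarrow> real"
    and g :: "nat \<Rightarrow> real \<Rightarrow> real"
    and eta :: "real \<Rightarrow> real"
    and \<Theta> :: "(real ^ 'p) set"
    and \<theta>s :: "real ^ 'p"
    and a :: real
    and alpha0 :: "nat \<Rightarrow> real"
    and c :: real
    and \<epsilon> :: real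
    and \<theta>hat :: "nat \<Rightarrow> 'a \<Rightarrow> real ^ 'p"
  assumes P: "prob_space M"
    and Theta: "compact \<Theta>" "\<theta>s \<in> \<Theta>"
    and tuning: "a \<ge> 0"
    and measY: "\<And>t. Y t \<in> measurable M (count_space UNIV)"
    and measX: "\<And>t. X t \<in> borel_measurable M"
    and measf: "\<And>\<theta>. \<theta> \<in> \<Theta> \<Longrightarrow> (\<lambda>(y, x). f \<theta> y x)
                  \<in> borel_measurable (PiM UNIV (\<lambda>_. count_space UNIV) \<Otimes>\<^sub>M PiM UNIV (\<lambda>_. borel))"
    \<comment> \<open>g(. | e) is a probability mass function on N_0 for the relevant natural parameters\<close>
    and pmf: "\<And>e. e \<in> eta ` {c..} \<Longrightarrow> (\<forall>y. 0 \<le> g y e) \<and> (\<lambda>y. g y e) sums 1"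
    \<comment> \<open>the model: conditional law and conditional mean of Y_t given F_{t-1}\<close>
    and model_pmf: "\<And>t y. AE \<omega> in M.
        real_cond_exp M (past M Y X (t - 1)) (indicator {\<omega>' \<in> space M. Y t \<omega>' = y}) \<omega>
          = g y (eta (lam f Y X \<theta>s t \<omega>))"
    and model_mean: "\<And>t. AE \<omega> in M.
        real_cond_exp M (past M Y X (t - 1)) (\<lambda>\<omega>'. real (Y t \<omega>')) \<omega> = lam f Y X \<theta>s t \<omega>"
    and support: "\<And>t \<omega> \<theta> \<theta>'. \<omega> \<in> space M \<Longrightarrow> \<theta> \<in> \<Theta> \<Longrightarrow> \<theta>' \<in> \<Theta> \<Longrightarrow>
        {y. g y (eta (lam f Y X \<theta> t \<omega>)) > 0} = {y. g y (eta (lam f Y X \<theta>' t \<omega>)) > 0}"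
    \<comment> \<open>standing assumption: (Y_t, lambda_t, X_t) is stationary and ergodic\<close>
    and stat: "stationary_proc M (count_space UNIV \<Otimes>\<^sub>M (borel \<Otimes>\<^sub>M borel))
                 (\<lambda>t \<omega>. (Y t \<omega>, lam f Y X \<theta>s t \<omega>, X t \<omega>))"
    and erg: "ergodic_proc M (count_space UNIV \<Otimes>\<^sub>M (borel \<Otimes>\<^sub>M borel))
                 (\<lambda>t \<omega>. (Y t \<omega>, lam f Y X \<theta>s t \<omega>, X t \<omega>))"
    \<comment> \<open>moment condition (M) with epsilon > 2\<close>
    and eps: "\<epsilon> > 2"
    and moment: "\<exists>C>0. \<forall>t. (\<integral>\<^sup>+\<omega>. ennreal (max (real (Y t \<omega>)) (max \<bar>lam f Y X \<theta>s t \<omega>\<bar> (supn (X t \<omega>)))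
                         powr (1 + \<epsilon>)) \<partial>M) < ennreal C"
    \<comment> \<open>condition A_0(Theta)\<close>
    and A0T_cont: "\<And>y x. continuous_on \<Theta> (\<lambda>\<theta>. f \<theta> y x)"
    and A0T_bdd: "\<exists>B. \<forall>\<theta>\<in>\<Theta>. \<bar>f \<theta> (\<lambda>_. 0) (\<lambda>_. 0)\<bar> \<le> B"
    and A0T_nonneg: "\<And>k. 0 \<le> alpha0 k"
    and A0T_summ: "summable (\<lambda>k. alpha0 (Suc k))" "(\<Sum>k. alpha0 (Suc k)) < 1"
    and A0T_lip: "\<And>y x y' x'.
        summable (\<lambda>k. alpha0 (Suc k) * (\<bar>real (y (Suc k)) - real (y' (Suc k))\<bar> + supn (x (Suc k) - x' (Suc k))))
        \<Longrightarrow> \<forall>\<theta>\<in>\<Theta>. \<bar>f \<theta> y x - f \<theta> y' x'\<bar>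
              \<le> (\<Sum>k. alpha0 (Suc k) * (\<bar>real (y (Suc k)) - real (y' (Suc k))\<bar> + supn (x (Suc k) - x' (Suc k))))"
    \<comment> \<open>(A0)\<close>
    and A0_ident: "\<And>\<theta> \<theta>'. \<theta> \<in> \<Theta> \<Longrightarrow> \<theta>' \<in> \<Theta> \<Longrightarrow>
        (\<exists>t. AE \<omega> in M. lam f Y X \<theta> t \<omega> = lam f Y X \<theta>' t \<omega>) \<Longrightarrow> \<theta> = \<theta>'"
    and A0_low: "c > 0" "\<And>\<theta> y x. \<theta> \<in> \<Theta> \<Longrightarrow> c \<le> f \<theta> y x"
    \<comment> \<open>(A1)\<close>
    and A1: "\<theta>s \<in> interior \<Theta>"
    \<comment> \<open>(A2)\<close>
    and A2: "\<exists>L. L < \<infinity> \<and> (\<forall>t\<ge>1. (\<integral>\<^sup>+\<omega>. (SUP \<theta>\<in>\<Theta>. ennreal \<bar>lam f Y X \<theta> t \<omega>\<bar>) ^ 4 \<partial>M) = L)"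
    \<comment> \<open>(A3)\<close>
    and A3_diff: "\<And>y. \<exists>g' g''. (\<forall>e. (g y has_real_derivative g' e) (at e)
                                   \<and> (g' has_real_derivative g'' e) (at e)) \<and> continuous_on UNIV g''"
    and A3_ident: "\<And>e e'. (\<forall>y. g y e = g y e') \<Longrightarrow> e = e'"
    \<comment> \<open>(A4), (A5): well-definedness of phi and psi\<close>
    and A4_wd: "\<And>e. summable (\<lambda>y. \<bar>deriv (g y) e\<bar>)"
    and A5_wd: "\<And>t::nat. t \<ge> 1 \<Longrightarrow> AE \<omega> in M. \<forall>e. g (Y (int t) \<omega>) e \<noteq> 0"
    \<comment> \<open>(A4), (A5) bounds together with the rate condition on alpha0 and the summability condition\<close>
    and rates: "\<exists>\<gamma> phib psib. \<gamma> > 1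
        \<and> alpha0 \<in> O(\<lambda>k. real k powr (- \<gamma>))
        \<and> summable (\<lambda>k. real k powr (- \<gamma>) * max (phib k) (psib k))
        \<and> (\<forall>t::nat. t \<ge> 1 \<longrightarrow> phib t > 0 \<and> psib t > 0
            \<and> (\<forall>\<delta>\<in>{0..1}.
                 (\<integral>\<^sup>+\<omega>. (SUP \<theta>\<in>\<Theta>. ennreal (\<Sum>y. \<bar>deriv (g y)
                     (\<delta> * eta (lam f Y X \<theta> (int t) \<omega>) + (1 - \<delta>) * eta (lamhat f Y X \<theta> (int t) \<omega>))\<bar>)) ^ 2 \<partial>M)
                   \<le> ennreal ((phib t)\<^sup>2)
               \<and> (\<integral>\<^sup>+\<omega>. (SUP \<theta>\<in>\<Theta>. ennreal (\<bar>deriv (g (Y (int t) \<omega>))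
                     (\<delta> * eta (lam f Y X \<theta> (int t) \<omega>) + (1 - \<delta>) * eta (lamhat f Y X \<theta> (int t) \<omega>))
                   / g (Y (int t) \<omega>)
                     (\<delta> * eta (lam f Y X \<theta> (int t) \<omega>) + (1 - \<delta>) * eta (lamhat f Y X \<theta> (int t) \<omega>))\<bar>)) ^ 2 \<partial>M)
                   \<le> ennreal ((psib t)\<^sup>2)))"
    \<comment> \<open>(A6)\<close>
    and A6: "\<exists>c_eta>0. \<forall>l\<in>{c..}. \<forall>l'\<in>{c..}. \<bar>eta l - eta l'\<bar> \<le> c_eta * \<bar>l - l'\<bar>"
            "inj_on eta {c..}"
    \<comment> \<open>theta hat: a minimiser of hat H_{a,n} over Theta (any choice)\<close>
    and est: "\<And>n \<omega>. n \<ge> 1 \<Longrightarrow> \<omega> \<in> space M \<Longrightarrow> \<theta>hat n \<omega> \<in> \<Theta> \<and>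
        (\<forall>\<theta>\<in>\<Theta>. Hhat a g eta f Y X n (\<theta>hat n \<omega>) \<omega> \<le> Hhat a g eta f Y X n \<theta> \<omega>)"
  shows "AE \<omega> in M. (\<lambda>n. \<theta>hat n \<omega>) \<longlonglongrightarrow> \<theta>s"
proof -
  interpret prob_space M by (rule P)
  obtain \<gamma> phib psib where \<gamma>: "\<gamma> > 1" and rate: "alpha0 \<in> O(\<lambda>k. real k powr (- \<gamma>))"
    and summ: "summable (\<lambda>k. real k powr (- \<gamma>) * max (phib k) (psib k))"
    and bnds: "\<forall>t::nat. t \<ge> 1 \<longrightarrow> phib t > 0 \<and> psib t > 0
            \<and> (\<forall>\<delta>\<in>{0..1}.
                 (\<integral>\<^sup>+\<omega>. (SUP \<theta>\<in>\<Theta>. ennreal (\<Sum>y. \<bar>deriv (g y)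
                     (\<delta> * eta (lam f Y X \<theta> (int t) \<omega>) + (1 - \<delta>) * eta (lamhat f Y X \<theta> (int t) \<omega>))\<bar>)) ^ 2 \<partial>M)
                   \<le> ennreal ((phib t)\<^sup>2)
               \<and> (\<integral>\<^sup>+\<omega>. (SUP \<theta>\<in>\<Theta>. ennreal (\<bar>deriv (g (Y (int t) \<omega>))
                     (\<delta> * eta (lam f Y X \<theta> (int t) \<omega>) + (1 - \<delta>) * eta (lamhat f Y X \<theta> (int t) \<omega>))
                   / g (Y (int t) \<omega>)
                     (\<delta> * eta (lam f Y X \<theta> (int t) \<omega>) + (1 - \<delta>) * eta (lamhat f Y X \<theta> (int t) \<omega>))\<bar>)) ^ 2 \<partial>M)
                   \<le> ennreal ((psib t)\<^sup>2))"
    using rates by blast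
  obtain C\<alpha> where C\<alpha>: "\<And>k. 1 \<le> k \<Longrightarrow> alpha0 k \<le> C\<alpha> * real k powr (- \<gamma>)"
    using bigo_powr_bound[OF rate] by blast
  obtain c_eta where c_eta: "0 < c_eta" "\<And>l l'. c \<le> l \<Longrightarrow> c \<le> l' \<Longrightarrow> \<bar>eta l - eta l'\<bar> \<le> c_eta * \<bar>l - l'\<bar>"
    using A6(1) by auto
  obtain C where C: "0 < C" and mom: "\<And>t. (\<integral>\<^sup>+\<omega>. ennreal (max (real (Y t \<omega>)) (max \<bar>lam f Y X \<theta>s t \<omega>\<bar> (supn (X t \<omega>)))
                         powr (1 + \<epsilon>)) \<partial>M) < ennreal C"
    using moment by blast
  \<comment> \<open>With \<open>m\<close> the maximum in the moment condition,
    \<open>Y + supn X \<le> 2 * m\<close> and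
    \<open>m ^ 2 \<le> 1 + m powr (1 + \<epsilon>)\<close>, the latter because
    \<open>1 + \<epsilon> \<ge> 2\<close>. Hence the second moment is at most
    \<open>4 * (1 + C)\<close>.\<close>
  define B where "B = sqrt (4 * (1 + C))"
  have B2: "B\<^sup>2 = 4 * (1 + C)" using C by (simp add: B_def)
  have mom2: "(\<integral>\<^sup>+\<omega>. ennreal (real (Y t \<omega>) + supn (X t \<omega>)) ^ 2 \<partial>M) \<le> ennreal (B\<^sup>2)" for t
  proof -
    let ?m = "\<lambda>\<omega>. max (real (Y t \<omega>)) (max \<bar>lam f Y X \<theta>s t \<omega>\<bar> (supn (X t \<omega>)))"
    note [measurable] = measY measX
    have [measurable]: "lam f Y X \<theta>s t \<in> borel_measurable M"
      by (rule measurable_lam(1)) (use measf Theta in auto)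
    have le: "ennreal (real (Y t \<omega>) + supn (X t \<omega>)) ^ 2 \<le> ennreal 4 * (1 + ennreal (?m \<omega> powr (1 + \<epsilon>)))" for \<omega>
    proof -
      have m: "0 \<le> ?m \<omega>" "real (Y t \<omega>) + supn (X t \<omega>) \<le> 2 * ?m \<omega>" by auto
      have "(?m \<omega>)\<^sup>2 \<le> 1 + ?m \<omega> powr (1 + \<epsilon>)"
      proof (cases "?m \<omega> \<le> 1")
        case True
        then have "(?m \<omega>)\<^sup>2 \<le> 1" using m(1) by (intro power_le_one)
        then show ?thesis by (simp add: add_increasing2)
      next
        case False
        then have "(?m \<omega>)\<^sup>2 = ?m \<omega> powr 2" by (subst powr_numeral) auto
        also have "\<dots> \<le> ?m \<omega> powr (1 + \<epsilon>)" using False eps by (intro powr_mono) auto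
        finally show ?thesis by simp
      qed
      moreover have "(real (Y t \<omega>) + supn (X t \<omega>))\<^sup>2 \<le> (2 * ?m \<omega>)\<^sup>2"
        using m supn_nonneg[of "X t \<omega>"] by (intro power_mono) auto
      ultimately have "(real (Y t \<omega>) + supn (X t \<omega>))\<^sup>2 \<le> 4 * (1 + ?m \<omega> powr (1 + \<epsilon>))"
        by (simp add: power_mult_distrib)
      then have "ennreal ((real (Y t \<omega>) + supn (X t \<omega>))\<^sup>2) \<le> ennreal (4 * (1 + ?m \<omega> powr (1 + \<epsilon>)))"
        by (rule ennreal_leI)
      moreover have "ennreal (4 * (1 + ?m \<omega> powr (1 + \<epsilon>))) = ennreal 4 * (1 + ennreal (?m \<omega> powr (1 + \<epsilon>)))"
        by (subst ennreal_mult) auto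
      moreover have "ennreal (real (Y t \<omega>) + supn (X t \<omega>)) ^ 2 = ennreal ((real (Y t \<omega>) + supn (X t \<omega>))\<^sup>2)"
        using supn_nonneg[of "X t \<omega>"] by (intro ennreal_power) auto
      ultimately show ?thesis by (simp only:)
    qed
    have "(\<integral>\<^sup>+\<omega>. ennreal (real (Y t \<omega>) + supn (X t \<omega>)) ^ 2 \<partial>M)
      \<le> (\<integral>\<^sup>+\<omega>. ennreal 4 * (1 + ennreal (?m \<omega> powr (1 + \<epsilon>))) \<partial>M)"
      by (rule nn_integral_mono) (rule le)
    also have "\<dots> = ennreal 4 * (\<integral>\<^sup>+\<omega>. 1 + ennreal (?m \<omega> powr (1 + \<epsilon>)) \<partial>M)"
      by (rule nn_integral_cmult) measurable
    also have "\<dots> = ennreal 4 * (1 + (\<integral>\<^sup>+\<omega>. ennreal (?m \<omega> powr (1 + \<epsilon>)) \<partial>M))"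
      by (subst nn_integral_add) (simp_all add: emeasure_space_1)
    also have "\<dots> \<le> ennreal 4 * (1 + ennreal C)"
      by (intro mult_left_mono add_left_mono less_imp_le[OF mom] zero_le)
    also have "\<dots> = ennreal (B\<^sup>2)"
      unfolding B2 using C by (subst ennreal_mult) auto
    finally show ?thesis .
  qed
  \<comment> \<open>The first derivative given by (A3) is identified with
    \<open>deriv (g y)\<close>; it is continuous because it is itself differentiable.\<close>
  have g_der: "(g y has_real_derivative deriv (g y) e) (at e)" "continuous_on UNIV (deriv (g y))" for y e
  proof -
    obtain g' g'' where d: "\<And>e. (g y has_real_derivative g' e) (at e)" "\<And>e. (g' has_real_derivative g'' e) (at e)"
      using A3_diff[of y] by blast
    have eq: "deriv (g y) = g'" using d(1) by (auto intro!: DERIV_imp_deriv)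
    show "(g y has_real_derivative deriv (g y) e) (at e)" unfolding eq by (rule d)
    show "continuous_on UNIV (deriv (g y))"
      unfolding eq by (rule DERIV_continuous_on[OF has_field_derivative_at_within[OF d(2)]])
  qed
  have "0 \<le> B" using C by (simp add: B_def)
  have "0 < phib t" "0 < psib t"
    "\<delta> \<in> {0..1} \<Longrightarrow> (\<integral>\<^sup>+\<omega>. (SUP \<theta>\<in>\<Theta>. ennreal (\<Sum>y. \<bar>deriv (g y)
        (\<delta> * eta (lam f Y X \<theta> (int t) \<omega>) + (1 - \<delta>) * eta (lamhat f Y X \<theta> (int t) \<omega>))\<bar>)) ^ 2 \<partial>M)
      \<le> ennreal ((phib t)\<^sup>2)"
    "\<delta> \<in> {0..1} \<Longrightarrow> (\<integral>\<^sup>+\<omega>. (SUP \<theta>\<in>\<Theta>. ennreal (\<bar>deriv (g (Y (int t) \<omega>))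
        (\<delta> * eta (lam f Y X \<theta> (int t) \<omega>) + (1 - \<delta>) * eta (lamhat f Y X \<theta> (int t) \<omega>))
      / g (Y (int t) \<omega>)
        (\<delta> * eta (lam f Y X \<theta> (int t) \<omega>) + (1 - \<delta>) * eta (lamhat f Y X \<theta> (int t) \<omega>))\<bar>)) ^ 2 \<partial>M)
      \<le> ennreal ((psib t)\<^sup>2)" if "1 \<le> t" for t \<delta>
    using bnds that by blast+
  interpret dpd_truncated_model M Y X f g eta \<Theta> \<theta>s a c c_eta B alpha0 phib psib \<gamma> C\<alpha>
    by unfold_locales fact+
  show ?thesis by (rule argmin_AE_tendsto) (rule est)
qed

end
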